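(* Let $\gamma>0$ be a constant with $n/N=\gamma$, let $\rho\in(0,1)$ and $\lambda,\mu\ge0$ be constants with $\lambda^2/\gamma\le1$, $\mu^2/\gamma\le1$ and $F(\lambda,\mu,\rho,\gamma)>1+\epsilon$ for some constant $\epsilon>0$. Let $\pi_*$ be the law of a pair $(\mathbb X,\mathbb Y)$ of real random variables with $\mathbb E[\mathbb X]=\mathbb E[\mathbb Y]=0$, $\mathbb E[\mathbb X^2]=\mathbb E[\mathbb Y^2]=1$, $\mathbb E[\mathbb X\mathbb Y]=\rho$ and $\mathbb E[\mathbb X^4],\mathbb E[\mathbb Y^4]\le C$ for an absolute constant $C$. Let $\ell=\ell_n$ satisfy $\ell=\omega(1)$ and $\ell=o(\tfrac{\log n}{\log\log n})$. Fix any constant $0<c<1$ and put $\tau=c\cdot\mathbb E_{\overline{\mathbb P}}[h_{\mathcal G}(\boldsymbol X,\boldsymbol Y)]$. Then, as $n\to\infty$, $$\overline{\mathbb P}\big(h_{\mathcal G}(\boldsymbol X,\boldsymbol Y)\le\tau\big)+\overline{\mathbb Q}\big(h_{\mathcal G}(\boldsymbol X,\boldsymbol Y)\ge\tau\big)=o(1).$$ In particular, the test that outputs $1$ if $h_{\mathcal G}(\boldsymbol X,\boldsymbol Y)\ge\tau$ and $0$ otherwise achieves strong detection between $\overline{\mathbb P}$ and $\overline{\mathbb Q}$.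
   Context: **The function $F$.** $F(\lambda,\mu,\rho,\gamma)=\max\Big\{\frac{\lambda^2}{\gamma},\frac{\mu^2}{\gamma},\frac{\lambda^2\rho^2}{\gamma-\lambda^2+\lambda^2\rho^2}+\frac{\mu^2\rho^2}{\gamma-\mu^2+\mu^2\rho^2}\Big\}$. **Model (correlated spiked Wishart).** The pairs $(x_i,y_i)_{1\le i\le n}$ are i.i.d. from $\pi_*$, $x=(x_i)$, $y=(y_i)\in\mathbb R^n$. Independently, $\boldsymbol u,\boldsymbol v\sim\mathcal N(0,\mathbb I_N)$ are independent and $\boldsymbol W,\boldsymbol Z\in\mathbb R^{n\times N}$ are independent with i.i.d. standard normal entries. $\overline{\mathbb P}$ is the law of $(\boldsymbol X,\boldsymbol Y)$ with $\boldsymbol X=\frac{\sqrt\lambda}{\sqrt n}x\boldsymbol u^\top+\boldsymbol W$, $\boldsymbol Y=\frac{\sqrt\mu}{\sqrt n}y\boldsymbol v^\top+\boldsymbol Z$; $\overline{\mathbb Q}$ is the law of $(\boldsymbol W,\boldsymbol Z)$. Strong detection by a $\{0,1\}$-valued algorithm $\mathcal A$ means $\overline{\mathbb P}(\mathcal A(\boldsymbol X,\boldsymbol Y)=0)+\overline{\mathbb Q}(\mathcal A(\boldsymbol X,\boldsymbol Y)=1)\to0$ as $n\to\infty$. **Decorated bipartite graphs.** A decorated bipartite graph $H$ is a bipartite graph with parts $V^{\mathsf a}(H),V^{\mathsf b}(H)$ and a map $E(H)\to\{\bullet,\circ\}$; $E_\bullet(H),E_\circ(H)$ are the sets of edges with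 decoration $\bullet,\circ$; $V_\bullet(H),V_\circ(H)$ are the sets of vertices incident to at least one edge of $E_\bullet(H)$, resp. $E_\circ(H)$; $\mathsf{diff}(H)=V_\bullet(H)\cap V_\circ(H)$. Isomorphisms preserve edges, decorations and the two parts; $|\mathsf{Aut}(H)|$ is the number of automorphisms. $\mathsf K_{n,N}$ is the complete bipartite graph with parts $[n]$ (the $\mathsf a$ side) and $[N]$ (the $\mathsf b$ side); edges are written $(i,j)$ with $i\in[n],j\in[N]$; $S\subset\mathsf K_{n,N}$ ranges over decorated subgraphs. **Statistic.** $\mathcal G=\mathcal G(\ell)$ is the collection of isomorphism classes of decorated bipartite cycles $H$ of length $2\ell$ with $\mathsf{diff}(H)\subset V^{\mathsf a}(H)$. Set $\Upsilon(H)=\lambda^{|E_\bullet(H)|/2}\mu^{|E_\circ(H)|/2}\rho^{|\mathsf{diff}(H)|}$, $\beta_{\mathcal G}=\sum_{[H]\in\mathcal G}\frac{\Upsilon(H)^2}{|\mathsf{Aut}(H)|}$, $h_S(\boldsymbol X,\boldsymbol Y)=\prod_{(i,j)\in E_\bullet(S)}\boldsymbol X_{i,j}\prod_{(i,j)\in E_\circ(S)}\boldsymbol Y_{i,j}$ and $$h_{\mathcal G}(\boldsymbol X,\boldsymbol Y)=\frac1{\sqrt{n^\ell N^\ell\beta_{\mathcal G}}}\sum_{[H]\in\mathcal G}\Upsilon(H)\sum_{S\subset\mathsf K_{n,N},\,S\cong H}h_S(\boldsymbol X,\boldsymbol Y).$$ *)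

theory Defs
  imports "HOL-Probability.Probability" "HOL-Library.Landau_Symbols"
begin

definition F :: "real \<Rightarrow> real \<Rightarrow> real \<Rightarrow> real \<Rightarrow> real" where
  "F lam \<mu> \<rho> \<gamma> =
     max (lam^2 / \<gamma>) (max (\<mu>^2 / \<gamma>)
       (lam^2 * \<rho>^2 / (\<gamma> - lam^2 + lam^2 * \<rho>^2) + \<mu>^2 * \<rho>^2 / (\<gamma> - \<mu>^2 + \<mu>^2 * \<rho>^2)))"


section \<open>Correlated spiked Wishart model\<close>

text \<open>The index sets [n] and [N] are rendered as \<open>{..<n}\<close> and \<open>{..<N}\<close>; an n x N matrix is an
  extensional function on \<open>{..<n} \<times> {..<N}\<close>.\<close>

type_synonym rmatrix = "nat \<times> nat \<Rightarrow> real"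

definition std_normal :: "real measure" where
  "std_normal = density lborel std_normal_density"

definition gauss_vector :: "nat \<Rightarrow> (nat \<Rightarrow> real) measure" where
  "gauss_vector N = PiM {..<N} (\<lambda>_. std_normal)"

definition gauss_matrix :: "nat \<Rightarrow> nat \<Rightarrow> rmatrix measure" where
  "gauss_matrix n N = PiM ({..<n} \<times> {..<N}) (\<lambda>_. std_normal)"

definition matrix_space :: "nat \<Rightarrow> nat \<Rightarrow> rmatrix measure" where
  "matrix_space n N = PiM ({..<n} \<times> {..<N}) (\<lambda>_. borel)"

definition spiked_matrix ::
    "nat \<Rightarrow> nat \<Rightarrow> real \<Rightarrow> (nat \<Rightarrow> real) \<Rightarrow> (nat \<Rightarrow> real) \<Rightarrow> rmatrix \<Rightarrow> rmatrix" where
  "spiked_matrix n N lam x u W =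
     (\<lambda>(i, j) \<in> {..<n} \<times> {..<N}. sqrt lam / sqrt (real n) * x i * u j + W (i, j))"

definition law_Q :: "nat \<Rightarrow> nat \<Rightarrow> (rmatrix \<times> rmatrix) measure" where
  "law_Q n N = gauss_matrix n N \<Otimes>\<^sub>M gauss_matrix n N"

text \<open>The sample \<open>xy\<close> is the vector of the i.i.d. pairs \<open>(x i, y i)\<close> with common law \<open>\<pi>\<close>; it
  is independent of \<open>u\<close>, \<open>v\<close>, \<open>W\<close> and \<open>Z\<close>, which are independent of one another.\<close>

definition law_P ::
    "(real \<times> real) measure \<Rightarrow> real \<Rightarrow> real \<Rightarrow> nat \<Rightarrow> nat \<Rightarrow> (rmatrix \<times> rmatrix) measure" where
  "law_P \<pi> lam \<mu> n N =
     distr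
       (PiM {..<n} (\<lambda>_. \<pi>) \<Otimes>\<^sub>M ((gauss_vector N \<Otimes>\<^sub>M gauss_vector N) \<Otimes>\<^sub>M
         (gauss_matrix n N \<Otimes>\<^sub>M gauss_matrix n N)))
       (matrix_space n N \<Otimes>\<^sub>M matrix_space n N)
       (\<lambda>(xy, (u, v), (W, Z)).
          (spiked_matrix n N lam (\<lambda>i. fst (xy i)) u W,
           spiked_matrix n N \<mu> (\<lambda>i. snd (xy i)) v Z))"

definition strong_detection ::
    "(nat \<Rightarrow> 'a measure) \<Rightarrow> (nat \<Rightarrow> 'a measure) \<Rightarrow> (nat \<Rightarrow> 'a \<Rightarrow> nat) \<Rightarrow> bool" where
  "strong_detection P Q A \<longleftrightarrow>
     (\<forall>k. A k \<in> P k \<rightarrow>\<^sub>M count_space {0, 1} \<and> A k \<in> Q k \<rightarrow>\<^sub>M count_space {0, 1}) \<and>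
     (\<lambda>k. \<P>(\<omega> in P k. A k \<omega> = 0) + \<P>(\<omega> in Q k. A k \<omega> = 1)) \<longlonglongrightarrow> 0"


section \<open>Decorated bipartite graphs\<close>

datatype decoration = Bullet | Circ

text \<open>The edge set together with its decoration map is one partial function, whose domain is the
  edge set. An edge is a pair of an a-vertex and a b-vertex; the parts may have different types.\<close>

record ('a, 'b) dgraph =
  Va :: "'a set"
  Vb :: "'b set"
  deco :: "'a \<times> 'b \<rightharpoonup> decoration"

definition dgraph_wf :: "('a, 'b) dgraph \<Rightarrow> bool" where
  "dgraph_wf H \<longleftrightarrow> finite (Va H) \<and> finite (Vb H) \<and> dom (deco H) \<subseteq> Va H \<times> Vb H"

definition edges :: "('a, 'b) dgraph \<Rightarrow> ('a \<times> 'b) set" where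
  "edges H = dom (deco H)"

definition edges_of :: "decoration \<Rightarrow> ('a, 'b) dgraph \<Rightarrow> ('a \<times> 'b) set" where
  "edges_of d H = {e. deco H e = Some d}"

definition verts_of :: "decoration \<Rightarrow> ('a, 'b) dgraph \<Rightarrow> ('a + 'b) set" where
  "verts_of d H = (\<Union>(a, b) \<in> edges_of d H. {Inl a, Inr b})"

definition diff :: "('a, 'b) dgraph \<Rightarrow> ('a + 'b) set" where
  "diff H = verts_of Bullet H \<inter> verts_of Circ H"

definition is_iso ::
    "('a, 'b) dgraph \<Rightarrow> ('c, 'd) dgraph \<Rightarrow> ('a \<Rightarrow> 'c) \<Rightarrow> ('b \<Rightarrow> 'd) \<Rightarrow> bool" where
  "is_iso H H' f g \<longleftrightarrow>
     bij_betw f (Va H) (Va H') \<and> bij_betw g (Vb H) (Vb H') \<and>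
     (\<forall>a \<in> Va H. \<forall>b \<in> Vb H. deco H' (f a, g b) = deco H (a, b))"

definition isomorphic :: "('a, 'b) dgraph \<Rightarrow> ('c, 'd) dgraph \<Rightarrow> bool" (infix "\<simeq>\<^sub>D" 50) where
  "H \<simeq>\<^sub>D H' \<longleftrightarrow> (\<exists>f g. is_iso H H' f g)"

text \<open>Extensionality makes each automorphism be counted once.\<close>

definition Aut :: "('a, 'b) dgraph \<Rightarrow> (('a \<Rightarrow> 'a) \<times> ('b \<Rightarrow> 'b)) set" where
  "Aut H = {(f, g). f \<in> extensional (Va H) \<and> g \<in> extensional (Vb H) \<and> is_iso H H f g}"

text \<open>A bipartite cycle of length 2l visits \<open>a 0, b 0, a 1, b 1, \<dots>, a (l-1), b (l-1)\<close> and
  returns to \<open>a 0\<close>.\<close>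

definition dcycle :: "nat \<Rightarrow> ('a, 'b) dgraph \<Rightarrow> bool" where
  "dcycle l H \<longleftrightarrow> 2 \<le> l \<and>
     (\<exists>a b. bij_betw a {..<l} (Va H) \<and> bij_betw b {..<l} (Vb H) \<and>
        edges H = (\<Union>i<l. {(a i, b i), (a (Suc i mod l), b i)}))"

definition iso_rel :: "(('a, 'b) dgraph \<times> ('a, 'b) dgraph) set" where
  "iso_rel = {(H, H'). dgraph_wf H \<and> dgraph_wf H' \<and> H \<simeq>\<^sub>D H'}"

text \<open>Vertices of class representatives are natural numbers, so every finite decorated graph is
  represented.\<close>

definition cycle_classes :: "nat \<Rightarrow> (nat, nat) dgraph set set" where
  "cycle_classes l = {H. dcycle l H \<and> diff H \<subseteq> Inl ` Va H} // iso_rel"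

definition rep :: "('a, 'b) dgraph set \<Rightarrow> ('a, 'b) dgraph" where
  "rep c = (SOME H. H \<in> c)"

text \<open>Decorated subgraphs of the complete bipartite graph with parts [n] and [N].\<close>

definition subgraphs_K :: "nat \<Rightarrow> nat \<Rightarrow> (nat, nat) dgraph set" where
  "subgraphs_K n N = {S. dgraph_wf S \<and> Va S \<subseteq> {..<n} \<and> Vb S \<subseteq> {..<N}}"


section \<open>The cycle statistic\<close>

text \<open>\<open>sqrt lam ^ m\<close> stands for lam to the power m/2; unlike \<open>powr\<close> it gives 1 for
  \<open>lam = 0\<close>, \<open>m = 0\<close>.\<close>

definition Upsilon :: "real \<Rightarrow> real \<Rightarrow> real \<Rightarrow> ('a, 'b) dgraph \<Rightarrow> real" where
  "Upsilon lam \<mu> \<rho> H =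
     sqrt lam ^ card (edges_of Bullet H) * sqrt \<mu> ^ card (edges_of Circ H) * \<rho> ^ card (diff H)"

definition beta :: "real \<Rightarrow> real \<Rightarrow> real \<Rightarrow> nat \<Rightarrow> real" where
  "beta lam \<mu> \<rho> l =
     (\<Sum>c \<in> cycle_classes l. (Upsilon lam \<mu> \<rho> (rep c))^2 / real (card (Aut (rep c))))"

definition h_sub :: "(nat, nat) dgraph \<Rightarrow> rmatrix \<times> rmatrix \<Rightarrow> real" where
  "h_sub S = (\<lambda>(X, Y). (\<Prod>e \<in> edges_of Bullet S. X e) * (\<Prod>e \<in> edges_of Circ S. Y e))"

definition h_stat ::
    "real \<Rightarrow> real \<Rightarrow> real \<Rightarrow> nat \<Rightarrow> nat \<Rightarrow> nat \<Rightarrow> rmatrix \<times> rmatrix \<Rightarrow> real" where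
  "h_stat lam \<mu> \<rho> l n N XY =
     1 / sqrt (real n ^ l * real N ^ l * beta lam \<mu> \<rho> l) *
     (\<Sum>c \<in> cycle_classes l. Upsilon lam \<mu> \<rho> (rep c) *
        (\<Sum>S \<in> {S \<in> subgraphs_K n N. S \<simeq>\<^sub>D rep c}. h_sub S XY))"

end

theory Submission
  imports Defs "HOL-Real_Asymp.Real_Asymp"
begin

text \<open>
  A cycle in \<open>\<G>\<close> is a closed walk through a-vertices whose b-vertices are coloured by a word \<open>w\<close>, and
  its squared weight is a product of transfer matrix entries along \<open>w\<close>; the condition \<open>F > 1\<close> says that
  the Perron eigenvalue of the transfer matrix exceeds \<open>\<gamma>\<close>. Let \<open>H\<close> be the unnormalised statistic and
  \<open>A\<close> the sum of the squared weights of all cycles. Then \<open>H\<close> has second moment \<open>A\<close> under the null law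
  and mean \<open>A / n\<^sup>l\<close> under the planted law, and \<open>A / n\<^bsup>2l\<^esup>\<close> grows at least like \<open>\<kappa>\<^sup>l / l\<^sup>2\<close> with
  \<open>\<kappa> > 1\<close>. This settles the null law.

  For the planted variance, vertex-disjoint pairs of cycles are uncorrelated, the diagonal contributes
  \<open>O(A)\<close>, and distinct cycles that meet share fewer edges than vertices, so that they contribute a
  relative error \<open>(K l)\<^bsup>O(l)\<^esup> / n\<close>. It vanishes because \<open>l = o(log n / log log n)\<close>. Chebyshev's
  inequality concludes. The positive normalisation of the statistic plays no role.
\<close>

text \<open>The two parts of the planted variance demand different precision. Relative to the
  squared mean, the diagonal costs \<open>E h_S^2\<close> times \<open>n^(2l) / A\<close>, and the
  latter is only known to be of order l^2 / \<kappa>^l, where \<kappa> may be close to 1. A bound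
  K^l for \<open>E h_S^2\<close> would be useless, so the diagonal is estimated by factors 1 +
  O(n^(-1/2)) per vertex, whose product stays bounded. For cycles that meet, a full factor 1/n is at
  hand, and any constant to the power l may be lost; moments are then bounded crudely, vertex by
  vertex.

  Cycles are counted through triples of two injections and a word. Each cycle comes from at least
  one and at most l^2 triples, a polynomial loss that \<kappa>^l absorbs.

  Spectral theory is replaced by a test vector. Since the squares of lam and \<mu> are at most
  \<gamma>, F > 1 amounts to det(\<gamma> I - T) < 0 for the 2 x 2 transfer matrix T. This leaves
  room for a positive vector that T expands by more than \<gamma> in both rows, and iterating the
  inequality along a word gives the growth.\<close>

section \<open>Parametrised cycles\<close>

text \<open>The word \<open>w\<close> decorates b-vertices: both edges at \<open>b i\<close> carry \<open>w i\<close>, which is what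
  \<open>diff H \<subseteq> Inl ` Va H\<close> demands.\<close>

definition cycle_graph ::
    "nat \<Rightarrow> (nat \<Rightarrow> 'a) \<Rightarrow> (nat \<Rightarrow> 'b) \<Rightarrow> (nat \<Rightarrow> decoration) \<Rightarrow> ('a, 'b) dgraph" where
  "cycle_graph l a b w = \<lparr>Va = a ` {..<l}, Vb = b ` {..<l},
     deco = (\<lambda>(p, q). if \<exists>i<l. q = b i \<and> (p = a i \<or> p = a (Suc i mod l))
                      then Some (w (THE i. i < l \<and> q = b i)) else None)\<rparr>"

lemma Va_cycle_graph [simp]: "Va (cycle_graph l a b w) = a ` {..<l}"
  and Vb_cycle_graph [simp]: "Vb (cycle_graph l a b w) = b ` {..<l}"
  by (simp_all add: cycle_graph_def)

text \<open>Injectivity of \<open>b\<close> makes the index chosen by \<open>THE\<close> unique, so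
  the decoration can be read off from any index that witnesses the edge.\<close>

lemma deco_cycle_graph:
  assumes "inj_on b {..<l}"
  shows "deco (cycle_graph l a b w) (p, q) = Some d \<longleftrightarrow>
    (\<exists>i<l. q = b i \<and> (p = a i \<or> p = a (Suc i mod l)) \<and> d = w i)"
proof -
  have "(THE k. k < l \<and> b i = b k) = i" if "i < l" for i
    using that assms by (intro the_equality) (auto dest: inj_onD)
  then show ?thesis
    by (auto simp: cycle_graph_def)
qed

lemma dgraph_eqI:
  fixes H H' :: "('a, 'b) dgraph"
  assumes "Va H = Va H'" "Vb H = Vb H'"
    and "\<And>p q d. deco H (p, q) = Some d \<longleftrightarrow> deco H' (p, q) = Some d"
  shows "H = H'"
proof -
  have "deco H e = deco H' e" for e
    using assms(3)[of "fst e" "snd e"] by (metis not_None_eq prod.collapse)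
  then show ?thesis using assms(1,2) by (intro dgraph.equality) auto
qed

lemma dgraph_wf_cycle_graph: "dgraph_wf (cycle_graph l a b w)"
  by (force simp: dgraph_wf_def cycle_graph_def split: if_splits)

lemma edges_of_cycle_graph:
  assumes "inj_on b {..<l}"
  shows "edges_of d (cycle_graph l a b w) =
    (\<Union>i \<in> {i. i < l \<and> w i = d}. {(a i, b i), (a (Suc i mod l), b i)})"
  using deco_cycle_graph[OF assms, of a w _ _ d] by (auto simp: edges_of_def)

lemma Suc_mod_neq:
  assumes "2 \<le> l" "i < l"
  shows "Suc i mod l \<noteq> i" "Suc i mod l < l"
  using assms by (auto simp: mod_Suc)

lemma verts_of_iff:
  "Inl p \<in> verts_of d H \<longleftrightarrow> (\<exists>q. deco H (p, q) = Some d)"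
  "Inr q \<in> verts_of d H \<longleftrightarrow> (\<exists>p. deco H (p, q) = Some d)"
  by (auto simp: verts_of_def edges_of_def)

lemma Inr_in_diff_iff:
  "Inr q \<in> diff H \<longleftrightarrow> (\<exists>p p'. deco H (p, q) = Some Bullet \<and> deco H (p', q) = Some Circ)"
  by (auto simp: diff_def verts_of_iff)

lemma Inl_in_diff_iff:
  "Inl p \<in> diff H \<longleftrightarrow> (\<exists>q q'. deco H (p, q) = Some Bullet \<and> deco H (p, q') = Some Circ)"
  by (auto simp: diff_def verts_of_iff)

lemma cycle_graph_edges:
  assumes "inj_on b {..<l}"
  shows "edges (cycle_graph l a b w) = (\<Union>i<l. {(a i, b i), (a (Suc i mod l), b i)})"
  using deco_cycle_graph[OF assms, of a w] by (fastforce simp: edges_def dom_def)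

lemma dcycle_cycle_graph:
  assumes "2 \<le> l" "inj_on a {..<l}" "inj_on b {..<l}"
  shows "dcycle l (cycle_graph l a b w)"
  unfolding dcycle_def using assms
  by (intro conjI exI[of _ a] exI[of _ b] cycle_graph_edges) (auto simp: bij_betw_def)

text \<open>The neighbours of \<open>a (Suc i mod l)\<close> are \<open>b i\<close> and
  \<open>b (Suc i mod l)\<close>, so this vertex sees both decorations exactly when the word changes
  from position \<open>i\<close> to the next one.\<close>

lemma diff_cycle_graph:
  assumes "2 \<le> l" "inj_on a {..<l}" "inj_on b {..<l}"
  shows "diff (cycle_graph l a b w) =
    (\<lambda>i. Inl (a (Suc i mod l))) ` {i. i < l \<and> w i \<noteq> w (Suc i mod l)}"
proof -
  have aeq: "a i = a j \<longleftrightarrow> i = j" if "i < l" "j < l" for i j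
    using that assms(2) by (auto dest: inj_onD)
  have beq: "b i = b j \<longleftrightarrow> i = j" if "i < l" "j < l" for i j
    using that assms(3) by (auto dest: inj_onD)
  note D = deco_cycle_graph[OF assms(3), of a w]
  have m: "Suc i mod l < l" for i using assms(1) by simp
  have dneq: "x \<noteq> y \<longleftrightarrow> (x = Bullet \<and> y = Circ) \<or> (x = Circ \<and> y = Bullet)" for x y
    by (cases x; cases y) auto
  have sinj: "i = j" if "Suc i mod l = Suc j mod l" "i < l" "j < l" for i j
    using that by (auto simp: mod_Suc split: if_splits)
  show ?thesis
  proof (rule set_eqI)
    fix z
    show "z \<in> diff (cycle_graph l a b w) \<longleftrightarrow>
      z \<in> (\<lambda>i. Inl (a (Suc i mod l))) ` {i. i < l \<and> w i \<noteq> w (Suc i mod l)}"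
    proof (cases z)
      case (Inr q)
      have "z \<notin> diff (cycle_graph l a b w)"
        unfolding Inr Inr_in_diff_iff D using beq by auto
      then show ?thesis using Inr by auto
    next
      case (Inl p)
      have "z \<in> diff (cycle_graph l a b w) \<longleftrightarrow>
         (\<exists>i<l. \<exists>j<l. (p = a i \<or> p = a (Suc i mod l)) \<and> (p = a j \<or> p = a (Suc j mod l))
            \<and> w i = Bullet \<and> w j = Circ)"
        unfolding Inl Inl_in_diff_iff D by metis
      also have "\<dots> \<longleftrightarrow> (\<exists>i<l. p = a (Suc i mod l) \<and> w i \<noteq> w (Suc i mod l))"
      proof
        assume "\<exists>i<l. \<exists>j<l. (p = a i \<or> p = a (Suc i mod l)) \<and> (p = a j \<or> p = a (Suc j mod l))
            \<and> w i = Bullet \<and> w j = Circ"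
        then obtain i j where ij: "i < l" "j < l" "p = a i \<or> p = a (Suc i mod l)"
          "p = a j \<or> p = a (Suc j mod l)" "w i = Bullet" "w j = Circ" by blast
        have ne: "i \<noteq> j" using ij by auto
        \<comment> \<open>Two different b-vertices with a common neighbour \<open>p\<close> are
          cyclically consecutive: \<open>sinj\<close> rules out that \<open>p\<close> is the forward
          neighbour of both.\<close>
        then have "(p = a i \<and> i = Suc j mod l) \<or> (p = a j \<and> j = Suc i mod l)"
          using ij aeq m sinj by metis
        then show "\<exists>i<l. p = a (Suc i mod l) \<and> w i \<noteq> w (Suc i mod l)"
          using ij by force
      next
        assume "\<exists>i<l. p = a (Suc i mod l) \<and> w i \<noteq> w (Suc i mod l)"
        then obtain i where i: "i < l" "p = a (Suc i mod l)" "w i \<noteq> w (Suc i mod l)" by blast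
        then show "\<exists>i<l. \<exists>j<l. (p = a i \<or> p = a (Suc i mod l)) \<and> (p = a j \<or> p = a (Suc j mod l))
            \<and> w i = Bullet \<and> w j = Circ"
          using i(1,2) m[of i] dneq[THEN iffD1, OF i(3)] by (elim disjE) blast+
      qed
      finally show ?thesis using Inl by auto
    qed
  qed
qed

text \<open>If no b-vertex lies in \<open>diff H\<close>, the two edges at \<open>b i\<close> agree,
  so the decoration of the edge \<open>(a i, b i)\<close> is a letter attached to
  \<open>b i\<close>. This is where the word comes from.\<close>

lemma good_cycle_iff:
  assumes "2 \<le> l"
  shows "dcycle l H \<and> diff H \<subseteq> Inl ` Va H \<longleftrightarrow>
    (\<exists>a b w. inj_on a {..<l} \<and> inj_on b {..<l} \<and> H = cycle_graph l a b w)"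
proof
  assume H: "dcycle l H \<and> diff H \<subseteq> Inl ` Va H"
  then obtain a b where ab: "bij_betw a {..<l} (Va H)" "bij_betw b {..<l} (Vb H)"
    and E: "edges H = (\<Union>i<l. {(a i, b i), (a (Suc i mod l), b i)})"
    by (auto simp: dcycle_def)
  have inj: "inj_on a {..<l}" "inj_on b {..<l}"
    using ab by (auto simp: bij_betw_def)
  define w where "w = (\<lambda>i. the (deco H (a i, b i)))"
  have ex: "(\<exists>d. deco H (p, q) = Some d) \<longleftrightarrow>
      (\<exists>i<l. q = b i \<and> (p = a i \<or> p = a (Suc i mod l)))" for p q
  proof -
    have "(\<exists>d. deco H (p, q) = Some d) \<longleftrightarrow> (p, q) \<in> edges H" by (auto simp: edges_def)
    then show ?thesis unfolding E by auto
  qed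
  have same: "d = d'" if "deco H (p, q) = Some d" "deco H (p', q) = Some d'" for p p' q d d'
  proof -
    have "Inr q \<notin> diff H" using H by auto
    then show ?thesis using that unfolding Inr_in_diff_iff by (metis (full_types) decoration.exhaust)
  qed
  have "H = cycle_graph l a b w"
  proof (rule dgraph_eqI)
    fix p q d
    show "deco H (p, q) = Some d \<longleftrightarrow> deco (cycle_graph l a b w) (p, q) = Some d"
      unfolding deco_cycle_graph[OF inj(2)]
    proof
      assume d: "deco H (p, q) = Some d"
      then obtain i where i: "i < l" "q = b i" "p = a i \<or> p = a (Suc i mod l)" using ex by blast
      then obtain d' where d': "deco H (a i, b i) = Some d'" using ex by blast
      then have "d = w i" using same[OF d, of "a i" d'] i by (simp add: w_def)
      then show "\<exists>i<l. q = b i \<and> (p = a i \<or> p = a (Suc i mod l)) \<and> d = w i" using i by blast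
    next
      assume "\<exists>i<l. q = b i \<and> (p = a i \<or> p = a (Suc i mod l)) \<and> d = w i"
      then obtain i where i: "i < l" "q = b i" "p = a i \<or> p = a (Suc i mod l)" "d = w i" by blast
      then obtain d1 d2 where "deco H (a i, b i) = Some d1" "deco H (p, q) = Some d2"
        using ex by blast
      then show "deco H (p, q) = Some d" using same i by (fastforce simp: w_def)
    qed
  qed (use ab in \<open>auto simp: bij_betw_def\<close>)
  then show "\<exists>a b w. inj_on a {..<l} \<and> inj_on b {..<l} \<and> H = cycle_graph l a b w"
    using inj by blast
next
  assume "\<exists>a b w. inj_on a {..<l} \<and> inj_on b {..<l} \<and> H = cycle_graph l a b w"
  then obtain a b w where *: "inj_on a {..<l}" "inj_on b {..<l}" "H = cycle_graph l a b w" by blast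
  show "dcycle l H \<and> diff H \<subseteq> Inl ` Va H"
    using dcycle_cycle_graph[OF assms *(1,2)] diff_cycle_graph[OF assms *(1,2)] *(3) assms by auto
qed

text \<open>An isomorphism transports both vertex sequences and keeps the word, so whatever depends
  on the word alone, in particular \<open>Upsilon\<close>, is constant on isomorphism
  classes.\<close>

lemma is_iso_cycle_graph:
  assumes "2 \<le> l" "inj_on a {..<l}" "inj_on b {..<l}" "is_iso (cycle_graph l a b w) S f g" "dgraph_wf S"
  shows "inj_on (f \<circ> a) {..<l}" "inj_on (g \<circ> b) {..<l}" "S = cycle_graph l (f \<circ> a) (g \<circ> b) w"
proof -
  have f: "bij_betw f (a ` {..<l}) (Va S)" and g: "bij_betw g (b ` {..<l}) (Vb S)"
    and D: "\<And>i j. i < l \<Longrightarrow> j < l \<Longrightarrow> deco S (f (a i), g (b j)) = deco (cycle_graph l a b w) (a i, b j)"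
    using assms(4) by (auto simp: is_iso_def)
  show 1: "inj_on (f \<circ> a) {..<l}" and 2: "inj_on (g \<circ> b) {..<l}"
    using f g assms(2,3) by (auto simp: bij_betw_def intro: comp_inj_on)
  have V: "Va S = f ` a ` {..<l}" "Vb S = g ` b ` {..<l}" using f g by (auto simp: bij_betw_def)
  have aeq: "a i = a j \<longleftrightarrow> i = j" if "i < l" "j < l" for i j
    using that assms(2) by (auto dest: inj_onD)
  have beq: "b i = b j \<longleftrightarrow> i = j" if "i < l" "j < l" for i j
    using that assms(3) by (auto dest: inj_onD)
  have m: "Suc i mod l < l" for i using assms(1) by simp
  have fa: "f (a i) = f (a j) \<longleftrightarrow> i = j" if "i < l" "j < l" for i j
    using that 1 by (auto simp: inj_on_def)
  have gb: "g (b i) = g (b j) \<longleftrightarrow> i = j" if "i < l" "j < l" for i j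
    using that 2 by (auto simp: inj_on_def)
  show "S = cycle_graph l (f \<circ> a) (g \<circ> b) w"
  proof (rule dgraph_eqI)
    fix p q d
    show "deco S (p, q) = Some d \<longleftrightarrow> deco (cycle_graph l (f \<circ> a) (g \<circ> b) w) (p, q) = Some d"
    proof (cases "p \<in> Va S \<and> q \<in> Vb S")
      \<comment> \<open>\<open>is_iso\<close> compares decorations on pairs of vertices only;
        well-formedness of \<open>S\<close> excludes edges elsewhere.\<close>
      case False
      then have "deco S (p, q) \<noteq> Some d" using assms(5) by (auto simp: dgraph_wf_def dom_def)
      moreover have "deco (cycle_graph l (f \<circ> a) (g \<circ> b) w) (p, q) \<noteq> Some d"
        using False m unfolding deco_cycle_graph[OF 2] V by auto
      ultimately show ?thesis by blast
    next
      case True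
      then obtain i j where ij: "i < l" "j < l" "p = f (a i)" "q = g (b j)" unfolding V by blast
      have "deco S (p, q) = Some d \<longleftrightarrow> (\<exists>k<l. b j = b k \<and> (a i = a k \<or> a i = a (Suc k mod l)) \<and> d = w k)"
        unfolding ij(3,4) D[OF ij(1,2)] deco_cycle_graph[OF assms(3)] ..
      also have "\<dots> \<longleftrightarrow> (\<exists>k<l. g (b j) = g (b k) \<and> (f (a i) = f (a k) \<or> f (a i) = f (a (Suc k mod l))) \<and> d = w k)"
        using ij aeq beq fa gb m by auto
      finally show ?thesis unfolding deco_cycle_graph[OF 2] ij(3,4) by auto
    qed
  qed (use V in \<open>auto simp: image_comp\<close>)
qed

lemma cycle_graph_isomorphic:
  assumes "2 \<le> l" "inj_on a {..<l}" "inj_on b {..<l}" "inj_on a' {..<l}" "inj_on b' {..<l}"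
  shows "cycle_graph l a b w \<simeq>\<^sub>D cycle_graph l a' b' w"
proof -
  define f where "f = a' \<circ> inv_into {..<l} a"
  define g where "g = b' \<circ> inv_into {..<l} b"
  have fa: "f (a i) = a' i" and gb: "g (b i) = b' i" if "i < l" for i
    using that assms by (auto simp: f_def g_def)
  have aeq: "a i = a j \<longleftrightarrow> i = j" "a' i = a' j \<longleftrightarrow> i = j" "b i = b j \<longleftrightarrow> i = j" "b' i = b' j \<longleftrightarrow> i = j"
    if "i < l" "j < l" for i j
    using that assms by (auto dest: inj_onD)
  have m: "Suc i mod l < l" for i using assms(1) by simp
  have "is_iso (cycle_graph l a b w) (cycle_graph l a' b' w) f g"
    unfolding is_iso_def
  proof (intro conjI ballI)
    show "bij_betw f (Va (cycle_graph l a b w)) (Va (cycle_graph l a' b' w))"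
      by (auto simp: bij_betw_def inj_on_def fa aeq image_iff)
    show "bij_betw g (Vb (cycle_graph l a b w)) (Vb (cycle_graph l a' b' w))"
      by (auto simp: bij_betw_def inj_on_def gb aeq image_iff)
    fix p q assume "p \<in> Va (cycle_graph l a b w)" "q \<in> Vb (cycle_graph l a b w)"
    then obtain i j where ij: "i < l" "j < l" "p = a i" "q = b j" by auto
    have "deco (cycle_graph l a' b' w) (f p, g q) = Some d \<longleftrightarrow>
          deco (cycle_graph l a b w) (p, q) = Some d" for d
      unfolding deco_cycle_graph[OF assms(3)] deco_cycle_graph[OF assms(5)] ij(3,4)
        fa[OF ij(1)] gb[OF ij(2)] using ij(1,2) aeq m by auto
    then show "deco (cycle_graph l a' b' w) (f p, g q) = deco (cycle_graph l a b w) (p, q)"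
      by (metis not_None_eq)
  qed
  then show ?thesis by (auto simp: isomorphic_def)
qed

text \<open>\<open>Upsilon\<close> of a cycle as a function of its word. A letter stands for two
  edges of the same decoration, which turns \<open>sqrt lam ^ 2\<close> into \<open>lam\<close>;
  each change of letter along the closed word is one vertex of \<open>diff\<close>.\<close>

definition word_weight :: "real \<Rightarrow> real \<Rightarrow> real \<Rightarrow> nat \<Rightarrow> (nat \<Rightarrow> decoration) \<Rightarrow> real" where
  "word_weight lam \<mu> \<rho> l w = (\<Prod>i<l. (case w i of Bullet \<Rightarrow> lam | Circ \<Rightarrow> \<mu>) *
     (if w i = w (Suc i mod l) then 1 else \<rho>))"

lemma card_edges_of_cycle_graph:
  assumes "2 \<le> l" "inj_on a {..<l}" "inj_on b {..<l}"
  shows "card (edges_of d (cycle_graph l a b w)) = 2 * card {i. i < l \<and> w i = d}"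
proof -
  have "card (\<Union>i \<in> {i. i < l \<and> w i = d}. {(a i, b i), (a (Suc i mod l), b i)}) =
      (\<Sum>i \<in> {i. i < l \<and> w i = d}. card {(a i, b i), (a (Suc i mod l), b i)})"
    using assms(3) by (intro card_UN_disjoint) (auto dest: inj_onD)
  also have "\<dots> = (\<Sum>i \<in> {i. i < l \<and> w i = d}. 2)"
  proof (intro sum.cong refl)
    fix i assume "i \<in> {i. i < l \<and> w i = d}"
    then have "a i \<noteq> a (Suc i mod l)"
      using Suc_mod_neq[OF assms(1), of i] inj_onD[OF assms(2), of i "Suc i mod l"] by fastforce
    then show "card {(a i, b i), (a (Suc i mod l), b i)} = 2" by simp
  qed
  finally show ?thesis by (simp add: edges_of_cycle_graph[OF assms(3)])
qed

lemma card_edges_cycle_graph: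
  assumes "2 \<le> l" "inj_on a {..<l}" "inj_on b {..<l}"
  shows "card (edges_of Bullet (cycle_graph l a b w)) + card (edges_of Circ (cycle_graph l a b w)) = 2 * l"
proof -
  have "card {i. i < l \<and> w i = Bullet} + card {i. i < l \<and> w i = Circ} =
      card ({i. i < l \<and> w i = Bullet} \<union> {i. i < l \<and> w i = Circ})"
    by (rule card_Un_disjoint[symmetric]) auto
  also have "{i. i < l \<and> w i = Bullet} \<union> {i. i < l \<and> w i = Circ} = {..<l}"
    by (auto, metis decoration.exhaust)
  finally show ?thesis
    unfolding card_edges_of_cycle_graph[OF assms] by simp
qed

lemma Upsilon_cycle_graph:
  assumes "2 \<le> l" "inj_on a {..<l}" "inj_on b {..<l}" "lam \<ge> 0" "\<mu> \<ge> 0"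
  shows "Upsilon lam \<mu> \<rho> (cycle_graph l a b w) = word_weight lam \<mu> \<rho> l w"
proof -
  have inj: "inj_on (\<lambda>i. Inl (a (Suc i mod l)) :: 'a + 'b) {i. i < l \<and> w i \<noteq> w (Suc i mod l)}"
  proof (rule inj_onI)
    fix i j assume *: "i \<in> {i. i < l \<and> w i \<noteq> w (Suc i mod l)}" "j \<in> {i. i < l \<and> w i \<noteq> w (Suc i mod l)}"
      "(Inl (a (Suc i mod l)) :: 'a + 'b) = Inl (a (Suc j mod l))"
    then have "Suc i mod l = Suc j mod l" using assms(1,2) by (auto dest: inj_onD)
    then show "i = j" using * by (auto simp: mod_Suc split: if_splits)
  qed
  have d: "card (diff (cycle_graph l a b w)) = card {i. i < l \<and> w i \<noteq> w (Suc i mod l)}"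
    unfolding diff_cycle_graph[OF assms(1-3)] by (rule card_image[OF inj])
  have sq: "sqrt x ^ (2 * k) = x ^ k" if "x \<ge> 0" for x k
    using that by (simp add: power_mult)
  have 1: "(\<Prod>i<l. case w i of Bullet \<Rightarrow> lam | Circ \<Rightarrow> \<mu>) =
     lam ^ card {i. i < l \<and> w i = Bullet} * \<mu> ^ card {i. i < l \<and> w i = Circ}"
  proof -
    have "(\<Prod>i<l. case w i of Bullet \<Rightarrow> lam | Circ \<Rightarrow> \<mu>) =
      (\<Prod>i\<in>{i. i < l \<and> w i = Bullet} \<union> {i. i < l \<and> w i = Circ}. case w i of Bullet \<Rightarrow> lam | Circ \<Rightarrow> \<mu>)"
      by (intro prod.cong refl) (auto, metis decoration.exhaust)
    also have "\<dots> = (\<Prod>i\<in>{i. i < l \<and> w i = Bullet}. lam) * (\<Prod>i\<in>{i. i < l \<and> w i = Circ}. \<mu>)"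
      by (subst prod.union_disjoint) (auto intro!: arg_cong2[where f="(*)"] prod.cong)
    finally show ?thesis by simp
  qed
  have 2: "(\<Prod>i<l. if w i = w (Suc i mod l) then 1 else \<rho>) = \<rho> ^ card {i. i < l \<and> w i \<noteq> w (Suc i mod l)}"
    by (simp add: prod.If_cases Int_def Collect_neg_eq[symmetric])
  show ?thesis
    unfolding Upsilon_def word_weight_def prod.distrib 1 2 d card_edges_of_cycle_graph[OF assms(1-3)]
    using assms(4,5) by (simp add: sq)
qed

lemma cycle_graph_cong:
  assumes "0 < l" "\<And>i. i < l \<Longrightarrow> a i = a' i" "\<And>i. i < l \<Longrightarrow> b i = b' i" "\<And>i. i < l \<Longrightarrow> w i = w' i"
    and "inj_on b {..<l}"
  shows "cycle_graph l a b w = cycle_graph l a' b' w'"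
proof (rule dgraph_eqI)
  have b': "inj_on b' {..<l}" using assms(3,5) by (simp add: inj_on_def)
  show "deco (cycle_graph l a b w) (p, q) = Some d \<longleftrightarrow> deco (cycle_graph l a' b' w') (p, q) = Some d" for p q d
    unfolding deco_cycle_graph[OF b'] deco_cycle_graph[OF assms(5)] using assms by auto
qed (use assms in \<open>auto simp: image_iff\<close>)

section \<open>Cycles in the complete bipartite graph\<close>

definition inj_maps :: "nat \<Rightarrow> nat \<Rightarrow> (nat \<Rightarrow> nat) set" where
  "inj_maps l n = {a \<in> {..<l} \<rightarrow>\<^sub>E {..<n}. inj_on a {..<l}}"

definition words :: "nat \<Rightarrow> (nat \<Rightarrow> decoration) set" where
  "words l = {..<l} \<rightarrow>\<^sub>E UNIV"

definition cycles :: "nat \<Rightarrow> nat \<Rightarrow> nat \<Rightarrow> (nat, nat) dgraph set" where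
  "cycles l n N = {S \<in> subgraphs_K n N. dcycle l S \<and> diff S \<subseteq> Inl ` Va S}"

lemma UNIV_decoration: "UNIV = {Bullet, Circ}"
  by (auto intro: decoration.exhaust)

lemma finite_decoration: "finite (UNIV :: decoration set)"
  by (simp add: UNIV_decoration)

lemma sum_decoration: "(\<Sum>d\<in>UNIV. f d) = f Bullet + (f Circ :: real)"
  by (simp add: UNIV_decoration)

lemma finite_words [simp]: "finite (words l)"
  by (auto simp: words_def finite_decoration intro: finite_PiE)

lemma finite_inj_maps [simp]: "finite (inj_maps l n)"
  unfolding inj_maps_def
  by (rule finite_subset[OF _ finite_PiE[of "{..<l}" "\<lambda>_. {..<n}"]]) auto

text \<open>The parametrisation is onto but many-to-one, since rotations and reflections of the
  indices give the same graph. \<open>sum_cycles_le\<close> and \<open>sum_cycles_ge\<close> control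
  the multiplicity from below and from above.\<close>

lemma cycles_eq:
  assumes "2 \<le> l"
  shows "cycles l n N =
    (\<lambda>(a, b, w). cycle_graph l a b w) ` (inj_maps l n \<times> inj_maps l N \<times> words l)"
proof (intro set_eqI iffI)
  fix S assume "S \<in> cycles l n N"
  then have S: "S \<in> subgraphs_K n N" "dcycle l S \<and> diff S \<subseteq> Inl ` Va S" by (auto simp: cycles_def)
  then obtain a b w where *: "inj_on a {..<l}" "inj_on b {..<l}" "S = cycle_graph l a b w"
    unfolding good_cycle_iff[OF assms] by blast
  have "S = cycle_graph l (restrict a {..<l}) (restrict b {..<l}) (restrict w {..<l})"
    unfolding *(3) using assms *(2) by (intro cycle_graph_cong) auto
  moreover have "restrict a {..<l} \<in> inj_maps l n" "restrict b {..<l} \<in> inj_maps l N" "restrict w {..<l} \<in> words l"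
    using S(1) * by (auto simp: subgraphs_K_def inj_maps_def words_def inj_on_def)
  ultimately show "S \<in> (\<lambda>(a, b, w). cycle_graph l a b w) ` (inj_maps l n \<times> inj_maps l N \<times> words l)"
    by force
next
  fix S assume "S \<in> (\<lambda>(a, b, w). cycle_graph l a b w) ` (inj_maps l n \<times> inj_maps l N \<times> words l)"
  then obtain a b w where *: "a \<in> inj_maps l n" "b \<in> inj_maps l N" "S = cycle_graph l a b w" by auto
  then have "inj_on a {..<l}" "inj_on b {..<l}" "a ` {..<l} \<subseteq> {..<n}" "b ` {..<l} \<subseteq> {..<N}"
    by (auto simp: inj_maps_def)
  moreover from this have "dcycle l S \<and> diff S \<subseteq> Inl ` Va S"
    using good_cycle_iff[OF assms, of S] *(3) by blast
  ultimately show "S \<in> cycles l n N"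
    by (simp add: cycles_def subgraphs_K_def *(3) dgraph_wf_cycle_graph)
qed

lemma finite_cycles [simp]: "2 \<le> l \<Longrightarrow> finite (cycles l n N)"
  by (simp add: cycles_eq)

lemma cyclesE:
  assumes "2 \<le> l" "S \<in> cycles l n N"
  obtains a b w where "inj_on a {..<l}" "inj_on b {..<l}" "a ` {..<l} \<subseteq> {..<n}" "b ` {..<l} \<subseteq> {..<N}"
    "S = cycle_graph l a b w" "a \<in> inj_maps l n" "b \<in> inj_maps l N" "w \<in> words l"
proof -
  obtain a b w where *: "S = cycle_graph l a b w" "a \<in> inj_maps l n" "b \<in> inj_maps l N" "w \<in> words l"
    using assms(2) unfolding cycles_eq[OF assms(1)] by auto
  then show ?thesis
    by (intro that[of a b w]) (auto simp: inj_maps_def)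
qed

section \<open>Isomorphism classes\<close>

lemma is_iso_refl: "is_iso H H id id"
  by (auto simp: is_iso_def)

lemma is_iso_sym:
  assumes "is_iso H H' f g"
  shows "is_iso H' H (inv_into (Va H) f) (inv_into (Vb H) g)"
proof -
  have f: "bij_betw f (Va H) (Va H')" and g: "bij_betw g (Vb H) (Vb H')"
    and D: "\<And>a b. a \<in> Va H \<Longrightarrow> b \<in> Vb H \<Longrightarrow> deco H' (f a, g b) = deco H (a, b)"
    using assms by (auto simp: is_iso_def)
  show ?thesis
    unfolding is_iso_def
  proof (intro conjI ballI)
    fix p q assume "p \<in> Va H'" "q \<in> Vb H'"
    then have pq: "p \<in> f ` Va H" "q \<in> g ` Vb H" using f g by (auto simp: bij_betw_def)
    show "deco H (inv_into (Va H) f p, inv_into (Vb H) g q) = deco H' (p, q)"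
      using D[OF inv_into_into[OF pq(1)] inv_into_into[OF pq(2)]]
      by (simp add: f_inv_into_f[OF pq(1)] f_inv_into_f[OF pq(2)])
  qed (use f g in \<open>auto intro: bij_betw_inv_into\<close>)
qed

lemma is_iso_trans:
  assumes "is_iso H H' f g" "is_iso H' H'' f' g'"
  shows "is_iso H H'' (f' \<circ> f) (g' \<circ> g)"
  using assms unfolding is_iso_def
  by (auto intro: bij_betw_trans simp: bij_betw_apply)

lemma equiv_iso_rel: "equiv {H. dgraph_wf H} (iso_rel :: (('a, 'b) dgraph \<times> ('a, 'b) dgraph) set)"
proof (rule equivI)
  show "iso_rel \<subseteq> {H. dgraph_wf H} \<times> {H. dgraph_wf (H :: ('a, 'b) dgraph)}"
    by (auto simp: iso_rel_def)
  show "refl_on {H. dgraph_wf H} (iso_rel :: (('a, 'b) dgraph \<times> ('a, 'b) dgraph) set)"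
    by (rule refl_onI) (auto simp: iso_rel_def isomorphic_def intro: is_iso_refl)
  show "sym (iso_rel :: (('a, 'b) dgraph \<times> ('a, 'b) dgraph) set)"
    by (rule symI) (auto simp: iso_rel_def isomorphic_def intro: is_iso_sym)
  show "trans (iso_rel :: (('a, 'b) dgraph \<times> ('a, 'b) dgraph) set)"
    by (rule transI) (auto simp: iso_rel_def isomorphic_def intro: is_iso_trans)
qed

text \<open>All cycles with the same word are isomorphic, so the cycle on the vertices
  \<open>0, ..., l - 1\<close> represents its class. Distinct words may give the same class.\<close>

lemma cycle_classes_eq:
  assumes "2 \<le> l"
  shows "cycle_classes l = (\<lambda>w. iso_rel `` {cycle_graph l id id w}) ` words l"
proof (intro set_eqI iffI)
  fix c assume "c \<in> cycle_classes l"
  then obtain H where H: "dcycle l H \<and> diff H \<subseteq> Inl ` Va H" "c = iso_rel `` {H}"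
    unfolding cycle_classes_def by (auto elim: quotientE)
  then obtain a b w where *: "inj_on a {..<l}" "inj_on b {..<l}" "H = cycle_graph l a b w"
    unfolding good_cycle_iff[OF assms] by blast
  have eq: "cycle_graph l id id w = cycle_graph l id id (restrict w {..<l})"
    using assms by (intro cycle_graph_cong) auto
  have "(H, cycle_graph l id id w) \<in> iso_rel"
    unfolding *(3) iso_rel_def using assms *(1,2)
    by (auto intro!: dgraph_wf_cycle_graph cycle_graph_isomorphic)
  then have "c = iso_rel `` {cycle_graph l id id (restrict w {..<l})}"
    unfolding H(2) eq by (intro equiv_class_eq[OF equiv_iso_rel])
  then show "c \<in> (\<lambda>w. iso_rel `` {cycle_graph l id id w}) ` words l"
    by (auto simp: words_def)
next
  fix c assume "c \<in> (\<lambda>w. iso_rel `` {cycle_graph l id id w}) ` words l"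
  then obtain w :: "nat \<Rightarrow> decoration" where w: "c = iso_rel `` {cycle_graph l id id w}" by blast
  have "dcycle l (cycle_graph l id id w) \<and>
      diff (cycle_graph l (id :: nat \<Rightarrow> nat) (id :: nat \<Rightarrow> nat) w) \<subseteq> Inl ` Va (cycle_graph l (id :: nat \<Rightarrow> nat) (id :: nat \<Rightarrow> nat) w)"
    unfolding good_cycle_iff[OF assms] by (intro exI[of _ id] exI[of _ w]) auto
  then show "c \<in> cycle_classes l"
    unfolding cycle_classes_def w by (intro quotientI) auto
qed

lemma finite_cycle_classes: "2 \<le> l \<Longrightarrow> finite (cycle_classes l)"
  by (simp add: cycle_classes_eq)

lemma rep_mem: "c \<in> cycle_classes l \<Longrightarrow> 2 \<le> l \<Longrightarrow> rep c \<in> c"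
proof -
  assume "c \<in> cycle_classes l" "2 \<le> l"
  then obtain w where "c = iso_rel `` {cycle_graph l id id w}" by (auto simp: cycle_classes_eq)
  then have "cycle_graph l id id w \<in> c"
    by (auto simp: iso_rel_def dgraph_wf_cycle_graph isomorphic_def intro: is_iso_refl)
  then show ?thesis unfolding rep_def by (rule someI)
qed

lemma rep_cycle_graph:
  assumes "c \<in> cycle_classes l" "2 \<le> l"
  obtains a b w where "inj_on a {..<l}" "inj_on b {..<l}" "rep c = cycle_graph l a b w"
proof -
  obtain w where c: "c = iso_rel `` {cycle_graph l id id w}"
    using assms by (auto simp: cycle_classes_eq)
  then have "cycle_graph l id id w \<simeq>\<^sub>D rep c" "dgraph_wf (rep c)"
    using rep_mem[OF assms] by (auto simp: iso_rel_def)
  then obtain f g where "is_iso (cycle_graph l id id w) (rep c) f g" by (auto simp: isomorphic_def)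
  from is_iso_cycle_graph[OF assms(2) _ _ this \<open>dgraph_wf (rep c)\<close>] show ?thesis
    using that by simp
qed

text \<open>Isomorphism with the arbitrarily chosen representative becomes an equation for the class
  of \<open>S\<close>, the form in which \<open>sum.group\<close> partitions the cycles.\<close>

lemma isomorphic_rep_iff:
  assumes "c \<in> cycle_classes l" "2 \<le> l" "dgraph_wf S"
  shows "S \<simeq>\<^sub>D rep c \<longleftrightarrow> iso_rel `` {S} = c"
proof -
  obtain w where c: "c = iso_rel `` {cycle_graph l id id w}"
    using assms by (auto simp: cycle_classes_eq)
  have wf: "dgraph_wf (rep c)" and r: "(cycle_graph l id id w, rep c) \<in> iso_rel"
    using rep_mem[OF assms(1,2)] c by (auto simp: iso_rel_def)
  have c': "c = iso_rel `` {rep c}"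
    using equiv_class_eq[OF equiv_iso_rel r] c by simp
  have "S \<simeq>\<^sub>D rep c \<longleftrightarrow> (S, rep c) \<in> iso_rel"
    using assms(3) wf by (simp add: iso_rel_def)
  also have "\<dots> \<longleftrightarrow> iso_rel `` {S} = iso_rel `` {rep c}"
    using eq_equiv_class_iff[OF equiv_iso_rel, of S "rep c"] assms(3) wf by auto
  finally show ?thesis using c' by simp
qed

text \<open>Every cycle of the complete bipartite graph lies in exactly one class and
  \<open>Upsilon\<close> is constant on it, so the double sum collapses. Afterwards isomorphism
  classes matter only through the positivity of \<open>beta\<close>.\<close>

lemma sum_over_classes:
  assumes l: "2 \<le> l" and "lam \<ge> 0" "\<mu> \<ge> 0"
  shows "(\<Sum>c \<in> cycle_classes l. Upsilon lam \<mu> \<rho> (rep c) *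
        (\<Sum>S \<in> {S \<in> subgraphs_K n N. S \<simeq>\<^sub>D rep c}. h S)) =
     (\<Sum>S \<in> cycles l n N. Upsilon lam \<mu> \<rho> S * h S)"
proof -
  have key: "{S \<in> subgraphs_K n N. S \<simeq>\<^sub>D rep c} = {S \<in> cycles l n N. iso_rel `` {S} = c}"
    and U: "\<And>S. S \<in> subgraphs_K n N \<Longrightarrow> S \<simeq>\<^sub>D rep c \<Longrightarrow> Upsilon lam \<mu> \<rho> S = Upsilon lam \<mu> \<rho> (rep c)"
    if c: "c \<in> cycle_classes l" for c
  proof -
    obtain a b w where r: "inj_on a {..<l}" "inj_on b {..<l}" "rep c = cycle_graph l a b w"
      using rep_cycle_graph[OF c l] .
    have *: "dcycle l S \<and> diff S \<subseteq> Inl ` Va S" "Upsilon lam \<mu> \<rho> S = Upsilon lam \<mu> \<rho> (rep c)"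
      if S: "S \<in> subgraphs_K n N" "S \<simeq>\<^sub>D rep c" for S
    proof -
      have wf: "dgraph_wf S" using S by (simp add: subgraphs_K_def)
      obtain f g where "is_iso (cycle_graph l a b w) S f g"
        using S(2) is_iso_sym unfolding r(3) isomorphic_def by blast
      note i = is_iso_cycle_graph[OF l r(1,2) this wf]
      show "dcycle l S \<and> diff S \<subseteq> Inl ` Va S"
        unfolding good_cycle_iff[OF l] using i by blast
      show "Upsilon lam \<mu> \<rho> S = Upsilon lam \<mu> \<rho> (rep c)"
        unfolding r(3) using i r assms by (simp add: Upsilon_cycle_graph)
    qed
    show "{S \<in> subgraphs_K n N. S \<simeq>\<^sub>D rep c} = {S \<in> cycles l n N. iso_rel `` {S} = c}"
      using *(1) isomorphic_rep_iff[OF c l] by (auto simp: cycles_def subgraphs_K_def)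
    show "\<And>S. S \<in> subgraphs_K n N \<Longrightarrow> S \<simeq>\<^sub>D rep c \<Longrightarrow> Upsilon lam \<mu> \<rho> S = Upsilon lam \<mu> \<rho> (rep c)"
      using *(2) .
  qed
  have "(\<Sum>c \<in> cycle_classes l. Upsilon lam \<mu> \<rho> (rep c) *
        (\<Sum>S \<in> {S \<in> subgraphs_K n N. S \<simeq>\<^sub>D rep c}. h S)) =
     (\<Sum>c \<in> cycle_classes l. \<Sum>S \<in> {S \<in> cycles l n N. iso_rel `` {S} = c}. Upsilon lam \<mu> \<rho> S * h S)"
    unfolding sum_distrib_left
    by (intro sum.cong) (auto simp: key[symmetric] U)
  also have "\<dots> = (\<Sum>S \<in> cycles l n N. Upsilon lam \<mu> \<rho> S * h S)"
  proof (rule sum.group)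
    show "(\<lambda>S. iso_rel `` {S}) ` cycles l n N \<subseteq> cycle_classes l"
      by (auto simp: cycle_classes_def cycles_def intro: quotientI)
  qed (simp_all add: l finite_cycle_classes)
  finally show ?thesis .
qed

lemma finite_Aut: "finite (Va H) \<Longrightarrow> finite (Vb H) \<Longrightarrow> finite (Aut H)"
proof -
  assume "finite (Va H)" "finite (Vb H)"
  then have "finite ((Va H \<rightarrow>\<^sub>E Va H) \<times> (Vb H \<rightarrow>\<^sub>E Vb H))"
    by (auto intro: finite_PiE)
  moreover have "Aut H \<subseteq> (Va H \<rightarrow>\<^sub>E Va H) \<times> (Vb H \<rightarrow>\<^sub>E Vb H)"
    by (auto simp: Aut_def is_iso_def PiE_def dest: bij_betw_apply)
  ultimately show ?thesis by (rule finite_subset[rotated])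
qed

lemma word_weight_pos: "lam > 0 \<Longrightarrow> \<mu> > 0 \<Longrightarrow> \<rho> > 0 \<Longrightarrow> word_weight lam \<mu> \<rho> l w > 0"
  unfolding word_weight_def by (intro prod_pos) (auto split: decoration.split)

lemma beta_pos:
  assumes l: "2 \<le> l" and pos: "lam > 0" "\<mu> > 0" "\<rho> > 0"
  shows "beta lam \<mu> \<rho> l > 0"
  unfolding beta_def
proof (rule sum_pos)
  show "cycle_classes l \<noteq> {}" using l by (auto simp: cycle_classes_eq words_def PiE_eq_empty_iff)
  fix c assume c: "c \<in> cycle_classes l"
  obtain a b w where r: "inj_on a {..<l}" "inj_on b {..<l}" "rep c = cycle_graph l a b w"
    using rep_cycle_graph[OF c l] .
  have "(restrict id (Va (rep c)), restrict id (Vb (rep c))) \<in> Aut (rep c)"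
    by (auto simp: Aut_def is_iso_def bij_betw_def inj_on_def)
  \<comment> \<open>\<open>card\<close> of an infinite set is 0 and division by 0 gives 0, so
    finiteness is needed besides the presence of the identity.\<close>
  moreover have "finite (Aut (rep c))" using r by (intro finite_Aut) auto
  ultimately have "card (Aut (rep c)) > 0" by (auto simp: card_gt_0_iff)
  moreover have "Upsilon lam \<mu> \<rho> (rep c) > 0"
    using r pos l word_weight_pos[OF pos, of l w] by (simp add: Upsilon_cycle_graph)
  ultimately show "0 < (Upsilon lam \<mu> \<rho> (rep c))\<^sup>2 / real (card (Aut (rep c)))" by simp
qed (simp add: l finite_cycle_classes)

section \<open>Counting cycles\<close>

text \<open>An injection is extended one value at a time, with at least \<open>n - l\<close> free
  values at each step; \<open>l\<close> stays fixed while the length \<open>k\<close> grows.\<close>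

lemma inj_maps_lower:
  assumes "l \<le> n"
  shows "(real n - real l) ^ l \<le> real (card (inj_maps l n))"
proof -
  have "(real n - real l) ^ k \<le> real (card (inj_maps k n))" if "k \<le> l" for k
    using that
  proof (induction k)
    case 0
    have "inj_maps 0 n = {\<lambda>_. undefined}" by (auto simp: inj_maps_def)
    then show ?case by simp
  next
    case (Suc k)
    let ?D = "Sigma (inj_maps k n) (\<lambda>f. {..<n} - f ` {..<k})"
    have "card ((\<lambda>(f, x). f(k := x)) ` ?D) = card ?D"
    proof (rule card_image, rule inj_onI, clarify)
      fix f x f' x'
      assume *: "f \<in> inj_maps k n" "f' \<in> inj_maps k n" "f(k := x) = f'(k := x')"
      \<comment> \<open>Maps in \<open>inj_maps k n\<close> are undefined at \<open>k\<close>, so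
        overwriting that value loses no information.\<close>
      have "f k = undefined" "f' k = undefined"
        using *(1,2) by (auto simp: inj_maps_def PiE_def extensional_def)
      moreover have "f i = f' i" if "i \<noteq> k" for i using fun_cong[OF *(3), of i] that by simp
      ultimately have "f = f'" by (metis ext)
      then show "f = f' \<and> x = x'" using fun_cong[OF *(3), of k] by simp
    qed
    moreover have "(\<lambda>(f, x). f(k := x)) ` ?D \<subseteq> inj_maps (Suc k) n"
      by (auto simp: inj_maps_def PiE_def extensional_def inj_on_def lessThan_Suc split: if_splits)
    ultimately have "card ?D \<le> card (inj_maps (Suc k) n)"
      by (metis card_mono finite_inj_maps)
    moreover have "card ?D = (\<Sum>f\<in>inj_maps k n. card ({..<n} - f ` {..<k}))"
      by (subst card_SigmaI) auto
    moreover have "\<dots> = (\<Sum>f\<in>inj_maps k n. n - k)"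
    proof (intro sum.cong refl)
      fix f assume "f \<in> inj_maps k n"
      then show "card ({..<n} - f ` {..<k}) = n - k"
        by (subst card_Diff_subset) (auto simp: inj_maps_def card_image)
    qed
    ultimately have "real (card (inj_maps k n)) * real (n - k) \<le> real (card (inj_maps (Suc k) n))"
      by (simp flip: of_nat_mult)
    moreover have "(real n - real l) ^ k * (real n - real l) \<le> real (card (inj_maps k n)) * real (n - k)"
      using Suc assms by (intro mult_mono) auto
    ultimately show ?case by (simp add: mult.commute)
  qed
  then show ?thesis by simp
qed

lemma sum_cycles_le:
  assumes "2 \<le> l" "\<And>S. 0 \<le> g S"
  shows "(\<Sum>S \<in> cycles l n N. g S :: real) \<le>
    (\<Sum>a \<in> inj_maps l n. \<Sum>b \<in> inj_maps l N. \<Sum>w \<in> words l. g (cycle_graph l a b w))"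
proof -
  have "(\<Sum>S \<in> cycles l n N. g S) \<le>
     (\<Sum>t \<in> inj_maps l n \<times> inj_maps l N \<times> words l. (g \<circ> (\<lambda>(a, b, w). cycle_graph l a b w)) t)"
    unfolding cycles_eq[OF assms(1)] using assms(2) by (intro sum_image_le) auto
  also have "\<dots> = (\<Sum>a \<in> inj_maps l n. \<Sum>b \<in> inj_maps l N. \<Sum>w \<in> words l. g (cycle_graph l a b w))"
    by (simp add: sum.cartesian_product split_def)
  finally show ?thesis .
qed

text \<open>Fixing \<open>a 0\<close> and \<open>b 0\<close> fixes a starting point and a direction.
  The walk is then forced: \<open>a (Suc i)\<close> is the neighbour of \<open>b i\<close> other
  than \<open>a i\<close>, and \<open>b (Suc i)\<close> is the neighbour of \<open>a (Suc i)\<close>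
  other than \<open>b i\<close>.\<close>

lemma cycle_graph_inject:
  assumes l: "2 \<le> l" and t: "a \<in> inj_maps l n" "b \<in> inj_maps l N" "w \<in> words l"
      "a' \<in> inj_maps l n" "b' \<in> inj_maps l N" "w' \<in> words l"
    and eq: "cycle_graph l a b w = cycle_graph l a' b' w'" "a 0 = a' 0" "b 0 = b' 0"
  shows "a = a' \<and> b = b' \<and> w = w'"
proof -
  have inj: "inj_on a {..<l}" "inj_on b {..<l}" "inj_on a' {..<l}" "inj_on b' {..<l}"
    using t by (auto simp: inj_maps_def)
  note D = deco_cycle_graph[OF inj(2), of a w] deco_cycle_graph[OF inj(4), of a' w']
  have aeq: "a i = a j \<longleftrightarrow> i = j" "a' i = a' j \<longleftrightarrow> i = j" "b i = b j \<longleftrightarrow> i = j" "b' i = b' j \<longleftrightarrow> i = j"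
    if "i < l" "j < l" for i j
    using that inj by (auto dest: inj_onD)
  have m: "Suc i mod l < l" for i using l by simp
  have E: "\<exists>j<l. b i = b' j \<and> (p = a' j \<or> p = a' (Suc j mod l)) \<and> w i = w' j"
    if "i < l" "p = a i \<or> p = a (Suc i mod l)" for i p
    using D[of p "b i" "w i"] eq(1) that by metis
  have ab: "i < l \<longrightarrow> a i = a' i \<and> b i = b' i" for i
  proof (induction i)
    case 0 then show ?case using eq by simp
  next
    case (Suc i)
    show ?case
    proof
      assume i: "Suc i < l"
      then have IH: "a i = a' i" "b i = b' i" "i < l" using Suc by auto
      have s: "Suc i mod l = Suc i" using i by simp
      have "\<exists>j<l. b i = b' j \<and> (a (Suc i) = a' j \<or> a (Suc i) = a' (Suc j mod l)) \<and> w i = w' j"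
        using IH(3) s by (intro E) auto
      then have "a (Suc i) = a' i \<or> a (Suc i) = a' (Suc i)" using IH aeq s by auto
      moreover have "a (Suc i) \<noteq> a' i" using IH(1) aeq(1)[OF i IH(3)] by auto
      ultimately have a: "a (Suc i) = a' (Suc i)" by blast
      have "\<exists>j<l. b (Suc i) = b' j \<and> (a (Suc i) = a' j \<or> a (Suc i) = a' (Suc j mod l)) \<and> w (Suc i) = w' j"
        using i by (intro E) auto
      then obtain j where j: "j < l" "b (Suc i) = b' j" "Suc i = j \<or> Suc i = Suc j mod l"
        using a aeq(2)[OF i] m by auto
      have "b (Suc i) = b' (Suc i)"
      proof (cases "Suc i = j")
        case False
        then have "j = i" using j by (auto simp: mod_Suc split: if_splits)
        then have "b (Suc i) = b i" using j IH by simp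
        then show ?thesis using aeq(3)[OF i IH(3)] by simp
      qed (use j in simp)
      then show "a (Suc i) = a' (Suc i) \<and> b (Suc i) = b' (Suc i)" using a by blast
    qed
  qed
  have w: "w i = w' i" if "i < l" for i
    using E[OF that, of "a i"] ab aeq that by auto
  have "a = a'"
    by (rule PiE_ext[of a "{..<l}" "\<lambda>_. {..<n}" a']) (use t ab in \<open>auto simp: inj_maps_def\<close>)
  moreover have "b = b'"
    by (rule PiE_ext[of b "{..<l}" "\<lambda>_. {..<N}" b']) (use t ab in \<open>auto simp: inj_maps_def\<close>)
  moreover have "w = w'"
    by (rule PiE_ext[of w "{..<l}" "\<lambda>_. UNIV" w']) (use t w in \<open>auto simp: words_def\<close>)
  ultimately show ?thesis by blast
qed

text \<open>By \<open>cycle_graph_inject\<close> a cycle has at most one parametrisation for each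
  choice of \<open>a 0\<close> and \<open>b 0\<close> among its vertices, hence at most
  \<open>l ^ 2\<close>. The true multiplicity is \<open>2 l\<close>, but a polynomial loss is
  harmless.\<close>

lemma sum_cycles_ge:
  assumes l: "2 \<le> l" and g: "\<And>S. 0 \<le> g S"
  shows "(\<Sum>a \<in> inj_maps l n. \<Sum>b \<in> inj_maps l N. \<Sum>w \<in> words l. g (cycle_graph l a b w))
    \<le> real l ^ 2 * (\<Sum>S \<in> cycles l n N. g S :: real)"
proof -
  let ?T = "inj_maps l n \<times> inj_maps l N \<times> words l"
  let ?f = "\<lambda>(a, b, w). (cycle_graph l a b w, a (0::nat), b (0::nat))"
  have inj: "inj_on ?f ?T"
    by (intro inj_onI, clarify) (use cycle_graph_inject[OF l] in auto)
  have "(\<Sum>a \<in> inj_maps l n. \<Sum>b \<in> inj_maps l N. \<Sum>w \<in> words l. g (cycle_graph l a b w)) =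
     (\<Sum>t \<in> ?T. g (fst (?f t)))"
    by (simp add: sum.cartesian_product split_def)
  also have "\<dots> = (\<Sum>s \<in> ?f ` ?T. g (fst s))"
    using inj by (simp add: sum.reindex)
  also have "\<dots> \<le> (\<Sum>s \<in> Sigma (cycles l n N) (\<lambda>S. Va S \<times> Vb S). g (fst s))"
  proof (rule sum_mono2)
    show "finite (Sigma (cycles l n N) (\<lambda>S. Va S \<times> Vb S))"
      using l by (auto elim!: cyclesE[OF l])
    show "?f ` ?T \<subseteq> Sigma (cycles l n N) (\<lambda>S. Va S \<times> Vb S)"
      unfolding cycles_eq[OF l] using l by force
  qed (use g in auto)
  also have "\<dots> = (\<Sum>S \<in> cycles l n N. \<Sum>v \<in> Va S \<times> Vb S. g S)"
    using l by (subst sum.Sigma) (auto elim!: cyclesE[OF l] intro!: sum.cong)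
  also have "\<dots> = (\<Sum>S \<in> cycles l n N. real l ^ 2 * g S)"
    using l by (intro sum.cong refl)
      (auto elim!: cyclesE[OF l] simp: card_cartesian_product card_image power2_eq_square)
  finally show ?thesis by (simp add: sum_distrib_left)
qed

text \<open>Each vertex of \<open>K\<close> is either arbitrary with weight 1 or one of the
  \<open>card (Va S)\<close> (or \<open>card (Vb S)\<close>) vertices of \<open>S\<close> with
  weight \<open>n\<close>. Dropping injectivity turns the sum into a product over positions;
  \<open>2 ^ l\<close> counts the words.\<close>

lemma sum_overlap_le:
  assumes l: "2 \<le> l" and n: "0 < n" and fin: "finite (Va S)" "finite (Vb S)"
  shows "(\<Sum>K \<in> cycles l n N. real n ^ (card (Va S \<inter> Va K) + card (Vb S \<inter> Vb K)))
    \<le> 2 ^ l * (real n + real (card (Va S)) * real n) ^ l * (real N + real (card (Vb S)) * real n) ^ l"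
proof -
  define h where "h = (\<lambda>(V :: nat set) p. if p \<in> V then real n else 1)"
  have h0: "h V p \<ge> 0" for V p by (simp add: h_def)
  have pw: "real n ^ card (V \<inter> a ` {..<l}) = (\<Prod>i<l. h V (a i))" if "a \<in> inj_maps l m" for V a m
  proof -
    have "inj_on a {..<l}" using that by (auto simp: inj_maps_def)
    then have "card (a ` {i\<in>{..<l}. a i \<in> V}) = card {i\<in>{..<l}. a i \<in> V}"
      by (intro card_image) (auto simp: inj_on_def)
    moreover have "V \<inter> a ` {..<l} = a ` {i\<in>{..<l}. a i \<in> V}" by auto
    ultimately show ?thesis by (simp add: h_def prod.If_cases Int_def)
  qed
  have tot: "(\<Sum>a\<in>inj_maps l m. \<Prod>i<l. h V (a i)) \<le> (real m + real (card V) * real n) ^ l"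
    if "finite V" for V m
  proof -
    have "(\<Sum>a\<in>inj_maps l m. \<Prod>i<l. h V (a i)) \<le> (\<Sum>a\<in>{..<l} \<rightarrow>\<^sub>E {..<m}. \<Prod>i<l. h V (a i))"
      by (intro sum_mono2) (auto simp: inj_maps_def intro!: finite_PiE prod_nonneg h0)
    also have "\<dots> = (\<Prod>i<l. \<Sum>p<m. h V p)"
      by (rule prod_sum_PiE[symmetric]) auto
    also have "\<dots> \<le> (\<Prod>i<l. real m + real (card V) * real n)"
    proof (intro prod_mono conjI sum_nonneg h0)
      have "(\<Sum>p<m. h V p) \<le> (\<Sum>p<m. 1 + (if p \<in> V then real n else 0))"
        by (intro sum_mono) (auto simp: h_def)
      also have "\<dots> = real m + real (card ({..<m} \<inter> V)) * real n"
        by (simp add: sum.distrib sum.If_cases)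
      also have "\<dots> \<le> real m + real (card V) * real n"
        using that by (auto intro!: mult_right_mono card_mono)
      finally show "(\<Sum>p<m. h V p) \<le> real m + real (card V) * real n" .
    qed
    finally show ?thesis by simp
  qed
  have "(\<Sum>K \<in> cycles l n N. real n ^ (card (Va S \<inter> Va K) + card (Vb S \<inter> Vb K))) \<le>
    (\<Sum>a \<in> inj_maps l n. \<Sum>b \<in> inj_maps l N. \<Sum>w \<in> words l.
      real n ^ (card (Va S \<inter> a ` {..<l}) + card (Vb S \<inter> b ` {..<l})))"
    using sum_cycles_le[OF l, of "\<lambda>K. real n ^ (card (Va S \<inter> Va K) + card (Vb S \<inter> Vb K))" n N] by simp
  also have "\<dots> = (\<Sum>a \<in> inj_maps l n. \<Sum>b \<in> inj_maps l N. 2 ^ l * ((\<Prod>i<l. h (Va S) (a i)) * (\<Prod>i<l. h (Vb S) (b i))))"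
    by (intro sum.cong refl)
      (simp add: power_add pw words_def card_PiE UNIV_decoration)
  also have "\<dots> = 2 ^ l * (\<Sum>a \<in> inj_maps l n. \<Prod>i<l. h (Va S) (a i)) * (\<Sum>b \<in> inj_maps l N. \<Prod>i<l. h (Vb S) (b i))"
    by (simp only: sum_distrib_left[symmetric] sum_distrib_right[symmetric] mult.assoc)
  also have "\<dots> \<le> 2 ^ l * (real n + real (card (Va S)) * real n) ^ l * (real N + real (card (Vb S)) * real n) ^ l"
    using tot fin by (intro mult_mono) (auto intro!: sum_nonneg prod_nonneg h0 mult_nonneg_nonneg)
  finally show ?thesis .
qed

text \<open>For the empty graph every overlap is empty and every summand of
  \<open>sum_overlap_le\<close> is 1.\<close>

lemma card_cycles_le:
  assumes "2 \<le> l" "0 < n"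
  shows "real (card (cycles l n N)) \<le> 2 ^ l * real n ^ l * real N ^ l"
  using sum_overlap_le[OF assms, of "\<lparr>Va = {}, Vb = {}, deco = Map.empty\<rparr>" N] by simp

text \<open>Equality would make the set of edges closed under moving to the next edge around the cycle.\<close>

lemma card_proper_edges_less:
  assumes l: "2 \<le> l" and inj: "inj_on a {..<l}" "inj_on b {..<l}"
    and A: "A \<subset> (\<Union>i<l. {(a i, b i), (a (Suc i mod l), b i)})" "A \<noteq> {}"
  shows "card A < card (fst ` A) + card (snd ` A)"
proof (rule ccontr)
  assume le: "\<not> ?thesis"
  define s where "s = (\<lambda>i. Suc i mod l)"
  \<comment> \<open>\<open>I\<close> and \<open>J\<close> index the edges of \<open>A\<close> that
    lead from \<open>b i\<close> back to \<open>a i\<close> and forward to \<open>a (s i)\<close>.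
    The touched a-vertices are indexed by \<open>I\<close> together with the image of
    \<open>J\<close> under \<open>s\<close>, the touched b-vertices by \<open>I \<union> J\<close>;
    hence \<open>card I + card J\<close> never exceeds their total number.\<close>
  define I where "I = {i. i < l \<and> (a i, b i) \<in> A}"
  define J where "J = {i. i < l \<and> (a (s i), b i) \<in> A}"
  have fin: "finite I" "finite J" by (auto simp: I_def J_def)
  have sl: "s i < l" for i using l by (simp add: s_def)
  have aeq: "a i = a j \<longleftrightarrow> i = j" "b i = b j \<longleftrightarrow> i = j" if "i < l" "j < l" for i j
    using that inj by (auto dest: inj_onD)
  have sne: "s i \<noteq> i" if "i < l" for i using Suc_mod_neq[OF l that] by (simp add: s_def)
  have sinj: "inj_on s {..<l}"
    by (auto simp: inj_on_def s_def mod_Suc split: if_splits)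
  have Aeq: "A = (\<lambda>i. (a i, b i)) ` I \<union> (\<lambda>i. (a (s i), b i)) ` J"
    using A(1) by (auto simp: I_def J_def s_def)
  have cA: "card A = card I + card J"
    unfolding Aeq
  proof (subst card_Un_disjoint)
    show "(\<lambda>i. (a i, b i)) ` I \<inter> (\<lambda>i. (a (s i), b i)) ` J = {}"
      using aeq sne sl by (auto simp: I_def J_def)
    show "card ((\<lambda>i. (a i, b i)) ` I) + card ((\<lambda>i. (a (s i), b i)) ` J) = card I + card J"
      using aeq by (auto simp: card_image I_def J_def inj_on_def)
  qed (use fin in auto)
  have f1: "fst ` A = a ` (I \<union> s ` J)" and f2: "snd ` A = b ` (I \<union> J)"
    unfolding Aeq by (auto simp: image_Un image_image)
  have "card (fst ` A) = card (I \<union> s ` J)" "card (snd ` A) = card (I \<union> J)"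
    unfolding f1 f2 using inj sl by (auto simp: I_def J_def intro!: card_image elim!: inj_on_subset)
  moreover have cs: "card (s ` J) = card J"
    using sinj by (auto simp: J_def intro!: card_image elim!: inj_on_subset)
  moreover have "card (s ` J) \<le> card (I \<union> s ` J)" "card I \<le> card (I \<union> J)"
    using fin by (auto intro!: card_mono)
  ultimately have eq: "card (s ` J) = card (I \<union> s ` J)" "card I = card (I \<union> J)"
    using le cA by linarith+
  have "s ` J = I \<union> s ` J"
    by (rule card_subset_eq) (use eq fin in auto)
  moreover have "I = I \<union> J"
    by (rule card_subset_eq) (use eq fin in auto)
  ultimately have sub: "I \<subseteq> s ` J" "J \<subseteq> I" by blast+
  then have "J = s ` J" using cs fin by (intro card_subset_eq) auto
  then have step: "s i \<in> J" if "i \<in> J" for i using that by blast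
  have "I = J" using sub \<open>J = s ` J\<close> by blast
  then obtain i where i: "i \<in> J" using A(2) Aeq by auto
  have "(i + k) mod l \<in> J" for k
  proof (induction k)
    case 0 then show ?case using i by (simp add: J_def)
  next
    case (Suc k) then show ?case using step[OF Suc] by (simp add: s_def mod_Suc_eq)
  qed
  then have "j \<in> J" if "j < l" for j
  proof -
    have "(i + (l - i + j)) mod l = j" using i that by (simp add: J_def)
    then show ?thesis using \<open>\<And>k. (i + k) mod l \<in> J\<close> by metis
  qed
  then have "A = (\<Union>i<l. {(a i, b i), (a (Suc i mod l), b i)})"
    using \<open>I = J\<close> A(1) by (auto simp: I_def J_def s_def)
  then show False using A(1) by blast
qed

text \<open>The edges shared with equal decorations form a part of the cycle \<open>S\<close>. A
  proper nonempty part is a union of paths and has fewer edges than vertices; for an empty part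
  \<open>meet\<close> provides a vertex. If all edges were shared, both cycles, having
  \<open>2 l\<close> edges each, would coincide. Cycles with the same edges but different words fall
  under the first two cases.\<close>

lemma shared_edges_less:
  assumes l: "2 \<le> l" and S: "S \<in> cycles l n N" and K: "K \<in> cycles l n N" and ne: "S \<noteq> K"
    and meet: "Va S \<inter> Va K \<noteq> {} \<or> Vb S \<inter> Vb K \<noteq> {}"
  shows "card (edges_of Bullet S \<inter> edges_of Bullet K) + card (edges_of Circ S \<inter> edges_of Circ K)
    < card (Va S \<inter> Va K) + card (Vb S \<inter> Vb K)"
proof -
  obtain a b w where s: "inj_on a {..<l}" "inj_on b {..<l}" "S = cycle_graph l a b w"
    using cyclesE[OF l S] by metis
  obtain a' b' w' where k: "inj_on a' {..<l}" "inj_on b' {..<l}" "K = cycle_graph l a' b' w'"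
    using cyclesE[OF l K] by metis
  define A where "A = (edges_of Bullet S \<inter> edges_of Bullet K) \<union> (edges_of Circ S \<inter> edges_of Circ K)"
  have wf: "edges S \<subseteq> Va S \<times> Vb S" "edges K \<subseteq> Va K \<times> Vb K"
    using dgraph_wf_cycle_graph[of l a b w] dgraph_wf_cycle_graph[of l a' b' w'] s k
    by (auto simp: dgraph_wf_def edges_def)
  have fin: "finite (Va S)" "finite (Vb S)" using s by auto
  have sub: "A \<subseteq> edges S" "A \<subseteq> edges K" by (auto simp: A_def edges_of_def edges_def)
  have finA: "finite A" using sub(1) wf(1) fin by (meson finite_SigmaI finite_subset)
  have cA: "card A = card (edges_of Bullet S \<inter> edges_of Bullet K) + card (edges_of Circ S \<inter> edges_of Circ K)"
    unfolding A_def by (rule card_Un_disjoint) (use finA in \<open>auto simp: A_def edges_of_def\<close>)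
  have img: "fst ` A \<subseteq> Va S \<inter> Va K" "snd ` A \<subseteq> Vb S \<inter> Vb K"
    using sub wf by force+
  have cimg: "card (fst ` A) \<le> card (Va S \<inter> Va K)" "card (snd ` A) \<le> card (Vb S \<inter> Vb K)"
    using img fin by (auto intro!: card_mono)
  have two: "card (edges H) = 2 * l" if "H = cycle_graph l a b w" "inj_on a {..<l}" "inj_on b {..<l}"
    for H :: "(nat, nat) dgraph" and a b w
  proof -
    have e: "edges H = edges_of Bullet H \<union> edges_of Circ H"
      by (auto simp: edges_def edges_of_def) (metis decoration.exhaust)
    have f: "finite (edges_of d H)" for d
      unfolding that(1) edges_of_cycle_graph[OF that(3)] by auto
    have "card (edges H) = card (edges_of Bullet H) + card (edges_of Circ H)"
      unfolding e by (rule card_Un_disjoint) (auto simp: f, auto simp: edges_of_def)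
    also have "\<dots> = 2 * l" unfolding that(1) by (rule card_edges_cycle_graph[OF l that(2,3)])
    finally show ?thesis .
  qed
  show ?thesis
  proof (cases "A = {}")
    case True
    then show ?thesis using cA meet fin by (auto simp: card_gt_0_iff)
  next
    case False
    have "A \<noteq> edges S"
    proof
      assume eq: "A = edges S"
      then have "edges S = edges K"
        using sub two[OF s(3,1,2)] two[OF k(3,1,2)] l
        by (intro card_subset_eq) (auto intro: card_ge_0_finite)
      then have "deco S e = deco K e" for e
      proof (cases "e \<in> edges S")
        case True
        then have "e \<in> A" using eq by simp
        then show ?thesis by (auto simp: A_def edges_of_def)
      next
        case False
        then have "deco S e = None" "deco K e = None"
          using \<open>edges S = edges K\<close> by (auto simp: edges_def domIff)
        then show ?thesis by simp
      qed
      moreover have V: "Va H = fst ` edges H \<and> Vb H = snd ` edges H"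
        if "H = cycle_graph l a b w" "inj_on b {..<l}" for H :: "(nat, nat) dgraph" and a b w
        using l that(1) cycle_graph_edges[OF that(2), of a w] by (force simp: image_iff)
      ultimately have "S = K"
        using V[OF s(3,2)] V[OF k(3,2)] \<open>edges S = edges K\<close> by (intro dgraph_eqI) auto
      then show False using ne by blast
    qed
    then have "card A < card (fst ` A) + card (snd ` A)"
      using sub(1) False s cycle_graph_edges[OF s(2), of a w]
      by (intro card_proper_edges_less[OF l s(1,2)]) auto
    then show ?thesis using cA cimg by linarith
  qed
qed

section \<open>Growth of the word sums\<close>

lemma sum_words_Suc:
  "(\<Sum>w \<in> words (Suc m). g w :: real) = (\<Sum>w \<in> words m. \<Sum>x\<in>UNIV. g (w(m := x)))"
proof -
  have "words (Suc m) = (\<lambda>(w, x). w(m := x)) ` (words m \<times> UNIV)"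
    unfolding words_def lessThan_Suc PiE_insert_eq by force
  moreover have "inj_on (\<lambda>(w, x). w(m := x)) (words m \<times> UNIV)"
  proof (rule inj_onI, clarify)
    fix f x f' x'
    assume *: "f \<in> words m" "f' \<in> words m" "f(m := x) = f'(m := x')"
    have "f m = undefined" "f' m = undefined"
      using *(1,2) by (auto simp: words_def PiE_def extensional_def)
    moreover have "f i = f' i" if "i \<noteq> m" for i using fun_cong[OF *(3), of i] that by simp
    ultimately have "f = f'" by (metis ext)
    then show "f = f' \<and> x = x'" using fun_cong[OF *(3), of m] by simp
  qed
  ultimately show ?thesis
    by (simp add: sum.reindex sum.cartesian_product split_def)
qed

text \<open>With \<open>T\<close> as a matrix, the right-hand side is the sum of the entries of
  \<open>T^m \<phi>\<close>, and the hypothesis \<open>T \<phi> \<ge> q \<phi>\<close> is iterated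
  \<open>m\<close> times. A word of \<open>m + 1\<close> letters has \<open>m\<close>
  transitions.\<close>

lemma word_chain_lower:
  fixes T :: "decoration \<Rightarrow> decoration \<Rightarrow> real"
  assumes T: "\<And>s t. T s t \<ge> 0" and q: "q \<ge> 0" and ev: "\<And>s. q * \<phi> s \<le> (\<Sum>t\<in>UNIV. T s t * \<phi> t)"
  shows "q ^ m * (\<phi> Bullet + \<phi> Circ) \<le> (\<Sum>w \<in> words (Suc m). (\<Prod>i<m. T (w i) (w (Suc i))) * \<phi> (w m))"
proof (induction m)
  case 0
  show ?case by (subst sum_words_Suc) (simp add: sum_decoration words_def)
next
  case (Suc m)
  have "q ^ Suc m * (\<phi> Bullet + \<phi> Circ) \<le>
      q * (\<Sum>w \<in> words (Suc m). (\<Prod>i<m. T (w i) (w (Suc i))) * \<phi> (w m))"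
    using mult_left_mono[OF Suc q] by (simp add: mult.assoc)
  also have "\<dots> = (\<Sum>w \<in> words (Suc m). (\<Prod>i<m. T (w i) (w (Suc i))) * (q * \<phi> (w m)))"
    by (simp add: sum_distrib_left algebra_simps)
  also have "\<dots> \<le> (\<Sum>w \<in> words (Suc m). (\<Prod>i<m. T (w i) (w (Suc i))) * (\<Sum>t\<in>UNIV. T (w m) t * \<phi> t))"
    by (intro sum_mono mult_left_mono ev prod_nonneg ballI T)
  also have "\<dots> = (\<Sum>w \<in> words (Suc m). \<Sum>t\<in>UNIV. (\<Prod>i<m. T (w i) (w (Suc i))) * T (w m) t * \<phi> t)"
    by (simp only: sum_distrib_left mult.assoc)
  also have "\<dots> = (\<Sum>w \<in> words (Suc (Suc m)). (\<Prod>i<Suc m. T (w i) (w (Suc i))) * \<phi> (w (Suc m)))"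
    unfolding sum_words_Suc[of _ "Suc m"] by (intro sum.cong refl) simp
  finally show ?case .
qed

text \<open>As both squares are at most \<gamma>, only the third entry of the maximum can exceed 1.
  It equals \<open>p / (A + p) + q / (B + q)\<close>, and clearing denominators leaves
  \<open>A * B < p * q\<close>, which forces \<open>p\<close> and \<open>q\<close> to be
  nonzero.\<close>

lemma F_gt_1_imp:
  assumes "\<gamma> > 0" "0 < \<rho>" "\<rho> < 1" "lam \<ge> 0" "\<mu> \<ge> 0" "lam^2 / \<gamma> \<le> 1" "\<mu>^2 / \<gamma> \<le> 1"
    and "F lam \<mu> \<rho> \<gamma> > 1"
  shows "lam > 0" "\<mu> > 0" "(\<gamma> - lam^2) * (\<gamma> - \<mu>^2) < (lam^2 * \<rho>^2) * (\<mu>^2 * \<rho>^2)"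
proof -
  define A B p q where "A = \<gamma> - lam^2" "B = \<gamma> - \<mu>^2" "p = lam^2 * \<rho>^2" "q = \<mu>^2 * \<rho>^2"
  have AB: "A \<ge> 0" "B \<ge> 0" using assms by (auto simp: A_B_p_q_def field_simps)
  have pq: "p \<ge> 0" "q \<ge> 0" by (auto simp: A_B_p_q_def)
  \<comment> \<open>If \<open>lam = 0\<close> then \<open>A = \<gamma> > 0\<close>, so the
    denominators are positive even before \<open>lam\<close> and \<open>\<mu>\<close> are known to
    be positive.\<close>
  have "p > 0 \<or> A > 0" "q > 0 \<or> B > 0" using assms by (auto simp: A_B_p_q_def)
  then have pos: "A + p > 0" "B + q > 0" using AB pq by auto
  have "1 < p / (A + p) + q / (B + q)"
    using assms(6-8) by (auto simp: F_def A_B_p_q_def max_def split: if_splits)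
  also have "\<dots> = (p * (B + q) + q * (A + p)) / ((A + p) * (B + q))"
    using pos by (simp add: add_frac_eq)
  finally have "(A + p) * (B + q) < p * (B + q) + q * (A + p)"
    using pos by (simp add: less_divide_eq)
  then have *: "A * B < p * q" by (simp add: algebra_simps)
  then have "p * q > 0" using AB by (smt (verit) mult_nonneg_nonneg)
  then have "p \<noteq> 0" "q \<noteq> 0" by auto
  then show "lam > 0" "\<mu> > 0" using assms(4,5) by (auto simp: A_B_p_q_def less_le)
  show "(\<gamma> - lam^2) * (\<gamma> - \<mu>^2) < (lam^2 * \<rho>^2) * (\<mu>^2 * \<rho>^2)" using * by (simp add: A_B_p_q_def)
qed

text \<open>\<open>T\<close> is the transfer matrix of the squared weights. The hypothesis \<open>supercrit\<close> says that its Perron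
  eigenvalue exceeds \<open>\<gamma>\<close>; \<open>\<phi>\<close> is an explicit vector with \<open>T \<phi> \<ge> \<kappa> \<gamma> \<phi>\<close>.\<close>

lemma word_weight_square_sum_lower:
  assumes g: "\<gamma> > 0" and r: "0 < \<rho>" "\<rho> < 1" and pos: "lam > 0" "\<mu> > 0"
    and le: "lam^2 \<le> \<gamma>" "\<mu>^2 \<le> \<gamma>"
    and supercrit: "(\<gamma> - lam^2) * (\<gamma> - \<mu>^2) < (lam^2 * \<rho>^2) * (\<mu>^2 * \<rho>^2)"
  shows "\<exists>\<kappa>>1. \<exists>c>0. \<forall>l\<ge>1. c * (\<kappa> * \<gamma>) ^ l \<le> (\<Sum>w\<in>words l. (word_weight lam \<mu> \<rho> l w)^2)"
proof -
  define A B p q where "A = \<gamma> - lam^2" "B = \<gamma> - \<mu>^2" "p = lam^2 * \<rho>^2" "q = \<mu>^2 * \<rho>^2"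
  have AB: "A \<ge> 0" "B \<ge> 0" using le by (auto simp: A_B_p_q_def)
  have pq: "p > 0" "q > 0" using pos r by (auto simp: A_B_p_q_def)
  have lt: "A * B < p * q" using supercrit by (simp add: A_B_p_q_def)
  \<comment> \<open>The vector \<open>\<phi>\<close> will be \<open>(x, 1)\<close>. It needs
    \<open>B < q * x\<close> and \<open>A * x < p\<close>, that is, a point strictly between
    \<open>B / q\<close> and \<open>p / A\<close>. Raising \<open>B\<close> by a small
    \<open>s\<close> gives one, and \<open>A + 1\<close> in the denominator covers
    \<open>A = 0\<close>.\<close>
  define s where "s = (p * q - A * B) / (2 * (A + 1))"
  have "s > 0" using lt AB by (simp add: s_def)
  moreover have "s * (2 * (A + 1)) = p * q - A * B" using AB by (simp add: s_def)
  then have "2 * (A * s) + 2 * s = p * q - A * B" by (simp add: algebra_simps)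
  moreover have "A * s \<ge> 0" using AB \<open>s > 0\<close> by simp
  ultimately have s: "s > 0" "A * s < p * q - A * B" by linarith+
  define x where "x = (B + s) / q"
  have x: "x > 0" "B < q * x" "A * x < p"
    using pq AB s by (auto simp: x_def field_simps add_nonneg_pos)
  define f where "f = (\<lambda>d. case d of Bullet \<Rightarrow> lam | Circ \<Rightarrow> \<mu>)"
  define T where "T = (\<lambda>s t. f s ^ 2 * (if s = t then 1 else \<rho>^2))"
  define \<phi> where "\<phi> = (\<lambda>d. case d of Bullet \<Rightarrow> x | Circ \<Rightarrow> (1::real))"
  \<comment> \<open>The smaller of the two ratios of \<open>(T \<phi>) s\<close> to
    \<open>\<gamma> * \<phi> s\<close>, so that the expansion holds in both rows.\<close>
  define \<kappa> where "\<kappa> = min ((lam^2 * x + p) / (\<gamma> * x)) ((q * x + \<mu>^2) / \<gamma>)"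
  have "1 < (lam^2 * x + p) / (\<gamma> * x)" "1 < (q * x + \<mu>^2) / \<gamma>"
    using x g by (auto simp: A_B_p_q_def field_simps)
  then have k: "\<kappa> > 1" by (simp add: \<kappa>_def)
  have fpos: "f s > 0" for s using pos by (auto simp: f_def split: decoration.split)
  have Tpos: "T s t > 0" for s t using fpos[of s] r by (simp add: T_def)
  have ev: "\<kappa> * \<gamma> * \<phi> s \<le> (\<Sum>t\<in>UNIV. T s t * \<phi> t)" for s
  proof (cases s)
    case Bullet
    have "\<kappa> * (\<gamma> * x) \<le> (lam^2 * x + p) / (\<gamma> * x) * (\<gamma> * x)"
      using g x by (intro mult_right_mono) (auto simp: \<kappa>_def)
    then show ?thesis using g x Bullet
      by (simp add: sum_decoration T_def \<phi>_def f_def A_B_p_q_def mult.assoc)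
  next
    case Circ
    have "\<kappa> * \<gamma> \<le> (q * x + \<mu>^2) / \<gamma> * \<gamma>"
      using g by (intro mult_right_mono) (auto simp: \<kappa>_def)
    then show ?thesis using g Circ
      by (simp add: sum_decoration T_def \<phi>_def f_def A_B_p_q_def mult.assoc)
  qed
  define t0 where "t0 = min (min (T Bullet Bullet) (T Bullet Circ)) (min (T Circ Bullet) (T Circ Circ))"
  have t0: "t0 > 0" "t0 \<le> T s t" for s t
    using Tpos by (auto simp: t0_def) (cases s; cases t; auto)
  define \<phi>m where "\<phi>m = max x 1"
  have \<phi>: "\<phi> s \<le> \<phi>m" "\<phi> s > 0" for s using x by (auto simp: \<phi>_def \<phi>m_def split: decoration.split)
  have pm: "\<phi>m > 0" by (auto simp: \<phi>m_def)
  \<comment> \<open>Closing the chain replaces the end value \<open>\<phi> (w m)\<close> by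
    \<open>T (w m) (w 0)\<close> at the cost of \<open>t0 / \<phi>m\<close>. The factor
    \<open>\<kappa> * \<gamma>\<close> in the denominator is there because the open chain has
    \<open>l - 1\<close> transitions while the bound has exponent \<open>l\<close>.\<close>
  define c where "c = t0 * (x + 1) / (\<phi>m * (\<kappa> * \<gamma>))"
  have c: "c > 0" using t0 x pm k g by (auto simp: c_def)
  have "c * (\<kappa> * \<gamma>) ^ l \<le> (\<Sum>w\<in>words l. (word_weight lam \<mu> \<rho> l w)^2)" if l1: "l \<ge> 1" for l
  proof -
    obtain m where m: "l = Suc m" using l1 by (cases l) auto
    have ww: "(word_weight lam \<mu> \<rho> l w)^2 = (\<Prod>i<m. T (w i) (w (Suc i))) * T (w m) (w 0)" for w
    proof -
      have "(word_weight lam \<mu> \<rho> l w)^2 = (\<Prod>i<l. T (w i) (w (Suc i mod l)))"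
        unfolding word_weight_def prod_power_distrib
        by (intro prod.cong refl) (auto simp: T_def f_def power_mult_distrib)
      then show ?thesis by (simp add: m)
    qed
    have "c * (\<kappa> * \<gamma>) ^ l = t0 / \<phi>m * ((\<kappa> * \<gamma>) ^ m * (x + 1))"
      using k g pm by (simp add: c_def m field_simps)
    also have "\<dots> \<le> t0 / \<phi>m * (\<Sum>w \<in> words (Suc m). (\<Prod>i<m. T (w i) (w (Suc i))) * \<phi> (w m))"
    proof (rule mult_left_mono)
      show "(\<kappa> * \<gamma>) ^ m * (x + 1) \<le> (\<Sum>w \<in> words (Suc m). (\<Prod>i<m. T (w i) (w (Suc i))) * \<phi> (w m))"
        using word_chain_lower[of T "\<kappa> * \<gamma>" \<phi> m] ev Tpos k g
        by (simp add: less_imp_le \<phi>_def)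
    qed (use t0 pm in auto)
    also have "\<dots> \<le> t0 / \<phi>m * (\<Sum>w \<in> words (Suc m). (\<Prod>i<m. T (w i) (w (Suc i))) * \<phi>m)"
      using t0 pm \<phi> Tpos by (intro mult_left_mono sum_mono prod_nonneg) (auto simp: less_imp_le)
    also have "\<dots> = (\<Sum>w \<in> words (Suc m). (\<Prod>i<m. T (w i) (w (Suc i))) * t0)"
      by (subst sum_distrib_left) (use pm in \<open>simp add: mult.commute\<close>)
    also have "\<dots> \<le> (\<Sum>w \<in> words (Suc m). (\<Prod>i<m. T (w i) (w (Suc i))) * T (w m) (w 0))"
      using t0 Tpos by (intro mult_left_mono sum_mono prod_nonneg) (auto simp: less_imp_le)
    finally show ?thesis by (simp add: m ww[unfolded m])
  qed
  then show ?thesis using k c by blast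
qed

section \<open>Products of independent factors\<close>

lemma prob_space_std_normal: "prob_space std_normal"
  unfolding std_normal_def by (rule prob_space_normal_density) simp

lemma sets_std_normal [simp, measurable_cong]: "sets std_normal = sets borel"
  by (simp add: std_normal_def)

lemma space_std_normal [simp]: "space std_normal = UNIV"
  by (simp add: std_normal_def)

lemma integrable_std_normal_power: "integrable std_normal (\<lambda>x. x ^ k)"
  unfolding std_normal_def by (subst integrable_density) (auto intro: integrable_std_normal_moment)

lemma integral_std_normal_even: "(\<integral>x. x ^ (2 * k) \<partial>std_normal) = fact (2 * k) / (2 ^ k * fact k)"
  unfolding std_normal_def by (subst integral_density) (auto simp: integral_std_normal_moment_even)

lemma integral_std_normal_odd: "(\<integral>x. x ^ (2 * k + 1) \<partial>std_normal) = 0"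
  unfolding std_normal_def by (subst integral_density) (use integral_std_normal_moment_odd[of k] in auto)

lemma integrable_std_normal_shift_power: "integrable std_normal (\<lambda>x. (s + x) ^ k)"
  unfolding binomial_ring
  by (intro Bochner_Integration.integrable_sum integrable_mult_right integrable_std_normal_power)

lemma integrable_std_normal_abs_power: "integrable std_normal (\<lambda>x. (1 + \<bar>x\<bar>) ^ k)"
proof -
  have "integrable std_normal (\<lambda>x. \<bar>x\<bar> ^ j)" for j
    using integrable_abs[OF integrable_std_normal_power[of j]] by (simp add: power_abs)
  then have "integrable std_normal (\<lambda>x. (\<bar>x\<bar> + 1) ^ k)"
    unfolding binomial_ring
    by (intro Bochner_Integration.integrable_sum integrable_mult_right integrable_mult_left) auto
  then show ?thesis by (simp add: add.commute)
qed

text \<open>Moment of a matrix entry given its spike part \<open>s\<close>. Two cycles together use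
  an entry of one matrix at most twice, hence closed forms are derived up to
  \<open>k = 2\<close>.\<close>

definition shifted_moment :: "nat \<Rightarrow> real \<Rightarrow> real" where
  "shifted_moment k s = (\<integral>x. (s + x) ^ k \<partial>std_normal)"

lemma shifted_moment_simps:
  "shifted_moment 0 s = 1" "shifted_moment (Suc 0) s = s" "shifted_moment 2 s = 1 + s\<^sup>2"
proof -
  interpret prob_space std_normal by (rule prob_space_std_normal)
  have one: "prob UNIV = 1" using prob_space by simp
  have i: "integrable std_normal (\<lambda>x. x)" "integrable std_normal (\<lambda>x. x\<^sup>2)"
    using integrable_std_normal_power[of 1] integrable_std_normal_power[of 2] by auto
  have m: "(\<integral>x. x \<partial>std_normal) = 0" "(\<integral>x. x\<^sup>2 \<partial>std_normal) = 1"
    using integral_std_normal_odd[of 0] integral_std_normal_even[of 1] by (auto simp: fact_2)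
  show "shifted_moment 0 s = 1" by (simp add: shifted_moment_def one)
  show "shifted_moment (Suc 0) s = s"
    using i m by (simp add: shifted_moment_def one)
  show "shifted_moment 2 s = 1 + s\<^sup>2"
    using i m by (simp add: shifted_moment_def one power2_sum)
qed

lemma pair_product_integral:
  fixes f :: "'a \<Rightarrow> real" and g :: "'b \<Rightarrow> real"
  assumes "prob_space M1" "prob_space M2" and f: "integrable M1 f" and g: "integrable M2 g"
  shows "integrable (M1 \<Otimes>\<^sub>M M2) (\<lambda>(x, y). f x * g y)"
    and "(\<integral>(x, y). f x * g y \<partial>(M1 \<Otimes>\<^sub>M M2)) = integral\<^sup>L M1 f * integral\<^sup>L M2 g"
proof -
  interpret M1: prob_space M1 by fact
  interpret M2: prob_space M2 by fact
  interpret pair_sigma_finite M1 M2 ..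
  have [measurable]: "f \<in> borel_measurable M1" "g \<in> borel_measurable M2" using f g by auto
  show *: "integrable (M1 \<Otimes>\<^sub>M M2) (\<lambda>(x, y). f x * g y)"
  proof (rule Fubini_integrable)
    show "integrable M1 (\<lambda>x. \<integral>y. norm (case (x, y) of (x, y) \<Rightarrow> f x * g y) \<partial>M2)"
      using f by (simp add: abs_mult)
  qed (use g in auto)
  show "(\<integral>(x, y). f x * g y \<partial>(M1 \<Otimes>\<^sub>M M2)) = integral\<^sup>L M1 f * integral\<^sup>L M2 g"
    using integral_fst'[OF *] by simp
qed

lemma PiM_product_integral:
  fixes f :: "'i \<Rightarrow> 'a \<Rightarrow> real"
  assumes "prob_space M" "finite I" "\<And>i. i \<in> I \<Longrightarrow> integrable M (f i)"
  shows "integrable (PiM I (\<lambda>_. M)) (\<lambda>x. \<Prod>i\<in>I. f i (x i))"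
    and "(\<integral>x. (\<Prod>i\<in>I. f i (x i)) \<partial>PiM I (\<lambda>_. M)) = (\<Prod>i\<in>I. integral\<^sup>L M (f i))"
proof -
  interpret prob_space M by fact
  interpret product_sigma_finite "\<lambda>_::'i. M" ..
  show "integrable (PiM I (\<lambda>_. M)) (\<lambda>x. \<Prod>i\<in>I. f i (x i))"
    using assms by (intro product_integrable_prod) auto
  show "(\<integral>x. (\<Prod>i\<in>I. f i (x i)) \<partial>PiM I (\<lambda>_. M)) = (\<Prod>i\<in>I. integral\<^sup>L M (f i))"
    using assms by (intro product_integral_prod) auto
qed

lemma prob_space_gauss_vector: "prob_space (gauss_vector N)"
  unfolding gauss_vector_def by (intro prob_space_PiM prob_space_std_normal)

lemma prob_space_gauss_matrix: "prob_space (gauss_matrix n N)"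
  unfolding gauss_matrix_def by (intro prob_space_PiM prob_space_std_normal)

lemma sets_gauss_matrix [measurable_cong]: "sets (gauss_matrix n N) = sets (matrix_space n N)"
  unfolding gauss_matrix_def matrix_space_def by (intro sets_PiM_cong) auto

abbreviation grid :: "nat \<Rightarrow> nat \<Rightarrow> (nat \<times> nat) set" where
  "grid n N \<equiv> {..<n} \<times> {..<N}"

lemma noise_prod:
  fixes f g :: "nat \<times> nat \<Rightarrow> real \<Rightarrow> real"
  assumes "\<And>e. e \<in> grid n N \<Longrightarrow> integrable std_normal (f e)" "\<And>e. e \<in> grid n N \<Longrightarrow> integrable std_normal (g e)"
  shows "integrable (gauss_matrix n N \<Otimes>\<^sub>M gauss_matrix n N)
      (\<lambda>(W, Z). (\<Prod>e\<in>grid n N. f e (W e)) * (\<Prod>e\<in>grid n N. g e (Z e)))"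
    and "(\<integral>(W, Z). (\<Prod>e\<in>grid n N. f e (W e)) * (\<Prod>e\<in>grid n N. g e (Z e))
        \<partial>(gauss_matrix n N \<Otimes>\<^sub>M gauss_matrix n N)) =
      (\<Prod>e\<in>grid n N. integral\<^sup>L std_normal (f e)) * (\<Prod>e\<in>grid n N. integral\<^sup>L std_normal (g e))"
proof -
  have 1: "integrable (gauss_matrix n N) (\<lambda>W. \<Prod>e\<in>grid n N. f e (W e))"
    "(\<integral>W. (\<Prod>e\<in>grid n N. f e (W e)) \<partial>gauss_matrix n N) = (\<Prod>e\<in>grid n N. integral\<^sup>L std_normal (f e))"
    if "\<And>e. e \<in> grid n N \<Longrightarrow> integrable std_normal (f e)" for f :: "nat \<times> nat \<Rightarrow> real \<Rightarrow> real"
    using PiM_product_integral[OF prob_space_std_normal, of "grid n N" f] that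
    by (auto simp: gauss_matrix_def)
  have fi: "integrable (gauss_matrix n N) (\<lambda>W. \<Prod>e\<in>grid n N. f e (W e))"
    and gi: "integrable (gauss_matrix n N) (\<lambda>Z. \<Prod>e\<in>grid n N. g e (Z e))"
    using assms by (auto intro: 1)
  note p = pair_product_integral[OF prob_space_gauss_matrix prob_space_gauss_matrix fi gi]
  show "integrable (gauss_matrix n N \<Otimes>\<^sub>M gauss_matrix n N)
      (\<lambda>(W, Z). (\<Prod>e\<in>grid n N. f e (W e)) * (\<Prod>e\<in>grid n N. g e (Z e)))"
    by (rule p)
  show "(\<integral>(W, Z). (\<Prod>e\<in>grid n N. f e (W e)) * (\<Prod>e\<in>grid n N. g e (Z e))
        \<partial>(gauss_matrix n N \<Otimes>\<^sub>M gauss_matrix n N)) =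
      (\<Prod>e\<in>grid n N. integral\<^sup>L std_normal (f e)) * (\<Prod>e\<in>grid n N. integral\<^sup>L std_normal (g e))"
    unfolding p(2) by (simp only: 1(2)[OF assms(1)] 1(2)[OF assms(2)])
qed

lemma noise_integral:
  shows "integrable (gauss_matrix n N \<Otimes>\<^sub>M gauss_matrix n N)
      (\<lambda>(W, Z). (\<Prod>e\<in>grid n N. (s e + W e) ^ p e) * (\<Prod>e\<in>grid n N. (t e + Z e) ^ q e))"
    and "(\<integral>(W, Z). (\<Prod>e\<in>grid n N. (s e + W e) ^ p e) * (\<Prod>e\<in>grid n N. (t e + Z e) ^ q e)
        \<partial>(gauss_matrix n N \<Otimes>\<^sub>M gauss_matrix n N)) =
      (\<Prod>e\<in>grid n N. shifted_moment (p e) (s e)) * (\<Prod>e\<in>grid n N. shifted_moment (q e) (t e))"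
  unfolding shifted_moment_def
  by (rule noise_prod; rule integrable_std_normal_shift_power)+

text \<open>When \<open>p\<close> records how often each edge is used, the exponent on the right is
  the degree of the a-vertex \<open>i\<close>. This regrouping turns products over edges into
  products of independent one-vertex factors.\<close>

lemma prod_grid_rows:
  "(\<Prod>e\<in>grid n N. f (fst e) ^ p e :: real) = (\<Prod>i<n. f i ^ (\<Sum>j<N. p (i, j)))"
  by (simp add: power_sum prod.cartesian_product split_def)

lemma prod_grid_cols:
  "(\<Prod>e\<in>grid n N. f (snd e) ^ p e :: real) = (\<Prod>j<N. f j ^ (\<Sum>i<n. p (i, j)))"
proof -
  have "(\<Prod>e\<in>grid n N. f (snd e) ^ p e) = (\<Prod>i<n. \<Prod>j<N. f j ^ p (i, j))"
    by (simp add: prod.cartesian_product split_def)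
  then show ?thesis by (simp add: power_sum prod.swap[of _ "{..<N}"])
qed

text \<open>Exponents on the whole grid instead of edge sets: the product of two
  \<open>h_sub\<close> is again of this form, with exponents added.\<close>

definition monomial :: "nat \<Rightarrow> nat \<Rightarrow> (nat \<times> nat \<Rightarrow> nat) \<Rightarrow> (nat \<times> nat \<Rightarrow> nat) \<Rightarrow> rmatrix \<times> rmatrix \<Rightarrow> real" where
  "monomial n N p q = (\<lambda>(X, Y). (\<Prod>e\<in>grid n N. X e ^ p e) * (\<Prod>e\<in>grid n N. Y e ^ q e))"

lemma measurable_monomial [measurable]:
  "monomial n N p q \<in> borel_measurable (matrix_space n N \<Otimes>\<^sub>M matrix_space n N)"
  unfolding monomial_def matrix_space_def split_def by measurable

lemma sets_law_Q: "sets (law_Q n N) = sets (matrix_space n N \<Otimes>\<^sub>M matrix_space n N)"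
  unfolding law_Q_def by (intro sets_pair_measure_cong sets_gauss_matrix)

lemma prob_space_law_Q: "prob_space (law_Q n N)"
  unfolding law_Q_def by (intro prob_space_pair prob_space_gauss_matrix)

lemma law_Q_monomial:
  "integrable (law_Q n N) (monomial n N p q)"
  "(\<integral>XY. monomial n N p q XY \<partial>law_Q n N) =
     (\<Prod>e\<in>grid n N. shifted_moment (p e) 0) * (\<Prod>e\<in>grid n N. shifted_moment (q e) 0)"
  using noise_integral[of n N "\<lambda>_. 0" p "\<lambda>_. 0" q] by (simp_all add: law_Q_def monomial_def)

section \<open>The planted law as an image of independent sample, spikes and noise\<close>

locale pair_law = prob_space \<pi> for \<pi> :: "(real \<times> real) measure" +
  fixes \<rho> C :: real
  assumes sets_pi: "sets \<pi> = sets (borel \<Otimes>\<^sub>M borel)"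
    and fourth: "integrable \<pi> (\<lambda>p. fst p ^ 4)" "integrable \<pi> (\<lambda>p. snd p ^ 4)"
    and var: "(\<integral>p. (fst p)^2 \<partial>\<pi>) = 1" "(\<integral>p. (snd p)^2 \<partial>\<pi>) = 1"
    and cov: "(\<integral>p. fst p * snd p \<partial>\<pi>) = \<rho>"
    and fourth_le: "(\<integral>p. fst p ^ 4 \<partial>\<pi>) \<le> C" "(\<integral>p. snd p ^ 4 \<partial>\<pi>) \<le> C"
begin

lemma measurable_coords [measurable]: "fst \<in> borel_measurable \<pi>" "snd \<in> borel_measurable \<pi>"
  using sets_pi by (auto simp: measurable_cong_sets[OF sets_pi refl])

text \<open>A common envelope of both coordinates. It turns every bound below into a product over single
  vertices, each raised to its degree, which is at most 4.\<close>

definition env :: "real \<times> real \<Rightarrow> real" where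
  "env p = 1 + \<bar>fst p\<bar> + \<bar>snd p\<bar>"

lemma measurable_env [measurable]: "env \<in> borel_measurable \<pi>"
  unfolding env_def by measurable

lemma env_ge: "1 \<le> env p" "\<bar>fst p\<bar> \<le> env p" "\<bar>snd p\<bar> \<le> env p"
  by (auto simp: env_def)

text \<open>The factor 27 is 9 times 3, from two uses of \<open>(a + b + c)\<^sup>2 \<le> 3 *
  (a\<^sup>2 + b\<^sup>2 + c\<^sup>2)\<close>.\<close>

lemma env_power4_le: "env p ^ 4 \<le> 27 * (1 + fst p ^ 4 + snd p ^ 4)"
proof -
  have sq: "(a + b + c)\<^sup>2 \<le> 3 * (a\<^sup>2 + b\<^sup>2 + c\<^sup>2)" for a b c :: real
    using sum_squares_ge_zero[of "a - b" "b - c"] zero_le_power2[of "a - c"]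
    by (simp add: power2_eq_square algebra_simps)
  have "env p ^ 4 = ((1 + \<bar>fst p\<bar> + \<bar>snd p\<bar>)\<^sup>2)\<^sup>2" by (simp add: env_def)
  also have "\<dots> \<le> (3 * (1 + (fst p)\<^sup>2 + (snd p)\<^sup>2))\<^sup>2"
    using sq[of 1 "\<bar>fst p\<bar>" "\<bar>snd p\<bar>"] by (intro power_mono) auto
  also have "\<dots> = 9 * (1 + (fst p)\<^sup>2 + (snd p)\<^sup>2)\<^sup>2" unfolding power_mult_distrib by simp
  also have "\<dots> \<le> 9 * (3 * (1 + fst p ^ 4 + snd p ^ 4))"
    using sq[of 1 "(fst p)\<^sup>2" "(snd p)\<^sup>2"] by simp
  finally show ?thesis by simp
qed

lemma integrable_env_power:
  assumes "k \<le> 4"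
  shows "integrable \<pi> (\<lambda>p. env p ^ k)" "(\<integral>p. env p ^ k \<partial>\<pi>) \<le> 27 * (1 + 2 * C)"
proof -
  have 4: "integrable \<pi> (\<lambda>p. 27 * (1 + fst p ^ 4 + snd p ^ 4))"
    using fourth by auto
  have le: "env p ^ k \<le> 27 * (1 + fst p ^ 4 + snd p ^ 4)" for p
    using power_increasing[OF assms env_ge(1)[of p]] env_power4_le[of p] by linarith
  show i: "integrable \<pi> (\<lambda>p. env p ^ k)"
    by (rule Bochner_Integration.integrable_bound[OF 4])
      (use le env_ge(1) in \<open>auto simp: abs_of_nonneg order_trans[OF zero_le_one env_ge(1)]\<close>)
  have "(\<integral>p. env p ^ k \<partial>\<pi>) \<le> (\<integral>p. 27 * (1 + fst p ^ 4 + snd p ^ 4) \<partial>\<pi>)"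
    by (rule integral_mono[OF i 4 le])
  also have "\<dots> \<le> 27 * (1 + 2 * C)"
    using fourth fourth_le by (simp add: prob_space)
  finally show "(\<integral>p. env p ^ k \<partial>\<pi>) \<le> 27 * (1 + 2 * C)" .
qed

lemma integrable_coord_monomial:
  assumes "a + b \<le> 4"
  shows "integrable \<pi> (\<lambda>p. fst p ^ a * snd p ^ b)"
proof (rule Bochner_Integration.integrable_bound[OF integrable_env_power(1)[OF assms]])
  have "\<bar>fst p ^ a * snd p ^ b\<bar> \<le> env p ^ (a + b)" for p
    unfolding abs_mult power_abs power_add
    by (intro mult_mono power_mono env_ge) (use env_ge(1)[of p] in auto)
  then show "AE p in \<pi>. norm (fst p ^ a * snd p ^ b) \<le> norm (env p ^ (a + b))"
    using env_ge(1) by (auto intro!: AE_I2 simp: abs_of_nonneg order_trans[OF zero_le_one env_ge(1)])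
qed measurable

abbreviation sample :: "nat \<Rightarrow> (nat \<Rightarrow> real \<times> real) measure" where
  "sample n \<equiv> PiM {..<n} (\<lambda>_. \<pi>)"

abbreviation spikes :: "nat \<Rightarrow> ((nat \<Rightarrow> real) \<times> (nat \<Rightarrow> real)) measure" where
  "spikes N \<equiv> gauss_vector N \<Otimes>\<^sub>M gauss_vector N"

abbreviation noise :: "nat \<Rightarrow> nat \<Rightarrow> (rmatrix \<times> rmatrix) measure" where
  "noise n N \<equiv> gauss_matrix n N \<Otimes>\<^sub>M gauss_matrix n N"

lemma prob_space_sample: "prob_space (sample n)"
  by (intro prob_space_PiM) (rule prob_space_axioms)

lemma prob_space_spikes: "prob_space (spikes N)"
  by (intro prob_space_pair prob_space_gauss_vector)

lemma prob_space_noise: "prob_space (noise n N)"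
  by (intro prob_space_pair prob_space_gauss_matrix)

lemma spikes_prod:
  fixes g h :: "nat \<Rightarrow> real \<Rightarrow> real"
  assumes "\<And>j. j < N \<Longrightarrow> integrable std_normal (g j)" "\<And>j. j < N \<Longrightarrow> integrable std_normal (h j)"
  shows "integrable (spikes N) (\<lambda>(u, v). (\<Prod>j<N. g j (u j)) * (\<Prod>j<N. h j (v j)))"
    and "(\<integral>(u, v). (\<Prod>j<N. g j (u j)) * (\<Prod>j<N. h j (v j)) \<partial>spikes N) =
      (\<Prod>j<N. integral\<^sup>L std_normal (g j)) * (\<Prod>j<N. integral\<^sup>L std_normal (h j))"
proof -
  have 1: "integrable (gauss_vector N) (\<lambda>u. \<Prod>j<N. g j (u j))"
    "(\<integral>u. (\<Prod>j<N. g j (u j)) \<partial>gauss_vector N) = (\<Prod>j<N. integral\<^sup>L std_normal (g j))"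
    if "\<And>j. j < N \<Longrightarrow> integrable std_normal (g j)" for g :: "nat \<Rightarrow> real \<Rightarrow> real"
    using PiM_product_integral[OF prob_space_std_normal, of "{..<N}" g] that
    by (auto simp: gauss_vector_def)
  have gi: "integrable (gauss_vector N) (\<lambda>u. \<Prod>j<N. g j (u j))"
    and hi: "integrable (gauss_vector N) (\<lambda>v. \<Prod>j<N. h j (v j))"
    using assms by (auto intro: 1)
  show "integrable (spikes N) (\<lambda>(u, v). (\<Prod>j<N. g j (u j)) * (\<Prod>j<N. h j (v j)))"
    by (rule pair_product_integral(1)[OF prob_space_gauss_vector prob_space_gauss_vector gi hi])
  show "(\<integral>(u, v). (\<Prod>j<N. g j (u j)) * (\<Prod>j<N. h j (v j)) \<partial>spikes N) =
      (\<Prod>j<N. integral\<^sup>L std_normal (g j)) * (\<Prod>j<N. integral\<^sup>L std_normal (h j))"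
    unfolding pair_product_integral(2)[OF prob_space_gauss_vector prob_space_gauss_vector gi hi] by (simp add: 1 assms)
qed

lemma sample_prod:
  assumes "\<And>i. i < n \<Longrightarrow> integrable \<pi> (f i)"
  shows "integrable (sample n) (\<lambda>xy. \<Prod>i<n. f i (xy i) :: real)"
    and "(\<integral>xy. (\<Prod>i<n. f i (xy i)) \<partial>sample n) = (\<Prod>i<n. integral\<^sup>L \<pi> (f i))"
  using PiM_product_integral[OF prob_space_axioms, of "{..<n}" f] assms by auto

text \<open>Integrability is asked of the bound alone. If an integral of \<open>G\<close> takes the
  default value 0, the inequality still holds because the factors of the bound are
  nonnegative.\<close>

lemma latent_le:
  fixes f :: "nat \<Rightarrow> real \<times> real \<Rightarrow> real" and g h :: "nat \<Rightarrow> real \<Rightarrow> real"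
  assumes i: "\<And>i. i < n \<Longrightarrow> integrable \<pi> (f i)"
      "\<And>j. j < N \<Longrightarrow> integrable std_normal (g j)" "\<And>j. j < N \<Longrightarrow> integrable std_normal (h j)"
    and pos: "\<And>i x. 0 \<le> f i x" "\<And>j x. 0 \<le> g j x" "\<And>j x. 0 \<le> h j x"
    and le: "\<And>xy u v. G xy (u, v) \<le> (\<Prod>i<n. f i (xy i)) * ((\<Prod>j<N. g j (u j)) * (\<Prod>j<N. h j (v j)))"
  shows "(\<integral>xy. \<integral>uv. G xy uv \<partial>spikes N \<partial>sample n) \<le>
    (\<Prod>i<n. integral\<^sup>L \<pi> (f i)) * ((\<Prod>j<N. integral\<^sup>L std_normal (g j)) * (\<Prod>j<N. integral\<^sup>L std_normal (h j)))"
proof -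
  let ?K = "(\<Prod>j<N. integral\<^sup>L std_normal (g j)) * (\<Prod>j<N. integral\<^sup>L std_normal (h j))"
  have K: "?K \<ge> 0" by (auto intro!: mult_nonneg_nonneg prod_nonneg Bochner_Integration.integral_nonneg pos)
  have "(\<integral>uv. G xy uv \<partial>spikes N) \<le> (\<Prod>i<n. f i (xy i)) * ?K" for xy
  proof -
    have "(\<integral>uv. G xy uv \<partial>spikes N) \<le>
      (\<integral>uv. (\<Prod>i<n. f i (xy i)) * (case uv of (u, v) \<Rightarrow> (\<Prod>j<N. g j (u j)) * (\<Prod>j<N. h j (v j))) \<partial>spikes N)"
      using le by (intro integral_mono' integrable_mult_right spikes_prod i)
        (auto simp del: split_paired_All intro!: mult_nonneg_nonneg prod_nonneg pos)
    then show ?thesis by (simp add: spikes_prod(2) i)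
  qed
  then have "(\<integral>xy. \<integral>uv. G xy uv \<partial>spikes N \<partial>sample n) \<le> (\<integral>xy. (\<Prod>i<n. f i (xy i)) * ?K \<partial>sample n)"
    using K by (intro integral_mono' integrable_mult_left sample_prod i)
      (auto simp del: split_paired_All intro!: mult_nonneg_nonneg[OF prod_nonneg K] pos)
  then show ?thesis by (simp add: sample_prod(2) i)
qed

lemma latent_eq:
  fixes f :: "nat \<Rightarrow> real \<times> real \<Rightarrow> real" and g h :: "nat \<Rightarrow> real \<Rightarrow> real"
  assumes i: "\<And>i. i < n \<Longrightarrow> integrable \<pi> (f i)"
      "\<And>j. j < N \<Longrightarrow> integrable std_normal (g j)" "\<And>j. j < N \<Longrightarrow> integrable std_normal (h j)"
    and eq: "\<And>xy u v. G xy (u, v) = (\<Prod>i<n. f i (xy i)) * ((\<Prod>j<N. g j (u j)) * (\<Prod>j<N. h j (v j)))"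
  shows "(\<integral>xy. \<integral>uv. G xy uv \<partial>spikes N \<partial>sample n) =
    (\<Prod>i<n. integral\<^sup>L \<pi> (f i)) * ((\<Prod>j<N. integral\<^sup>L std_normal (g j)) * (\<Prod>j<N. integral\<^sup>L std_normal (h j)))"
proof -
  have "G xy uv = (\<Prod>i<n. f i (xy i)) * (case uv of (u, v) \<Rightarrow> (\<Prod>j<N. g j (u j)) * (\<Prod>j<N. h j (v j)))" for xy uv
    by (cases uv) (simp add: eq)
  then show ?thesis by (simp add: spikes_prod(2) sample_prod(2) i)
qed

definition spike_map :: "nat \<Rightarrow> nat \<Rightarrow> real \<Rightarrow> real \<Rightarrow>
    (nat \<Rightarrow> real \<times> real) \<times> ((nat \<Rightarrow> real) \<times> (nat \<Rightarrow> real)) \<times> (rmatrix \<times> rmatrix) \<Rightarrow> rmatrix \<times> rmatrix" where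
  "spike_map n N lam \<mu> = (\<lambda>(xy, (u, v), (W, Z)).
          (spiked_matrix n N lam (\<lambda>i. fst (xy i)) u W,
           spiked_matrix n N \<mu> (\<lambda>i. snd (xy i)) v Z))"

lemma law_P_eq: "law_P \<pi> lam \<mu> n N =
    distr (sample n \<Otimes>\<^sub>M (spikes N \<Otimes>\<^sub>M noise n N)) (matrix_space n N \<Otimes>\<^sub>M matrix_space n N) (spike_map n N lam \<mu>)"
  by (simp add: law_P_def spike_map_def)

lemma measurable_spike_map [measurable]:
  "spike_map n N lam \<mu> \<in>
    (sample n \<Otimes>\<^sub>M (spikes N \<Otimes>\<^sub>M noise n N)) \<rightarrow>\<^sub>M (matrix_space n N \<Otimes>\<^sub>M matrix_space n N)"
proof -
  have [measurable]: "(\<lambda>w. fst w i) \<in> sample n \<Otimes>\<^sub>M M \<rightarrow>\<^sub>M \<pi>" if "i < n" for i and M :: "'z measure"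
    using that by (intro measurable_compose[OF measurable_fst] measurable_component_singleton) auto
  show ?thesis
    unfolding spike_map_def spiked_matrix_def matrix_space_def split_def gauss_vector_def gauss_matrix_def
    by (intro measurable_Pair measurable_restrict) (auto intro!: borel_measurable_add borel_measurable_times)
qed

lemma prob_space_law_P: "prob_space (law_P \<pi> lam \<mu> n N)"
  unfolding law_P_eq
  by (intro prob_space.prob_space_distr prob_space_pair prob_space_sample prob_space_spikes
      prob_space_noise measurable_spike_map)

end

context pair_law
begin

abbreviation scale :: "real \<Rightarrow> nat \<Rightarrow> real" where
  "scale lam n \<equiv> sqrt lam / sqrt (real n)"

text \<open>Conditional expectation of a monomial given the sample and the spikes: only the noise is
  integrated out.\<close>

definition latent :: "nat \<Rightarrow> nat \<Rightarrow> real \<Rightarrow> real \<Rightarrow> (nat \<times> nat \<Rightarrow> nat) \<Rightarrow> (nat \<times> nat \<Rightarrow> nat) \<Rightarrow>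
    (nat \<Rightarrow> real \<times> real) \<Rightarrow> (nat \<Rightarrow> real) \<times> (nat \<Rightarrow> real) \<Rightarrow> real" where
  "latent n N lam \<mu> p q xy = (\<lambda>(u, v).
    (\<Prod>e\<in>grid n N. shifted_moment (p e) (scale lam n * fst (xy (fst e)) * u (snd e))) *
    (\<Prod>e\<in>grid n N. shifted_moment (q e) (scale \<mu> n * snd (xy (fst e)) * v (snd e))))"

lemma monomial_spike_map:
  "monomial n N p q (spike_map n N lam \<mu> (xy, (u, v), (W, Z))) =
    (\<Prod>e\<in>grid n N. (scale lam n * fst (xy (fst e)) * u (snd e) + W e) ^ p e) *
    (\<Prod>e\<in>grid n N. (scale \<mu> n * snd (xy (fst e)) * v (snd e) + Z e) ^ q e)"
  unfolding monomial_def spike_map_def spiked_matrix_def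
  by (auto intro!: arg_cong2[where f="(*)"] prod.cong)

text \<open>Fubini, with the noise innermost. \<open>single\<close> bounds each entry by a product
  of a constant, \<open>env\<close> and the two factors \<open>1 + \<bar>u\<bar>\<close> and
  \<open>1 + \<bar>w\<bar>\<close>, so the dominating function splits over sample, spikes and noise.
  Gaussian factors have all moments, \<open>env\<close> has four of them; this is why the row sums
  are limited.\<close>

lemma law_P_monomial:
  assumes rows: "\<And>i. i < n \<Longrightarrow> (\<Sum>j<N. p (i, j) + q (i, j)) \<le> 4"
  shows "integrable (law_P \<pi> lam \<mu> n N) (monomial n N p q)"
    and "(\<integral>XY. monomial n N p q XY \<partial>law_P \<pi> lam \<mu> n N) =
      (\<integral>xy. \<integral>uv. latent n N lam \<mu> p q xy uv \<partial>spikes N \<partial>sample n)"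
proof -
  define F where "F = (\<lambda>w. monomial n N p q (spike_map n N lam \<mu> w))"
  define c where "c = 1 + \<bar>scale lam n\<bar> + \<bar>scale \<mu> n\<bar>"
  define A where "A = (\<lambda>xy. (\<Prod>e\<in>grid n N. c ^ p e) * (\<Prod>e\<in>grid n N. c ^ q e) *
    (\<Prod>i<n. env (xy i) ^ (\<Sum>j<N. p (i, j) + q (i, j))))"
  define B where "B = (\<lambda>(u, v). (\<Prod>j<N. (1 + \<bar>u j\<bar>) ^ (\<Sum>i<n. p (i, j))) * (\<Prod>j<N. (1 + \<bar>v j\<bar> :: real) ^ (\<Sum>i<n. q (i, j))))"
  define D where "D = (\<lambda>(W, Z). (\<Prod>e\<in>grid n N. (1 + \<bar>W e\<bar>) ^ p e) * (\<Prod>e\<in>grid n N. (1 + \<bar>Z e\<bar> :: real) ^ q e))"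
  have meas [measurable]: "F \<in> borel_measurable (sample n \<Otimes>\<^sub>M (spikes N \<Otimes>\<^sub>M noise n N))"
    unfolding F_def by measurable
  have single: "\<bar>b * x * u + w\<bar> \<le> c * env xy * (1 + \<bar>u\<bar>) * (1 + \<bar>w\<bar>)"
    if "\<bar>b\<bar> \<le> c" "\<bar>x\<bar> \<le> env xy" for b x u w xy
  proof -
    have c1: "1 \<le> c" by (simp add: c_def)
    have "\<bar>b * x * u + w\<bar> \<le> \<bar>b\<bar> * \<bar>x\<bar> * \<bar>u\<bar> + \<bar>w\<bar>"
      by (metis abs_mult abs_triangle_ineq)
    also have "\<dots> \<le> c * env xy * \<bar>u\<bar> + c * env xy * \<bar>w\<bar>"
    proof (rule add_mono)
      show "\<bar>b\<bar> * \<bar>x\<bar> * \<bar>u\<bar> \<le> c * env xy * \<bar>u\<bar>"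
        using that c1 by (intro mult_right_mono mult_mono) auto
      have "1 * 1 \<le> c * env xy" using c1 env_ge(1)[of xy] by (intro mult_mono) auto
      then show "\<bar>w\<bar> \<le> c * env xy * \<bar>w\<bar>" using mult_right_mono[of 1 "c * env xy" "\<bar>w\<bar>"] by simp
    qed
    also have "\<dots> \<le> c * env xy * ((1 + \<bar>u\<bar>) * (1 + \<bar>w\<bar>))"
      unfolding distrib_left[symmetric]
      using c1 env_ge(1)[of xy] by (intro mult_left_mono) (auto simp: algebra_simps)
    finally show ?thesis by (simp add: mult.assoc)
  qed
  have bound: "\<bar>F (xy, uv, WZ)\<bar> \<le> A xy * (B uv * D WZ)" for xy uv WZ
  proof -
    obtain u v W Z where uv: "uv = (u, v)" "WZ = (W, Z)" by (metis surj_pair)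
    have "\<bar>F (xy, uv, WZ)\<bar> = (\<Prod>e\<in>grid n N. \<bar>scale lam n * fst (xy (fst e)) * u (snd e) + W e\<bar> ^ p e) *
      (\<Prod>e\<in>grid n N. \<bar>scale \<mu> n * snd (xy (fst e)) * v (snd e) + Z e\<bar> ^ q e)"
      unfolding F_def uv monomial_spike_map by (simp add: abs_mult abs_prod power_abs)
    also have "\<dots> \<le> (\<Prod>e\<in>grid n N. (c * env (xy (fst e)) * (1 + \<bar>u (snd e)\<bar>) * (1 + \<bar>W e\<bar>)) ^ p e) *
      (\<Prod>e\<in>grid n N. (c * env (xy (fst e)) * (1 + \<bar>v (snd e)\<bar>) * (1 + \<bar>Z e\<bar>)) ^ q e)"
      by (intro mult_mono prod_mono conjI power_mono single env_ge prod_nonneg ballI zero_le_power)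
        (auto simp: c_def intro!: mult_nonneg_nonneg order_trans[OF zero_le_one env_ge(1)])
    also have "\<dots> = A xy * (B uv * D WZ)"
      unfolding A_def B_def D_def uv
      by (simp add: power_mult_distrib prod.distrib prod_grid_rows[of "\<lambda>i. env (xy i)"]
        prod_grid_cols[of "\<lambda>j. 1 + \<bar>u j\<bar>"] prod_grid_cols[of "\<lambda>j. 1 + \<bar>v j\<bar>"] sum.distrib power_add)
    finally show ?thesis .
  qed
  have iA: "integrable (sample n) A"
    unfolding A_def by (intro integrable_mult_right sample_prod integrable_env_power rows)
  have iB: "integrable (spikes N) B"
    unfolding B_def by (intro spikes_prod integrable_std_normal_abs_power)
  have iD: "integrable (noise n N) D"
    unfolding D_def by (intro noise_prod integrable_std_normal_abs_power)
  have iBD: "integrable (spikes N \<Otimes>\<^sub>M noise n N) (\<lambda>(uv, WZ). B uv * D WZ)"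
    by (rule pair_product_integral(1)[OF prob_space_spikes prob_space_noise iB iD])
  have iABD: "integrable (sample n \<Otimes>\<^sub>M (spikes N \<Otimes>\<^sub>M noise n N))
      (\<lambda>(xy, r). A xy * (case r of (uv, WZ) \<Rightarrow> B uv * D WZ))"
    by (rule pair_product_integral(1)[OF prob_space_sample prob_space_pair[OF prob_space_spikes prob_space_noise] iA iBD])
  have iF: "integrable (sample n \<Otimes>\<^sub>M (spikes N \<Otimes>\<^sub>M noise n N)) F"
    by (rule Bochner_Integration.integrable_bound[OF iABD meas])
      (auto intro!: AE_I2 order_trans[OF bound])
  interpret S: prob_space "sample n" by (rule prob_space_sample)
  interpret U: prob_space "spikes N" by (rule prob_space_spikes)
  interpret Z: prob_space "noise n N" by (rule prob_space_noise)
  interpret UZ: prob_space "spikes N \<Otimes>\<^sub>M noise n N" by (intro prob_space_pair prob_space_spikes prob_space_noise)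
  interpret P1: pair_sigma_finite "sample n" "spikes N \<Otimes>\<^sub>M noise n N" ..
  interpret P2: pair_sigma_finite "spikes N" "noise n N" ..
  show "integrable (law_P \<pi> lam \<mu> n N) (monomial n N p q)"
    unfolding law_P_eq by (subst integrable_distr_eq) (use iF in \<open>auto simp: F_def\<close>)
  have "(\<integral>XY. monomial n N p q XY \<partial>law_P \<pi> lam \<mu> n N) = integral\<^sup>L (sample n \<Otimes>\<^sub>M (spikes N \<Otimes>\<^sub>M noise n N)) F"
    unfolding law_P_eq by (subst integral_distr) (auto simp: F_def)
  also have "\<dots> = (\<integral>xy. \<integral>r. F (xy, r) \<partial>(spikes N \<Otimes>\<^sub>M noise n N) \<partial>sample n)"
    by (rule P1.integral_fst'[OF iF, symmetric])
  also have "\<dots> = (\<integral>xy. \<integral>uv. latent n N lam \<mu> p q xy uv \<partial>spikes N \<partial>sample n)"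
  proof (rule Bochner_Integration.integral_cong[OF refl])
    fix xy assume xy: "xy \<in> space (sample n)"
    have [measurable]: "(\<lambda>r. F (xy, r)) \<in> borel_measurable (spikes N \<Otimes>\<^sub>M noise n N)"
      by (rule measurable_compose[OF measurable_Pair1'[OF xy] meas])
    \<comment> \<open>The second use of Fubini is pointwise in \<open>xy\<close>; there the same
      bound serves, with \<open>A xy\<close> as a constant.\<close>
    have "integrable (spikes N \<Otimes>\<^sub>M noise n N) (\<lambda>r. F (xy, r))"
      by (rule Bochner_Integration.integrable_bound[OF integrable_mult_right[OF iBD, of "A xy"]])
        (auto intro!: AE_I2 order_trans[OF bound])
    then have "(\<integral>r. F (xy, r) \<partial>(spikes N \<Otimes>\<^sub>M noise n N)) = (\<integral>uv. \<integral>WZ. F (xy, uv, WZ) \<partial>noise n N \<partial>spikes N)"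
      using P2.integral_fst'[of "\<lambda>r. F (xy, r)"] by simp
    also have "\<dots> = (\<integral>uv. latent n N lam \<mu> p q xy uv \<partial>spikes N)"
    proof (rule Bochner_Integration.integral_cong[OF refl])
      fix uv :: "(nat \<Rightarrow> real) \<times> (nat \<Rightarrow> real)"
      obtain u v where uv: "uv = (u, v)" by (metis surj_pair)
      have "F (xy, uv, WZ) = (case WZ of (W, Z) \<Rightarrow>
         (\<Prod>e\<in>grid n N. (scale lam n * fst (xy (fst e)) * u (snd e) + W e) ^ p e) *
         (\<Prod>e\<in>grid n N. (scale \<mu> n * snd (xy (fst e)) * v (snd e) + Z e) ^ q e))" for WZ
        unfolding F_def uv by (cases WZ) (simp add: monomial_spike_map)
      then show "(\<integral>WZ. F (xy, uv, WZ) \<partial>noise n N) = latent n N lam \<mu> p q xy uv"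
        unfolding latent_def uv by (simp add: noise_integral(2))
    qed
    finally show "(\<integral>r. F (xy, r) \<partial>(spikes N \<Otimes>\<^sub>M noise n N)) = (\<integral>uv. latent n N lam \<mu> p q xy uv \<partial>spikes N)" .
  qed
  finally show "(\<integral>XY. monomial n N p q XY \<partial>law_P \<pi> lam \<mu> n N) =
      (\<integral>xy. \<integral>uv. latent n N lam \<mu> p q xy uv \<partial>spikes N \<partial>sample n)" .
qed

end

section \<open>Degrees in a cycle\<close>

definition adeg :: "decoration \<Rightarrow> ('a, 'b) dgraph \<Rightarrow> 'a \<Rightarrow> nat" where
  "adeg d S i = card {j. (i, j) \<in> edges_of d S}"

definition bdeg :: "decoration \<Rightarrow> ('a, 'b) dgraph \<Rightarrow> 'b \<Rightarrow> nat" where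
  "bdeg d S j = card {i. (i, j) \<in> edges_of d S}"

definition ind :: "decoration \<Rightarrow> ('a, 'b) dgraph \<Rightarrow> 'a \<times> 'b \<Rightarrow> nat" where
  "ind d S e = (if e \<in> edges_of d S then 1 else 0)"

lemma cycles_vertices:
  assumes l: "2 \<le> l" and S: "S \<in> cycles l n N"
  shows "finite (Va S)" "finite (Vb S)" "card (Va S) = l" "card (Vb S) = l"
    "Va S \<subseteq> {..<n}" "Vb S \<subseteq> {..<N}" "edges_of d S \<subseteq> Va S \<times> Vb S" "finite (edges_of d S)"
    "diff S \<subseteq> Inl ` Va S"
proof -
  obtain a b w where s: "inj_on a {..<l}" "inj_on b {..<l}" "a ` {..<l} \<subseteq> {..<n}" "b ` {..<l} \<subseteq> {..<N}"
    "S = cycle_graph l a b w"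
    using cyclesE[OF l S] by metis
  then show 1: "finite (Va S)" "finite (Vb S)" "card (Va S) = l" "card (Vb S) = l"
    "Va S \<subseteq> {..<n}" "Vb S \<subseteq> {..<N}"
    by (auto simp: card_image)
  show 2: "edges_of d S \<subseteq> Va S \<times> Vb S"
    using dgraph_wf_cycle_graph[of l a b w] s by (auto simp: dgraph_wf_def edges_of_def)
  show "finite (edges_of d S)" using 1 2 by (meson finite_SigmaI finite_subset)
  show "diff S \<subseteq> Inl ` Va S" using S by (simp add: cycles_def)
qed

lemma card_edges_of_cycles:
  assumes l: "2 \<le> l" and S: "S \<in> cycles l n N"
  shows "card (edges_of Bullet S) + card (edges_of Circ S) = 2 * l"
proof -
  obtain a b w where s: "inj_on a {..<l}" "inj_on b {..<l}" "S = cycle_graph l a b w"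
    using cyclesE[OF l S] by metis
  then show ?thesis using card_edges_cycle_graph[OF l s(1,2)] by simp
qed

lemma adeg_outside: "2 \<le> l \<Longrightarrow> S \<in> cycles l n N \<Longrightarrow> i \<notin> Va S \<Longrightarrow> adeg d S i = 0"
  unfolding adeg_def card_eq_0_iff using cycles_vertices(7)[of l S n N d] by blast

lemma bdeg_outside: "2 \<le> l \<Longrightarrow> S \<in> cycles l n N \<Longrightarrow> j \<notin> Vb S \<Longrightarrow> bdeg d S j = 0"
  unfolding bdeg_def card_eq_0_iff using cycles_vertices(7)[of l S n N d] by blast

lemma adeg_cycles:
  assumes l: "2 \<le> l" and S: "S \<in> cycles l n N" and i: "i \<in> Va S"
  shows "adeg Bullet S i + adeg Circ S i = 2"
proof -
  obtain a b w where s: "inj_on a {..<l}" "inj_on b {..<l}" "S = cycle_graph l a b w"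
    using cyclesE[OF l S] by metis
  then obtain k where k: "k < l" "i = a k" using i by auto
  \<comment> \<open>The cyclic predecessor of \<open>k\<close>: the neighbours of \<open>a k\<close>
    are \<open>b k\<close> and \<open>b k'\<close>.\<close>
  define k' where "k' = (if k = 0 then l - 1 else k - 1)"
  have k': "k' < l" "k' \<noteq> k" "\<And>m. m < l \<Longrightarrow> Suc m mod l = k \<longleftrightarrow> m = k'"
    using k l by (auto simp: k'_def mod_Suc split: if_splits)
  have aeq: "a i = a j \<longleftrightarrow> i = j" "b i = b j \<longleftrightarrow> i = j" if "i < l" "j < l" for i j
    using that s by (auto dest: inj_onD)
  have m: "Suc i mod l < l" for i using l by simp
  have "{j. (i, j) \<in> edges_of Bullet S} \<union> {j. (i, j) \<in> edges_of Circ S} = {j. (i, j) \<in> edges S}"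
    by (auto simp: edges_of_def edges_def) (metis decoration.exhaust)
  also have "\<dots> = {b k, b k'}"
  proof -
    have "(a k, j) \<in> edges S \<longleftrightarrow> (\<exists>m<l. j = b m \<and> (k = m \<or> k = Suc m mod l))" for j
      unfolding s(3) cycle_graph_edges[OF s(2)] using aeq(1)[OF k(1)] m by auto
    also have "(\<exists>m<l. j = b m \<and> (k = m \<or> k = Suc m mod l)) \<longleftrightarrow> j = b k \<or> j = b k'" for j
      using k(1) k' by metis
    finally show ?thesis unfolding k(2) by auto
  qed
  finally have "card ({j. (i, j) \<in> edges_of Bullet S} \<union> {j. (i, j) \<in> edges_of Circ S}) = 2"
    using aeq(2)[OF k(1) k'(1)] k' by simp
  moreover have "card ({j. (i, j) \<in> edges_of Bullet S} \<union> {j. (i, j) \<in> edges_of Circ S}) =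
      adeg Bullet S i + adeg Circ S i"
    unfolding adeg_def
  proof (rule card_Un_disjoint)
    show "finite {j. (i, j) \<in> edges_of d S}" for d
      by (rule finite_subset[OF _ cycles_vertices(2)[OF l S]]) (use cycles_vertices(7)[OF l S] in blast)
    then show "finite {j. (i, j) \<in> edges_of Circ S}" .
  qed (auto simp: edges_of_def)
  ultimately show ?thesis by simp
qed

lemma bdeg_cycles:
  assumes l: "2 \<le> l" and S: "S \<in> cycles l n N" and j: "j \<in> Vb S"
  shows "(bdeg Bullet S j = 2 \<and> bdeg Circ S j = 0) \<or> (bdeg Bullet S j = 0 \<and> bdeg Circ S j = 2)"
proof -
  obtain a b w where s: "inj_on a {..<l}" "inj_on b {..<l}" "S = cycle_graph l a b w"
    using cyclesE[OF l S] by metis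
  then obtain k where k: "k < l" "j = b k" using j by auto
  have beq: "b i = b j \<longleftrightarrow> i = j" if "i < l" "j < l" for i j
    using that s by (auto dest: inj_onD)
  have "{i. (i, j) \<in> edges_of d S} = (if w k = d then {a k, a (Suc k mod l)} else {})" for d
    unfolding s(3) k(2) edges_of_cycle_graph[OF s(2)] using beq k by auto
  moreover have "a k \<noteq> a (Suc k mod l)"
    using Suc_mod_neq[OF l k(1)] inj_onD[OF s(1), of k "Suc k mod l"] k by fastforce
  ultimately have "bdeg d S j = (if w k = d then 2 else 0)" for d
    by (simp add: bdeg_def)
  then show ?thesis by (cases "w k") auto
qed

lemma diff_iff_adeg:
  assumes l: "2 \<le> l" and S: "S \<in> cycles l n N"
  shows "Inl i \<in> diff S \<longleftrightarrow> adeg Bullet S i > 0 \<and> adeg Circ S i > 0"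
proof -
  have "finite {j. (i, j) \<in> edges_of d S}" for d
    by (rule finite_subset[OF _ cycles_vertices(2)[OF l S]]) (use cycles_vertices(7)[OF l S] in blast)
  then show ?thesis
    by (auto simp: Inl_in_diff_iff adeg_def card_gt_0_iff edges_of_def)
qed

lemma sum_ind:
  assumes l: "2 \<le> l" and S: "S \<in> cycles l n N"
  shows "(\<Sum>j<N. ind d S (i, j)) = adeg d S i"
    and "(\<Sum>i<n. ind d S (i, j)) = bdeg d S j"
    and "(\<Sum>e\<in>grid n N. ind d S e) = card (edges_of d S)"
proof -
  note v = cycles_vertices[OF l S]
  have sub: "edges_of d S \<subseteq> grid n N" using v(5,6) v(7)[of d] by blast
  have "{..<N} \<inter> {j. (i, j) \<in> edges_of d S} = {j. (i, j) \<in> edges_of d S}" using sub by auto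
  then show "(\<Sum>j<N. ind d S (i, j)) = adeg d S i"
    by (simp add: ind_def sum.If_cases adeg_def)
  have "{..<n} \<inter> {i. (i, j) \<in> edges_of d S} = {i. (i, j) \<in> edges_of d S}" using sub by auto
  then show "(\<Sum>i<n. ind d S (i, j)) = bdeg d S j"
    by (simp add: ind_def sum.If_cases bdeg_def)
  have "grid n N \<inter> edges_of d S = edges_of d S" using sub by auto
  then show "(\<Sum>e\<in>grid n N. ind d S e) = card (edges_of d S)"
    by (simp add: ind_def sum.If_cases)
qed

lemma h_sub_eq_monomial:
  assumes l: "2 \<le> l" and S: "S \<in> cycles l n N"
  shows "h_sub S = monomial n N (ind Bullet S) (ind Circ S)"
proof -
  have *: "(\<Prod>e\<in>edges_of d S. X e) = (\<Prod>e\<in>grid n N. X e ^ ind d S e)" for d and X :: rmatrix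
  proof -
    have "edges_of d S \<subseteq> grid n N" using cycles_vertices(5,6,7)[OF l S] by blast
    then have "grid n N \<inter> edges_of d S = edges_of d S" by auto
    moreover have "(\<Prod>e\<in>grid n N. X e ^ ind d S e) = (\<Prod>e\<in>grid n N. if e \<in> edges_of d S then X e else 1)"
      by (intro prod.cong) (auto simp: ind_def)
    ultimately show ?thesis by (simp add: prod.If_cases)
  qed
  show ?thesis by (simp add: h_sub_def monomial_def * fun_eq_iff)
qed

lemma monomial_mult:
  "monomial n N p q XY * monomial n N p' q' XY = monomial n N (\<lambda>e. p e + p' e) (\<lambda>e. q e + q' e) XY"
  by (cases XY) (simp add: monomial_def power_add prod.distrib)

lemma h_sub_mult:
  assumes "2 \<le> l" "S \<in> cycles l n N" "K \<in> cycles l n N"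
  shows "h_sub S XY * h_sub K XY = monomial n N (\<lambda>e. ind Bullet S e + ind Bullet K e)
    (\<lambda>e. ind Circ S e + ind Circ K e) XY"
  by (simp add: h_sub_eq_monomial[OF assms(1,2)] h_sub_eq_monomial[OF assms(1,3)] monomial_mult)

lemma adeg_le: "2 \<le> l \<Longrightarrow> S \<in> cycles l n N \<Longrightarrow> adeg Bullet S i + adeg Circ S i \<le> 2"
  using adeg_cycles[of l S n N i] adeg_outside[of l S n N i] by (cases "i \<in> Va S") auto

lemma bdeg_le: "2 \<le> l \<Longrightarrow> S \<in> cycles l n N \<Longrightarrow> bdeg d S i \<le> 2"
  using bdeg_cycles[of l S n N i] bdeg_outside[of l S n N i d] by (cases "i \<in> Vb S"; cases d) auto

section \<open>The statistic under the null law\<close>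

text \<open>Orthonormality. For \<open>S \<noteq> K\<close> some entry of one of the matrices occurs
  exactly once and has mean zero: otherwise the decorated edges coincide, and \<open>2 l\<close>
  shared edges against at most \<open>2 l\<close> shared vertices contradict
  \<open>shared_edges_less\<close>.\<close>

lemma law_Q_cycles:
  assumes l: "2 \<le> l" and S: "S \<in> cycles l n N" and K: "K \<in> cycles l n N"
  shows "integrable (law_Q n N) (\<lambda>XY. h_sub S XY * h_sub K XY)"
    and "(\<integral>XY. h_sub S XY * h_sub K XY \<partial>law_Q n N) = (if S = K then 1 else 0)"
proof -
  show "integrable (law_Q n N) (\<lambda>XY. h_sub S XY * h_sub K XY)"
    using law_Q_monomial(1) by (simp add: h_sub_mult[OF assms])
  have E: "(\<integral>XY. h_sub S XY * h_sub K XY \<partial>law_Q n N) =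
     (\<Prod>e\<in>grid n N. shifted_moment (ind Bullet S e + ind Bullet K e) 0) *
     (\<Prod>e\<in>grid n N. shifted_moment (ind Circ S e + ind Circ K e) 0)"
    by (simp add: h_sub_mult[OF assms] law_Q_monomial(2))
  show "(\<integral>XY. h_sub S XY * h_sub K XY \<partial>law_Q n N) = (if S = K then 1 else 0)"
  proof (cases "S = K")
    case True
    have "shifted_moment (ind d K e + ind d K e) 0 = 1" for d e
      by (simp add: ind_def shifted_moment_simps flip: numeral_2_eq_2)
    then show ?thesis using E True by simp
  next
    case False
    have "\<exists>d e. e \<in> grid n N \<and> ind d S e + ind d K e = 1"
    proof (rule ccontr)
      assume no: "\<not> ?thesis"
      have "edges_of d S = edges_of d K" for d
      proof -
        have "e \<in> edges_of d S \<longleftrightarrow> e \<in> edges_of d K" for e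
        proof (cases "e \<in> grid n N")
          case True
          then show ?thesis using no by (auto simp: ind_def split: if_splits)
        next
          case False
          then show ?thesis using cycles_vertices(5,6,7)[OF l S] cycles_vertices(5,6,7)[OF l K] by blast
        qed
        then show ?thesis by blast
      qed
      then have "card (edges_of Bullet S \<inter> edges_of Bullet K) + card (edges_of Circ S \<inter> edges_of Circ K) = 2 * l"
        using card_edges_of_cycles[OF l S] by simp
      moreover have "card (Va S \<inter> Va K) \<le> l" "card (Vb S \<inter> Vb K) \<le> l"
        using cycles_vertices(1-4)[OF l S] card_mono[of "Va S" "Va S \<inter> Va K"] card_mono[of "Vb S" "Vb S \<inter> Vb K"]
        by auto
      moreover have "Va S \<inter> Va K \<noteq> {}"
      proof -
        have "edges_of Bullet S \<noteq> {} \<or> edges_of Circ S \<noteq> {}"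
          using card_edges_of_cycles[OF l S] l by auto
        then show ?thesis
          using \<open>\<And>d. edges_of d S = edges_of d K\<close> cycles_vertices(7)[OF l S] cycles_vertices(7)[OF l K]
          by blast
      qed
      ultimately show False using shared_edges_less[OF l S K False] by linarith
    qed
    then obtain d e where de: "e \<in> grid n N" "ind d S e + ind d K e = 1" by blast
    have "(\<Prod>e\<in>grid n N. shifted_moment (ind d S e + ind d K e) 0) = 0"
    proof (rule prod_zero)
      have "shifted_moment (ind d S e + ind d K e) 0 = 0"
        unfolding de(2) by (simp add: shifted_moment_simps)
      then show "\<exists>e\<in>grid n N. shifted_moment (ind d S e + ind d K e) 0 = 0" using de(1) by blast
    qed simp
    then show ?thesis using E False by (cases d) auto
  qed
qed

section \<open>Moments under the planted law\<close>

text \<open>Products run over all \<open>n\<close> or \<open>N\<close> vertices, but only those of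
  the cycles contribute more than 1; the bound therefore depends on the cycle length alone.\<close>

lemma prod_le_power_card:
  fixes f :: "'a \<Rightarrow> real"
  assumes "finite I" "finite T" "card T \<le> k" "1 \<le> B" "\<And>i. i \<in> I \<Longrightarrow> 0 \<le> f i"
    and "\<And>i. i \<in> I \<Longrightarrow> i \<in> T \<Longrightarrow> f i \<le> B" "\<And>i. i \<in> I \<Longrightarrow> i \<notin> T \<Longrightarrow> f i \<le> 1"
  shows "(\<Prod>i\<in>I. f i) \<le> B ^ k"
proof -
  have "(\<Prod>i\<in>I. f i) \<le> (\<Prod>i\<in>I. if i \<in> T then B else 1)"
    using assms by (intro prod_mono) auto
  also have "\<dots> = B ^ card (I \<inter> T)"
    using assms(1) by (simp add: prod.If_cases)
  also have "card (I \<inter> T) \<le> card T" using assms(2) by (intro card_mono) auto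
  then have "B ^ card (I \<inter> T) \<le> B ^ k" using assms(3,4) by (intro power_increasing) auto
  finally show ?thesis .
qed

context pair_law
begin

definition moment :: "nat \<Rightarrow> nat \<Rightarrow> real" where
  "moment a b = (\<integral>p. fst p ^ a * snd p ^ b \<partial>\<pi>)"

definition normal_moment :: "nat \<Rightarrow> real" where
  "normal_moment k = (\<integral>x. x ^ k \<partial>std_normal)"

lemma moment_simps: "moment 0 0 = 1" "moment 2 0 = 1" "moment 0 2 = 1" "moment 1 1 = \<rho>"
  using var cov by (simp_all add: moment_def prob_space)

lemma normal_moment_simps: "normal_moment 0 = 1" "normal_moment 2 = 1"
proof -
  have "measure std_normal UNIV = 1"
    using prob_space.prob_space[OF prob_space_std_normal] by simp
  then show "normal_moment 0 = 1" "normal_moment 2 = 1"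
    using integral_std_normal_even[of 1] by (simp_all add: normal_moment_def fact_2)
qed

text \<open>For exponents at most 1 the shifted moment of order \<open>k\<close> is
  \<open>s ^ k\<close>, so the noise disappears and the expectation factors exactly over vertices.
  This covers single cycles and vertex-disjoint pairs.\<close>

lemma simple_monomial:
  assumes p: "\<And>e. e \<in> grid n N \<Longrightarrow> p e \<le> 1" "\<And>e. e \<in> grid n N \<Longrightarrow> q e \<le> 1"
    and rows: "\<And>i. i < n \<Longrightarrow> (\<Sum>j<N. p (i, j) + q (i, j)) \<le> 4"
  shows "(\<integral>XY. monomial n N p q XY \<partial>law_P \<pi> lam \<mu> n N) =
    scale lam n ^ (\<Sum>e\<in>grid n N. p e) * scale \<mu> n ^ (\<Sum>e\<in>grid n N. q e) *
    (\<Prod>i<n. moment (\<Sum>j<N. p (i, j)) (\<Sum>j<N. q (i, j))) *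
    ((\<Prod>j<N. normal_moment (\<Sum>i<n. p (i, j))) * (\<Prod>j<N. normal_moment (\<Sum>i<n. q (i, j))))"
proof -
  let ?K = "scale lam n ^ (\<Sum>e\<in>grid n N. p e) * scale \<mu> n ^ (\<Sum>e\<in>grid n N. q e)"
  have sm: "shifted_moment k s = s ^ k" if "k \<le> 1" for k s
    using that by (cases k) (auto simp: shifted_moment_simps)
  define G where "G = (\<lambda>xy (u, v). (\<Prod>i<n. fst (xy i) ^ (\<Sum>j<N. p (i, j)) * snd (xy i) ^ (\<Sum>j<N. q (i, j))) *
      ((\<Prod>j<N. u j ^ (\<Sum>i<n. p (i, j))) * (\<Prod>j<N. (v j :: real) ^ (\<Sum>i<n. q (i, j)))))"
  have lat: "latent n N lam \<mu> p q xy uv = ?K * G xy uv" for xy uv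
  proof -
    obtain u v where uv: "uv = (u, v)" by (metis surj_pair)
    have "latent n N lam \<mu> p q xy uv =
      (\<Prod>e\<in>grid n N. (scale lam n * fst (xy (fst e)) * u (snd e)) ^ p e) *
      (\<Prod>e\<in>grid n N. (scale \<mu> n * snd (xy (fst e)) * v (snd e)) ^ q e)"
      unfolding latent_def uv using p by (simp add: sm cong: prod.cong)
    also have "\<dots> = ?K * G xy uv"
      unfolding G_def uv prod.case power_mult_distrib prod.distrib prod_grid_rows[of "\<lambda>i. fst (xy i)"]
        prod_grid_rows[of "\<lambda>i. snd (xy i)"] prod_grid_cols[of u] prod_grid_cols[of v]
        power_sum[of "scale lam n"] power_sum[of "scale \<mu> n"]
      by (simp only: mult_ac)
    finally show ?thesis .
  qed
  have "(\<integral>xy. \<integral>uv. G xy uv \<partial>spikes N \<partial>sample n) =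
     (\<Prod>i<n. moment (\<Sum>j<N. p (i, j)) (\<Sum>j<N. q (i, j))) *
    ((\<Prod>j<N. normal_moment (\<Sum>i<n. p (i, j))) * (\<Prod>j<N. normal_moment (\<Sum>i<n. q (i, j))))"
    unfolding moment_def normal_moment_def
  proof (rule latent_eq)
    show "integrable \<pi> (\<lambda>pa. fst pa ^ (\<Sum>j<N. p (i, j)) * snd pa ^ (\<Sum>j<N. q (i, j)))" if "i < n" for i
      using rows[OF that] by (intro integrable_coord_monomial) (simp add: sum.distrib)
  qed (auto simp: G_def integrable_std_normal_power)
  moreover have "(\<integral>XY. monomial n N p q XY \<partial>law_P \<pi> lam \<mu> n N) =
      (\<integral>xy. \<integral>uv. latent n N lam \<mu> p q xy uv \<partial>spikes N \<partial>sample n)"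
    by (rule law_P_monomial(2)) (rule rows)
  ultimately show ?thesis
    unfolding lat by simp
qed

text \<open>At an a-vertex of the cycle the degrees in the two decorations are
  \<open>(2, 0)\<close>, \<open>(0, 2)\<close> or \<open>(1, 1)\<close>, with moments 1, 1 and
  \<rho>; at a b-vertex only the second moment of one spike coordinate occurs. The
  \<open>2 l\<close> edges carry a factor \<open>1 / sqrt n\<close> each, whence
  \<open>1 / n ^ l\<close>.\<close>

lemma expectation_h_sub:
  assumes l: "2 \<le> l" and S: "S \<in> cycles l n N" and n: "0 < n"
  shows "integrable (law_P \<pi> lam \<mu> n N) (h_sub S)"
    and "(\<integral>XY. h_sub S XY \<partial>law_P \<pi> lam \<mu> n N) = Upsilon lam \<mu> \<rho> S / real n ^ l"
proof -
  note s = sum_ind[OF l S]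
  have rows: "(\<Sum>j<N. ind Bullet S (i, j) + ind Circ S (i, j)) \<le> 4" for i
    using adeg_le[OF l S, of i] by (simp add: sum.distrib s)
  show "integrable (law_P \<pi> lam \<mu> n N) (h_sub S)"
    unfolding h_sub_eq_monomial[OF l S] by (intro law_P_monomial rows)
  have D: "finite (diff S)" using cycles_vertices(1,9)[OF l S] by (meson finite_imageI finite_subset)
  have "(\<Prod>i<n. moment (adeg Bullet S i) (adeg Circ S i)) = (\<Prod>i<n. if Inl i \<in> diff S then \<rho> else 1)"
  proof (intro prod.cong refl)
    fix i
    show "moment (adeg Bullet S i) (adeg Circ S i) = (if Inl i \<in> diff S then \<rho> else 1)"
    proof (cases "i \<in> Va S")
      case True
      from adeg_cycles[OF l S True] have "adeg Bullet S i = 2 \<and> adeg Circ S i = 0 \<or>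
          adeg Bullet S i = 0 \<and> adeg Circ S i = 2 \<or> adeg Bullet S i = 1 \<and> adeg Circ S i = 1"
        by linarith
      then show ?thesis
        unfolding diff_iff_adeg[OF l S] using moment_simps by auto
    next
      case False
      then show ?thesis
        unfolding diff_iff_adeg[OF l S] using adeg_outside[OF l S False] moment_simps by auto
    qed
  qed
  also have "\<dots> = \<rho> ^ card {i\<in>{..<n}. Inl i \<in> diff S}"
    by (simp add: prod.If_cases Int_def)
  also have "card {i\<in>{..<n}. Inl i \<in> diff S} = card (diff S)"
  proof -
    have "diff S = Inl ` {i\<in>{..<n}. Inl i \<in> diff S}"
      using cycles_vertices(5,9)[OF l S] by (fastforce simp: image_iff)
    then show ?thesis by (metis card_image inj_Inl inj_on_subset subset_UNIV)
  qed
  finally have a: "(\<Prod>i<n. moment (adeg Bullet S i) (adeg Circ S i)) = \<rho> ^ card (diff S)" .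
  have b: "normal_moment (bdeg d S j) = 1" for d j
    using bdeg_cycles[OF l S, of j] bdeg_outside[OF l S, of j] normal_moment_simps
    by (cases "j \<in> Vb S"; cases d) auto
  have "(\<integral>XY. h_sub S XY \<partial>law_P \<pi> lam \<mu> n N) =
     scale lam n ^ card (edges_of Bullet S) * scale \<mu> n ^ card (edges_of Circ S) * \<rho> ^ card (diff S)"
    unfolding h_sub_eq_monomial[OF l S]
    by (subst simple_monomial[OF _ _ rows]) (auto simp: s a b, auto simp: ind_def)
  also have "\<dots> = Upsilon lam \<mu> \<rho> S / sqrt (real n) ^ (card (edges_of Bullet S) + card (edges_of Circ S))"
    by (simp add: Upsilon_def power_divide power_add field_simps)
  also have "sqrt (real n) ^ (card (edges_of Bullet S) + card (edges_of Circ S)) = real n ^ l"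
    unfolding card_edges_of_cycles[OF l S] by (simp add: power_mult)
  finally show "(\<integral>XY. h_sub S XY \<partial>law_P \<pi> lam \<mu> n N) = Upsilon lam \<mu> \<rho> S / real n ^ l" .
qed

lemma rows_pair:
  assumes l: "2 \<le> l" and S: "S \<in> cycles l n N" and K: "K \<in> cycles l n N"
  shows "(\<Sum>j<N. ind Bullet S (i, j) + ind Bullet K (i, j) + (ind Circ S (i, j) + ind Circ K (i, j))) \<le> 4"
  using adeg_le[OF l S, of i] adeg_le[OF l K, of i]
  by (simp add: sum.distrib sum_ind[OF l S] sum_ind[OF l K])

lemma integrable_h_sub_mult:
  assumes l: "2 \<le> l" and S: "S \<in> cycles l n N" and K: "K \<in> cycles l n N"
  shows "integrable (law_P \<pi> lam \<mu> n N) (\<lambda>XY. h_sub S XY * h_sub K XY)"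
  unfolding h_sub_mult[OF assms] by (intro law_P_monomial rows_pair[OF assms])

text \<open>Every vertex belongs to at most one of the cycles, so each one-vertex moment is a
  product in which one factor is a zeroth moment. The pair has zero covariance.\<close>

lemma expectation_disjoint:
  assumes l: "2 \<le> l" and S: "S \<in> cycles l n N" and K: "K \<in> cycles l n N" and n: "0 < n"
    and dis: "Va S \<inter> Va K = {}" "Vb S \<inter> Vb K = {}"
  shows "(\<integral>XY. h_sub S XY * h_sub K XY \<partial>law_P \<pi> lam \<mu> n N) =
    Upsilon lam \<mu> \<rho> S / real n ^ l * (Upsilon lam \<mu> \<rho> K / real n ^ l)"
proof -
  note s = sum_ind[OF l S] sum_ind[OF l K]
  have one: "ind d S e + ind d K e \<le> 1" for d e
    using cycles_vertices(7)[OF l S, of d] cycles_vertices(7)[OF l K, of d] dis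
    by (auto simp: ind_def)
  have rows1: "(\<Sum>j<N. ind Bullet H (i, j) + ind Circ H (i, j)) \<le> 4" if "H \<in> cycles l n N" for H i
    using adeg_le[OF l that, of i] by (simp add: sum.distrib sum_ind[OF l that])
  have a: "moment (adeg Bullet S i + adeg Bullet K i) (adeg Circ S i + adeg Circ K i) =
      moment (adeg Bullet S i) (adeg Circ S i) * moment (adeg Bullet K i) (adeg Circ K i)" for i
  proof (cases "i \<in> Va S")
    case True
    then have "i \<notin> Va K" using dis by auto
    then show ?thesis using adeg_outside[OF l K] moment_simps by simp
  next
    case False
    then show ?thesis using adeg_outside[OF l S] moment_simps by simp
  qed
  have b: "normal_moment (bdeg d S j + bdeg d K j) = normal_moment (bdeg d S j) * normal_moment (bdeg d K j)" for d j
  proof (cases "j \<in> Vb S")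
    case True
    then have "j \<notin> Vb K" using dis by auto
    then show ?thesis using bdeg_outside[OF l K] normal_moment_simps by simp
  next
    case False
    then show ?thesis using bdeg_outside[OF l S] normal_moment_simps by simp
  qed
  have E: "(\<integral>XY. h_sub H XY \<partial>law_P \<pi> lam \<mu> n N) =
     scale lam n ^ card (edges_of Bullet H) * scale \<mu> n ^ card (edges_of Circ H) *
     (\<Prod>i<n. moment (adeg Bullet H i) (adeg Circ H i)) *
     ((\<Prod>j<N. normal_moment (bdeg Bullet H j)) * (\<Prod>j<N. normal_moment (bdeg Circ H j)))"
    if H: "H \<in> cycles l n N" for H
    unfolding h_sub_eq_monomial[OF l H]
    by (subst simple_monomial[OF _ _ rows1[OF H]]) (auto simp: sum_ind[OF l H], auto simp: ind_def)
  have "(\<integral>XY. h_sub S XY * h_sub K XY \<partial>law_P \<pi> lam \<mu> n N) =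
     scale lam n ^ (card (edges_of Bullet S) + card (edges_of Bullet K)) *
     scale \<mu> n ^ (card (edges_of Circ S) + card (edges_of Circ K)) *
     (\<Prod>i<n. moment (adeg Bullet S i + adeg Bullet K i) (adeg Circ S i + adeg Circ K i)) *
     ((\<Prod>j<N. normal_moment (bdeg Bullet S j + bdeg Bullet K j)) *
      (\<Prod>j<N. normal_moment (bdeg Circ S j + bdeg Circ K j)))"
    unfolding h_sub_mult[OF l S K]
    by (subst simple_monomial[OF one one rows_pair[OF l S K]]) (simp add: s sum.distrib)
  also have "\<dots> = (\<integral>XY. h_sub S XY \<partial>law_P \<pi> lam \<mu> n N) * (\<integral>XY. h_sub K XY \<partial>law_P \<pi> lam \<mu> n N)"
    unfolding a b E[OF S] E[OF K] prod.distrib power_add by (simp only: mult_ac)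
  finally show ?thesis
    unfolding expectation_h_sub(2)[OF l S n] expectation_h_sub(2)[OF l K n] .
qed

end

section \<open>Bounds for the joint moments of two cycles\<close>

lemma square_excess:
  fixes X :: "'a \<Rightarrow> real"
  assumes "prob_space M" and i: "integrable M (\<lambda>x. X x ^ 2)" "integrable M (\<lambda>x. X x ^ 4)"
    and B: "(\<integral>x. X x ^ 2 \<partial>M) \<le> B" "(\<integral>x. X x ^ 4 \<partial>M) \<le> B" and c: "0 \<le> c" "c \<le> 1"
  shows "integrable M (\<lambda>x. (1 + c * X x ^ 2)\<^sup>2)" "(\<integral>x. (1 + c * X x ^ 2)\<^sup>2 \<partial>M) \<le> 1 + 3 * c * B"
proof -
  interpret prob_space M by fact
  have eq: "(1 + c * X x ^ 2)\<^sup>2 = 1 + 2 * c * X x ^ 2 + c\<^sup>2 * X x ^ 4" for x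
    by (simp add: power2_eq_square power4_eq_xxxx algebra_simps)
  show "integrable M (\<lambda>x. (1 + c * X x ^ 2)\<^sup>2)"
    unfolding eq using i by auto
  have "(\<integral>x. (1 + c * X x ^ 2)\<^sup>2 \<partial>M) = 1 + 2 * c * (\<integral>x. X x ^ 2 \<partial>M) + c\<^sup>2 * (\<integral>x. X x ^ 4 \<partial>M)"
    unfolding eq using i by (simp add: prob_space)
  also have "\<dots> \<le> 1 + 2 * c * B + c * B"
  proof -
    have "0 \<le> (\<integral>x. X x ^ 4 \<partial>M)" by (intro Bochner_Integration.integral_nonneg) simp
    moreover have "c\<^sup>2 \<le> c" using c by (simp add: power2_eq_square mult_left_le)
    ultimately have "c\<^sup>2 * (\<integral>x. X x ^ 4 \<partial>M) \<le> c * B"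
      using B c by (intro mult_mono) auto
    moreover have "2 * c * (\<integral>x. X x ^ 2 \<partial>M) \<le> 2 * c * B"
      using B c by (intro mult_left_mono) auto
    ultimately show ?thesis by linarith
  qed
  finally show "(\<integral>x. (1 + c * X x ^ 2)\<^sup>2 \<partial>M) \<le> 1 + 3 * c * B" by (simp add: algebra_simps)
qed

definition normal_bound :: real where
  "normal_bound = (\<integral>x. (1 + \<bar>x\<bar>) ^ 4 \<partial>std_normal)"

lemma normal_bound:
  assumes "k \<le> 4"
  shows "(\<integral>x. (1 + \<bar>x\<bar>) ^ k \<partial>std_normal) \<le> normal_bound"
  unfolding normal_bound_def using assms
  by (intro integral_mono integrable_std_normal_abs_power power_increasing) auto

lemma normal_bound_ge_1: "1 \<le> normal_bound"
  using normal_bound[of 0] prob_space.prob_space[OF prob_space_std_normal] by simp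

context pair_law
begin

definition env_bound :: real where
  "env_bound = 27 * (1 + 2 * C)"

lemma env_bound: "k \<le> 4 \<Longrightarrow> (\<integral>p. env p ^ k \<partial>\<pi>) \<le> env_bound"
  unfolding env_bound_def by (rule integrable_env_power)

lemma env_bound_ge_1: "1 \<le> env_bound"
  using env_bound[of 0] by (simp add: prob_space)

lemma scale_bound:
  assumes "0 \<le> lam" "lam \<le> L" "1 \<le> L"
  shows "0 \<le> scale lam n" "scale lam n \<le> L / sqrt (real n)"
proof -
  have "L * 1 \<le> L * L" using assms by (intro mult_left_mono) auto
  then have "lam \<le> L\<^sup>2" using assms unfolding power2_eq_square by linarith
  then have "sqrt lam \<le> L" using assms by (intro real_le_lsqrt) auto
  then show "scale lam n \<le> L / sqrt (real n)" by (intro divide_right_mono) auto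
qed (use assms in simp)

text \<open>The excess over 1 has to be small, not merely bounded. An entry on the cycle contributes
  \<open>1 + s\<^sup>2\<close> with spike part \<open>s\<close>, and after decoupling each vertex
  costs a factor \<open>1 + O(c)\<close> with \<open>c\<close> of order
  \<open>n^(-1/2)\<close>.\<close>

lemma expectation_h_sub_square_le:
  assumes l: "2 \<le> l" and S: "S \<in> cycles l n N"
    and L: "0 \<le> lam" "lam \<le> L" "0 \<le> \<mu>" "\<mu> \<le> L" "1 \<le> L" and c: "c = L / sqrt (real n)" "c \<le> 1"
  shows "(\<integral>XY. h_sub S XY * h_sub S XY \<partial>law_P \<pi> lam \<mu> n N) \<le>
    (1 + 3 * c * env_bound) ^ l * ((1 + 3 * c * normal_bound) ^ l * (1 + 3 * c * normal_bound) ^ l)"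
proof -
  note s = sum_ind[OF l S]
  have c0: "0 \<le> c" using L c by simp
  \<comment> \<open>The exponents are degrees, and these are 0 or 2. The factors are therefore 1 or
    the squares treated by \<open>square_excess\<close>, where \<open>c\<^sup>2 \<le> c\<close>
    keeps the excess linear in \<open>c\<close>.\<close>
  define f where "f = (\<lambda>i p. (1 + c * env p ^ 2) ^ (adeg Bullet S i + adeg Circ S i))"
  define g where "g = (\<lambda>d j x. (1 + c * (1 + \<bar>x\<bar>) ^ 2) ^ bdeg d S j :: real)"
  have sm: "0 \<le> shifted_moment (k + k) (a * x * u) \<and>
      shifted_moment (k + k) (a * x * u) \<le> ((1 + c * env xy ^ 2) * (1 + c * (1 + \<bar>u\<bar>) ^ 2)) ^ k"
    if "k \<le> 1" "0 \<le> a" "a \<le> c" "\<bar>x\<bar> \<le> env xy" for k a x u xy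
  proof (cases "k = 0")
    case False
    then have k: "k = 1" using that by simp
    have "(a * x * u)\<^sup>2 = (a * \<bar>x\<bar> * \<bar>u\<bar>)\<^sup>2" by (simp add: power_mult_distrib)
    also have "\<dots> \<le> (c * env xy * (1 + \<bar>u\<bar>))\<^sup>2"
      using that c0 by (intro power_mono mult_mono) auto
    finally have "1 + (a * x * u)\<^sup>2 \<le> 1 + (c * env xy * (1 + \<bar>u\<bar>))\<^sup>2" by simp
    txt \<open>This decouples the two endpoints at the cost of replacing \<open>c\<^sup>2\<close> by \<open>c\<close>.\<close>
    also have "\<dots> \<le> (1 + c * env xy ^ 2) * (1 + c * (1 + \<bar>u\<bar>) ^ 2)"
    proof -
      have "0 \<le> c * env xy ^ 2 + c * (1 + \<bar>u\<bar>) ^ 2" using c0 by simp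
      then show ?thesis by (simp add: algebra_simps power2_eq_square)
    qed
    finally show ?thesis using k by (simp add: shifted_moment_simps flip: numeral_2_eq_2)
  qed (simp add: shifted_moment_simps)
  have ind1: "ind d S e \<le> 1" for d e by (simp add: ind_def)
  note sc = scale_bound[OF L(1,2,5), of n, folded c(1)] scale_bound[OF L(3,4,5), of n, folded c(1)]
  \<comment> \<open>The pair \<open>(x, 0)\<close> is a dummy: nonnegativity holds for every real
    \<open>x\<close>, and \<open>env\<close> of this pair dominates
    \<open>\<bar>x\<bar>\<close>.\<close>
  have nn: "0 \<le> shifted_moment (ind d S e + ind d S e) (a * x * u)" if "0 \<le> a" "a \<le> c" for a x u d e
    using sm[OF ind1 that env_ge(2)[of "(x, 0)"]] by simp
  have pos: "0 \<le> f i p" "0 \<le> g d j x" for i p d j x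
    using c0 by (auto simp: f_def g_def)
  have le: "latent n N lam \<mu> (\<lambda>e. ind Bullet S e + ind Bullet S e) (\<lambda>e. ind Circ S e + ind Circ S e) xy (u, v)
     \<le> (\<Prod>i<n. f i (xy i)) * ((\<Prod>j<N. g Bullet j (u j)) * (\<Prod>j<N. g Circ j (v j)))" for xy u v
  proof -
    have "latent n N lam \<mu> (\<lambda>e. ind Bullet S e + ind Bullet S e) (\<lambda>e. ind Circ S e + ind Circ S e) xy (u, v)
       \<le> (\<Prod>e\<in>grid n N. ((1 + c * env (xy (fst e)) ^ 2) * (1 + c * (1 + \<bar>u (snd e)\<bar>) ^ 2)) ^ ind Bullet S e) *
         (\<Prod>e\<in>grid n N. ((1 + c * env (xy (fst e)) ^ 2) * (1 + c * (1 + \<bar>v (snd e)\<bar>) ^ 2)) ^ ind Circ S e)"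
      unfolding latent_def prod.case
      using c0 by (intro mult_mono prod_mono sm[OF ind1] sc env_ge nn prod_nonneg ballI
          zero_le_power mult_nonneg_nonneg) auto
    also have "\<dots> = (\<Prod>i<n. f i (xy i)) * ((\<Prod>j<N. g Bullet j (u j)) * (\<Prod>j<N. g Circ j (v j)))"
      unfolding f_def g_def power_mult_distrib prod.distrib power_add
        prod_grid_rows[of "\<lambda>i. 1 + c * env (xy i) ^ 2"] prod_grid_cols[of "\<lambda>j. 1 + c * (1 + \<bar>u j\<bar>) ^ 2"]
        prod_grid_cols[of "\<lambda>j. 1 + c * (1 + \<bar>v j\<bar>) ^ 2"] s
      by (simp only: mult_ac)
    finally show ?thesis .
  qed
  have F: "integrable \<pi> (f i)" "0 \<le> integral\<^sup>L \<pi> (f i)"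
    "i \<in> Va S \<Longrightarrow> integral\<^sup>L \<pi> (f i) \<le> 1 + 3 * c * env_bound"
    "i \<notin> Va S \<Longrightarrow> integral\<^sup>L \<pi> (f i) \<le> 1" for i
  proof -
    note sq = square_excess[OF prob_space_axioms integrable_env_power(1) integrable_env_power(1) env_bound env_bound c0 c(2)]
    have 0: "f i = (\<lambda>p. 1)" if "i \<notin> Va S"
      using adeg_outside[OF l S that] by (simp add: f_def)
    have 1: "f i = (\<lambda>p. (1 + c * env p ^ 2)\<^sup>2)" if "i \<in> Va S"
      using adeg_cycles[OF l S that] by (simp add: f_def)
    show "integrable \<pi> (f i)" using sq(1) 0 1 by (cases "i \<in> Va S") auto
    show "0 \<le> integral\<^sup>L \<pi> (f i)" using pos by (intro Bochner_Integration.integral_nonneg)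
    show "i \<in> Va S \<Longrightarrow> integral\<^sup>L \<pi> (f i) \<le> 1 + 3 * c * env_bound" using sq(2) 1 by simp
    show "i \<notin> Va S \<Longrightarrow> integral\<^sup>L \<pi> (f i) \<le> 1" using 0 by (simp add: prob_space)
  qed
  have G: "integrable std_normal (g d j)" "0 \<le> integral\<^sup>L std_normal (g d j)"
    "j \<in> Vb S \<Longrightarrow> integral\<^sup>L std_normal (g d j) \<le> 1 + 3 * c * normal_bound"
    "j \<notin> Vb S \<Longrightarrow> integral\<^sup>L std_normal (g d j) \<le> 1" for d j
  proof -
    note sq = square_excess[OF prob_space_std_normal integrable_std_normal_abs_power integrable_std_normal_abs_power
        normal_bound normal_bound c0 c(2)]
    have one: "(\<integral>x. 1 \<partial>std_normal) = (1 :: real)" 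
      using prob_space.prob_space[OF prob_space_std_normal] by simp
    have i1: "integrable std_normal (\<lambda>x. 1 :: real)" using integrable_std_normal_power[of 0] by simp
    have 0: "g d j = (\<lambda>p. 1)" if "bdeg d S j = 0"
      using that by (simp add: g_def)
    have 1: "g d j = (\<lambda>x. (1 + c * (1 + \<bar>x\<bar>) ^ 2)\<^sup>2)" if "bdeg d S j = 2"
      using that by (simp add: g_def)
    have dd: "bdeg d S j = 0 \<or> (bdeg d S j = 2 \<and> j \<in> Vb S)"
      using bdeg_cycles[OF l S, of j] bdeg_outside[OF l S, of j d] by (cases "j \<in> Vb S"; cases d) auto
    show "integrable std_normal (g d j)" using sq(1) i1 0 1 dd by auto
    show "0 \<le> integral\<^sup>L std_normal (g d j)" using pos by (intro Bochner_Integration.integral_nonneg)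
    have "0 \<le> 3 * c * normal_bound" using c0 normal_bound_ge_1 by simp
    then show "j \<in> Vb S \<Longrightarrow> integral\<^sup>L std_normal (g d j) \<le> 1 + 3 * c * normal_bound"
      using sq(2) 0 1 dd one by auto
    show "j \<notin> Vb S \<Longrightarrow> integral\<^sup>L std_normal (g d j) \<le> 1" using 0 dd one by auto
  qed
  note v = cycles_vertices(1-4)[OF l S]
  have "(\<integral>XY. h_sub S XY * h_sub S XY \<partial>law_P \<pi> lam \<mu> n N) =
     (\<integral>xy. \<integral>uv. latent n N lam \<mu> (\<lambda>e. ind Bullet S e + ind Bullet S e) (\<lambda>e. ind Circ S e + ind Circ S e) xy uv \<partial>spikes N \<partial>sample n)"
    unfolding h_sub_mult[OF l S S] by (rule law_P_monomial(2)) (rule rows_pair[OF l S S])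
  also have "\<dots> \<le> (\<Prod>i<n. integral\<^sup>L \<pi> (f i)) *
     ((\<Prod>j<N. integral\<^sup>L std_normal (g Bullet j)) * (\<Prod>j<N. integral\<^sup>L std_normal (g Circ j)))"
    by (rule latent_le) (use F G pos le in auto)
  also have "\<dots> \<le> (1 + 3 * c * env_bound) ^ l * ((1 + 3 * c * normal_bound) ^ l * (1 + 3 * c * normal_bound) ^ l)"
    using v c0 env_bound_ge_1 normal_bound_ge_1 F G
    by (intro mult_mono prod_le_power_card[of _ "Va S"] prod_le_power_card[of _ "Vb S"] prod_nonneg mult_nonneg_nonneg ballI zero_le_power)
      auto
  finally show ?thesis .
qed

text \<open>Crude on purpose: constants to the power \<open>l\<close> are affordable, and only the
  power of \<open>n\<close> matters. Of the \<open>4 l\<close> edges counted with multiplicity,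
  \<open>2 e\<close> lie in shared pairs; the remaining \<open>4 l - 2 e\<close> contribute
  \<open>n^(-1/2)\<close> each.\<close>

lemma expectation_pair_le:
  assumes l: "2 \<le> l" and S: "S \<in> cycles l n N" and K: "K \<in> cycles l n N" and n: "0 < n"
    and L: "0 \<le> lam" "lam \<le> L" "0 \<le> \<mu>" "\<mu> \<le> L" "1 \<le> L"
    and e: "e = card (edges_of Bullet S \<inter> edges_of Bullet K) + card (edges_of Circ S \<inter> edges_of Circ K)"
  shows "(\<integral>XY. h_sub S XY * h_sub K XY \<partial>law_P \<pi> lam \<mu> n N) \<le>
    (2 * L\<^sup>2) ^ (4 * l) * (env_bound ^ (2 * l) * (normal_bound ^ (2 * l) * normal_bound ^ (2 * l))) *
      (real n ^ e / real n ^ (2 * l))"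
proof -
  note s = sum_ind[OF l S] sum_ind[OF l K]
  define p where "p = (\<lambda>d e. ind d S e + ind d K e)"
  define z where "z = 1 / sqrt (real n)"
  have z0: "0 < z" using n by (simp add: z_def)
  have sq1: "1 \<le> sqrt (real n)" using n by (simp add: real_le_rsqrt)
  \<comment> \<open>An entry used once has conditional mean of order \<open>z\<close>, an entry used
    twice has second moment of order 1, so only unshared edges yield a \<open>z\<close>. Powers of
    \<open>2 * L\<^sup>2\<close> absorb both \<open>L\<close> and
    \<open>1 + L\<^sup>2\<close>.\<close>
  define b where "b = (\<lambda>k. (2 * L\<^sup>2) ^ k * (if k = 1 then z else 1))"
  have L2: "1 \<le> L\<^sup>2" using L by (simp add: one_le_power)
  have b0: "0 < b k" for k
    unfolding b_def using z0 L by (intro mult_pos_pos zero_less_power) auto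
  have z1: "z \<le> 1" using sq1 by (simp add: z_def)
  have Lz1: "L * z \<le> L" using mult_left_mono[OF z1, of L] L by simp
  define f where "f = (\<lambda>i x. env x ^ (\<Sum>j<N. p Bullet (i, j) + p Circ (i, j)))"
  define g where "g = (\<lambda>d j x. (1 + \<bar>x\<bar>) ^ (\<Sum>i<n. p d (i, j)) :: real)"
  have sm: "\<bar>shifted_moment k (a * x * u)\<bar> \<le> b k * (env xy * (1 + \<bar>u\<bar>)) ^ k"
    if k2: "k \<le> 2" and ax: "0 \<le> a" "a \<le> L / sqrt (real n)" "\<bar>x\<bar> \<le> env xy" for k a x u xy
  proof -
    have a: "a \<le> L * z" using ax(2) by (simp add: z_def)
    have Lz: "0 \<le> L * z" using L z0 by simp
    have abs: "\<bar>a * x * u\<bar> \<le> L * z * (env xy * (1 + \<bar>u\<bar>))"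
      unfolding abs_mult mult.assoc[of _ _ "\<bar>u\<bar>"]
      using ax a Lz by (intro mult_mono) auto
    have ew: "1 \<le> env xy * (1 + \<bar>u\<bar>)"
      using mult_mono[of 1 "env xy" 1 "1 + \<bar>u\<bar>"] env_ge(1)[of xy] by simp
    have "k = 0 \<or> k = 1 \<or> k = 2" using k2 by linarith
    then consider "k = 0" | "k = 1" | "k = 2" by blast
    then show ?thesis
    proof cases
      case 1
      then show ?thesis by (simp add: shifted_moment_simps b_def)
    next
      case 2
      have le: "L * z \<le> 2 * L\<^sup>2 * z"
        using L z0 L2 by (intro mult_right_mono) (auto simp: power2_eq_square mult_le_cancel_left1)
      have "L * z * (env xy * (1 + \<bar>u\<bar>)) \<le> 2 * L\<^sup>2 * z * (env xy * (1 + \<bar>u\<bar>))"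
        by (rule mult_right_mono[OF le]) (use ew in auto)
      from order_trans[OF abs this] show ?thesis using 2 by (simp add: shifted_moment_simps b_def)
    next
      case 3
      have "(a * x * u)\<^sup>2 \<le> (L * z * (env xy * (1 + \<bar>u\<bar>)))\<^sup>2"
        using abs by (metis abs_ge_zero power2_abs power_mono)
      also have "\<dots> \<le> (L * (env xy * (1 + \<bar>u\<bar>)))\<^sup>2"
        using L z0 ew Lz1 by (intro power_mono mult_right_mono) auto
      finally have "1 + (a * x * u)\<^sup>2 \<le> (env xy * (1 + \<bar>u\<bar>))\<^sup>2 + L\<^sup>2 * (env xy * (1 + \<bar>u\<bar>))\<^sup>2"
        using one_le_power[OF ew, of 2] unfolding power_mult_distrib[of L] by linarith
      also have "\<dots> = (1 + L\<^sup>2) * (env xy * (1 + \<bar>u\<bar>))\<^sup>2" by (simp add: distrib_right)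
      also have "\<dots> \<le> (2 * L\<^sup>2)\<^sup>2 * (env xy * (1 + \<bar>u\<bar>))\<^sup>2"
      proof (rule mult_right_mono)
        have "1 + L\<^sup>2 \<le> 2 * L\<^sup>2" using L2 by simp
        also have "2 * L\<^sup>2 * 1 \<le> 2 * L\<^sup>2 * (2 * L\<^sup>2)" using L2 by (intro mult_left_mono) auto
        then have "2 * L\<^sup>2 \<le> (2 * L\<^sup>2)\<^sup>2" unfolding power2_eq_square[of "2 * L\<^sup>2"] by simp
        finally show "1 + L\<^sup>2 \<le> (2 * L\<^sup>2)\<^sup>2" .
      qed simp
      finally show ?thesis using 3 by (simp add: shifted_moment_simps b_def)
    qed
  qed
  have p2: "p d e \<le> 2" for d e by (simp add: p_def ind_def)
  note sc = scale_bound[OF L(1,2,5), of n] scale_bound[OF L(3,4,5), of n]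
  \<comment> \<open>The deterministic part of the bound. Dividing by it leaves a pure product over
    vertices, the shape that \<open>latent_le\<close> expects.\<close>
  define K0 where "K0 = (\<Prod>e\<in>grid n N. b (p Bullet e)) * (\<Prod>e\<in>grid n N. b (p Circ e))"
  have K0: "0 < K0" unfolding K0_def using b0 by (intro mult_pos_pos prod_pos) auto
  have le: "latent n N lam \<mu> (p Bullet) (p Circ) xy (u, v) / K0
     \<le> (\<Prod>i<n. f i (xy i)) * ((\<Prod>j<N. g Bullet j (u j)) * (\<Prod>j<N. g Circ j (v j)))" for xy u v
  proof -
    have "latent n N lam \<mu> (p Bullet) (p Circ) xy (u, v) \<le> \<bar>latent n N lam \<mu> (p Bullet) (p Circ) xy (u, v)\<bar>"
      by simp
    also have "\<dots> \<le> (\<Prod>e\<in>grid n N. b (p Bullet e) * (env (xy (fst e)) * (1 + \<bar>u (snd e)\<bar>)) ^ p Bullet e) *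
         (\<Prod>e\<in>grid n N. b (p Circ e) * (env (xy (fst e)) * (1 + \<bar>v (snd e)\<bar>)) ^ p Circ e)"
      unfolding latent_def prod.case abs_mult[of "prod _ _"] abs_prod
      by (intro mult_mono prod_mono conjI sm[OF p2] sc env_ge prod_nonneg ballI zero_le_power mult_nonneg_nonneg
           less_imp_le[OF b0] order_trans[OF zero_le_one env_ge(1)]) auto
    also have "\<dots> = K0 * ((\<Prod>i<n. f i (xy i)) * ((\<Prod>j<N. g Bullet j (u j)) * (\<Prod>j<N. g Circ j (v j))))"
      unfolding f_def g_def K0_def power_mult_distrib prod.distrib power_add sum.distrib
        prod_grid_rows[of "\<lambda>i. env (xy i)"] prod_grid_cols[of "\<lambda>j. 1 + \<bar>u j\<bar>"]
        prod_grid_cols[of "\<lambda>j. 1 + \<bar>v j\<bar>"]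
      by (simp only: mult_ac)
    finally show ?thesis using K0 by (simp add: divide_le_eq mult.commute)
  qed
  have pos: "0 \<le> f i x" "0 \<le> g d j y" for i x d j y
    by (auto simp: f_def g_def intro!: zero_le_power order_trans[OF zero_le_one env_ge(1)])
  note rows = rows_pair[OF l S K]
  have rows': "(\<Sum>j<N. p Bullet (i, j) + p Circ (i, j)) \<le> 4" for i using rows by (simp add: p_def)
  have F: "integrable \<pi> (f i)" "0 \<le> integral\<^sup>L \<pi> (f i)" "integral\<^sup>L \<pi> (f i) \<le> env_bound"
    "i \<notin> Va S \<union> Va K \<Longrightarrow> integral\<^sup>L \<pi> (f i) \<le> 1" for i
  proof -
    show "integrable \<pi> (f i)" "integral\<^sup>L \<pi> (f i) \<le> env_bound"
      unfolding f_def by (rule integrable_env_power[OF rows'] env_bound[OF rows'])+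
    show "0 \<le> integral\<^sup>L \<pi> (f i)"
      unfolding f_def by (intro Bochner_Integration.integral_nonneg zero_le_power order_trans[OF zero_le_one env_ge(1)])
    assume "i \<notin> Va S \<union> Va K"
    then have "f i = (\<lambda>x. 1)"
      using adeg_outside[OF l S, of i] adeg_outside[OF l K, of i]
      by (simp add: f_def p_def sum.distrib s)
    then show "integral\<^sup>L \<pi> (f i) \<le> 1" by (simp add: prob_space)
  qed
  have G: "integrable std_normal (g d j)" "0 \<le> integral\<^sup>L std_normal (g d j)" "integral\<^sup>L std_normal (g d j) \<le> normal_bound"
    "j \<notin> Vb S \<union> Vb K \<Longrightarrow> integral\<^sup>L std_normal (g d j) \<le> 1" for d j
  proof -
    have "(\<Sum>i<n. p d (i, j)) \<le> 4"
      using bdeg_le[OF l S, of d j] bdeg_le[OF l K, of d j] by (simp add: p_def sum.distrib s)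
    then show "integrable std_normal (g d j)" "integral\<^sup>L std_normal (g d j) \<le> normal_bound"
      unfolding g_def by (auto intro: integrable_std_normal_abs_power normal_bound)
    show "0 \<le> integral\<^sup>L std_normal (g d j)"
      unfolding g_def by (intro Bochner_Integration.integral_nonneg) auto
    assume "j \<notin> Vb S \<union> Vb K"
    then have "g d j = (\<lambda>x. 1)"
      using bdeg_outside[OF l S, of j d] bdeg_outside[OF l K, of j d]
      by (simp add: g_def p_def sum.distrib s)
    then show "integral\<^sup>L std_normal (g d j) \<le> 1"
      using prob_space.prob_space[OF prob_space_std_normal] by simp
  qed
  note v = cycles_vertices(1-4)[OF l S] cycles_vertices(1-4)[OF l K]
  have cV: "card (Va S \<union> Va K) \<le> 2 * l" "card (Vb S \<union> Vb K) \<le> 2 * l"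
    using card_Un_le[of "Va S" "Va K"] card_Un_le[of "Vb S" "Vb K"] v by auto
  have K0eq: "K0 = (2 * L\<^sup>2) ^ (4 * l) * (real n ^ e / real n ^ (2 * l))"
  proof -
    have b1: "(\<Prod>e\<in>grid n N. b (p d e)) = (2 * L\<^sup>2) ^ (\<Sum>e\<in>grid n N. p d e) * z ^ card {e\<in>grid n N. p d e = 1}" for d
      by (simp add: b_def prod.distrib power_sum prod.If_cases Int_def)
    have cnt: "(\<Sum>e\<in>grid n N. p d e) = card {e\<in>grid n N. p d e = 1} + 2 * card (edges_of d S \<inter> edges_of d K)" for d
    proof -
      have "edges_of d S \<inter> edges_of d K \<subseteq> grid n N"
        using cycles_vertices(5,6,7)[OF l S] by blast
      then have i: "{e\<in>grid n N. e \<in> edges_of d S \<and> e \<in> edges_of d K} = edges_of d S \<inter> edges_of d K" by blast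
      have "(\<Sum>e\<in>grid n N. p d e) = (\<Sum>e\<in>grid n N. (if p d e = 1 then 1 else 0) +
          2 * (if e \<in> edges_of d S \<and> e \<in> edges_of d K then 1 else 0))"
        by (intro sum.cong refl) (auto simp: p_def ind_def)
      also have "\<dots> = card {e\<in>grid n N. p d e = 1} + 2 * card {e\<in>grid n N. e \<in> edges_of d S \<and> e \<in> edges_of d K}"
        by (simp add: sum.distrib sum_distrib_left[symmetric] sum.If_cases Int_def)
      finally show ?thesis unfolding i .
    qed
    have tot: "(\<Sum>e\<in>grid n N. p Bullet e) + (\<Sum>e\<in>grid n N. p Circ e) = 4 * l"
      using card_edges_of_cycles[OF l S] card_edges_of_cycles[OF l K] by (simp add: p_def sum.distrib s)
    have ones: "card {e\<in>grid n N. p Bullet e = 1} + card {e\<in>grid n N. p Circ e = 1} + 2 * e = 4 * l"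
      using tot cnt[of Bullet] cnt[of Circ] e by simp
    then obtain m where m: "card {e\<in>grid n N. p Bullet e = 1} + card {e\<in>grid n N. p Circ e = 1} = 2 * m" "m + e = 2 * l"
      by (intro that[of "2 * l - e"]) auto
    have "K0 = (2 * L\<^sup>2) ^ (4 * l) * z ^ (2 * m)"
      unfolding K0_def b1 tot[symmetric] m(1)[symmetric] power_add by (simp only: mult_ac)
    also have "z ^ (2 * m) = 1 / real n ^ m"
      using n by (simp add: z_def power_mult power_divide)
    also have "\<dots> = real n ^ e / real n ^ (2 * l)"
      using n unfolding m(2)[symmetric] power_add by simp
    finally show ?thesis .
  qed
  have "(\<integral>XY. h_sub S XY * h_sub K XY \<partial>law_P \<pi> lam \<mu> n N) =
     (\<integral>xy. \<integral>uv. latent n N lam \<mu> (p Bullet) (p Circ) xy uv \<partial>spikes N \<partial>sample n)"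
    unfolding h_sub_mult[OF l S K] p_def by (rule law_P_monomial(2)) (rule rows)
  also have "\<dots> = K0 * (\<integral>xy. \<integral>uv. latent n N lam \<mu> (p Bullet) (p Circ) xy uv / K0 \<partial>spikes N \<partial>sample n)"
    using K0 by simp
  also have "\<dots> \<le> K0 * ((\<Prod>i<n. integral\<^sup>L \<pi> (f i)) *
     ((\<Prod>j<N. integral\<^sup>L std_normal (g Bullet j)) * (\<Prod>j<N. integral\<^sup>L std_normal (g Circ j))))"
  proof (rule mult_left_mono)
    show "(\<integral>xy. \<integral>uv. latent n N lam \<mu> (p Bullet) (p Circ) xy uv / K0 \<partial>spikes N \<partial>sample n) \<le> (\<Prod>i<n. integral\<^sup>L \<pi> (f i)) *
     ((\<Prod>j<N. integral\<^sup>L std_normal (g Bullet j)) * (\<Prod>j<N. integral\<^sup>L std_normal (g Circ j)))"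
      by (rule latent_le) (use F G pos le in auto)
  qed (use K0 in simp)
  also have "\<dots> \<le> K0 * (env_bound ^ (2 * l) * (normal_bound ^ (2 * l) * normal_bound ^ (2 * l)))"
  proof (rule mult_left_mono)
    have "(\<Prod>i<n. integral\<^sup>L \<pi> (f i)) \<le> env_bound ^ (2 * l)"
      using v cV env_bound_ge_1 F by (intro prod_le_power_card[of _ "Va S \<union> Va K"]) auto
    moreover have "(\<Prod>j<N. integral\<^sup>L std_normal (g d j)) \<le> normal_bound ^ (2 * l)" for d
      using v cV normal_bound_ge_1 G by (intro prod_le_power_card[of _ "Vb S \<union> Vb K"]) auto
    moreover have "0 \<le> (\<Prod>j<N. integral\<^sup>L std_normal (g d j))" for d
      using G by (intro prod_nonneg) auto
    ultimately show "(\<Prod>i<n. integral\<^sup>L \<pi> (f i)) *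
     ((\<Prod>j<N. integral\<^sup>L std_normal (g Bullet j)) * (\<Prod>j<N. integral\<^sup>L std_normal (g Circ j))) \<le>
      env_bound ^ (2 * l) * (normal_bound ^ (2 * l) * normal_bound ^ (2 * l))"
      using env_bound_ge_1 normal_bound_ge_1 by (intro mult_mono) auto
  qed (use K0 in simp)
  finally show ?thesis unfolding K0eq by (simp only: mult_ac)
qed

end

section \<open>Mean and variance of the unnormalised statistic\<close>

definition cycle_sum :: "real \<Rightarrow> real \<Rightarrow> real \<Rightarrow> nat \<Rightarrow> nat \<Rightarrow> nat \<Rightarrow> rmatrix \<times> rmatrix \<Rightarrow> real" where
  "cycle_sum lam \<mu> \<rho> l n N XY = (\<Sum>S \<in> cycles l n N. Upsilon lam \<mu> \<rho> S * h_sub S XY)"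

text \<open>The \<open>A\<close> of the overview; \<open>cycle_sum\<close> is its
  \<open>H\<close>.\<close>

definition energy :: "real \<Rightarrow> real \<Rightarrow> real \<Rightarrow> nat \<Rightarrow> nat \<Rightarrow> nat \<Rightarrow> real" where
  "energy lam \<mu> \<rho> l n N = (\<Sum>S \<in> cycles l n N. (Upsilon lam \<mu> \<rho> S)\<^sup>2)"

lemma h_stat_eq_cycle_sum:
  assumes "2 \<le> l" "lam > 0" "\<mu> > 0" "\<rho> > 0" "0 < n" "0 < N"
  shows "\<exists>\<kappa>>0. \<forall>XY. h_stat lam \<mu> \<rho> l n N XY = \<kappa> * cycle_sum lam \<mu> \<rho> l n N XY"
proof (intro exI conjI allI)
  show "0 < 1 / sqrt (real n ^ l * real N ^ l * beta lam \<mu> \<rho> l)"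
    using beta_pos[OF assms(1-4)] assms by simp
  show "h_stat lam \<mu> \<rho> l n N XY =
      1 / sqrt (real n ^ l * real N ^ l * beta lam \<mu> \<rho> l) * cycle_sum lam \<mu> \<rho> l n N XY" for XY
    unfolding h_stat_def cycle_sum_def
    using assms by (simp add: sum_over_classes[where h = "\<lambda>S. h_sub S XY"])
qed

lemma measurable_h_sub:
  assumes "S \<in> subgraphs_K n N"
  shows "h_sub S \<in> borel_measurable (matrix_space n N \<Otimes>\<^sub>M matrix_space n N)"
proof -
  have "edges_of d S \<subseteq> grid n N" for d
    using assms by (auto simp: subgraphs_K_def dgraph_wf_def edges_of_def dom_def)
  then have [measurable]: "(\<lambda>XY. fst XY e) \<in> borel_measurable (matrix_space n N \<Otimes>\<^sub>M matrix_space n N)"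
    "(\<lambda>XY. snd XY e) \<in> borel_measurable (matrix_space n N \<Otimes>\<^sub>M matrix_space n N)" if "e \<in> edges_of d S" for d e
    using that unfolding matrix_space_def
    by (auto intro!: measurable_compose[OF measurable_fst] measurable_compose[OF measurable_snd]
        measurable_component_singleton)
  show ?thesis
    unfolding h_sub_def split_def
    by (intro borel_measurable_times borel_measurable_prod) auto
qed

lemma measurable_h_stat:
  "h_stat lam \<mu> \<rho> l n N \<in> borel_measurable (matrix_space n N \<Otimes>\<^sub>M matrix_space n N)"
  unfolding h_stat_def
  by (intro borel_measurable_times borel_measurable_sum borel_measurable_const measurable_h_sub) auto

lemma measurable_cycle_sum:
  "cycle_sum lam \<mu> \<rho> l n N \<in> borel_measurable (matrix_space n N \<Otimes>\<^sub>M matrix_space n N)"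
  unfolding cycle_sum_def
  by (intro borel_measurable_times borel_measurable_sum borel_measurable_const measurable_h_sub)
    (auto simp: cycles_def)

lemma cycle_sum_square:
  "(cycle_sum lam \<mu> \<rho> l n N XY)\<^sup>2 = (\<Sum>S \<in> cycles l n N. \<Sum>K \<in> cycles l n N.
     Upsilon lam \<mu> \<rho> S * Upsilon lam \<mu> \<rho> K * (h_sub S XY * h_sub K XY))"
  unfolding cycle_sum_def power2_eq_square sum_product
  by (intro sum.cong refl) (simp only: mult_ac)

lemma law_Q_cycle_sum:
  assumes l: "2 \<le> l"
  shows "integrable (law_Q n N) (\<lambda>XY. (cycle_sum lam \<mu> \<rho> l n N XY)\<^sup>2)"
    and "(\<integral>XY. (cycle_sum lam \<mu> \<rho> l n N XY)\<^sup>2 \<partial>law_Q n N) = energy lam \<mu> \<rho> l n N"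
proof -
  note q = law_Q_cycles[OF l]
  show "integrable (law_Q n N) (\<lambda>XY. (cycle_sum lam \<mu> \<rho> l n N XY)\<^sup>2)"
    unfolding cycle_sum_square
    by (intro Bochner_Integration.integrable_sum integrable_mult_right q(1))
  have "(\<integral>XY. (cycle_sum lam \<mu> \<rho> l n N XY)\<^sup>2 \<partial>law_Q n N) = (\<Sum>S \<in> cycles l n N. \<Sum>K \<in> cycles l n N.
     Upsilon lam \<mu> \<rho> S * Upsilon lam \<mu> \<rho> K * (if S = K then 1 else 0))"
    unfolding cycle_sum_square by (simp add: Bochner_Integration.integral_sum q)
  also have "\<dots> = energy lam \<mu> \<rho> l n N"
    unfolding energy_def using l
    by (intro sum.cong refl) (simp add: if_distrib sum.delta' power2_eq_square cong: if_cong)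
  finally show "(\<integral>XY. (cycle_sum lam \<mu> \<rho> l n N XY)\<^sup>2 \<partial>law_Q n N) = energy lam \<mu> \<rho> l n N" .
qed

lemma Upsilon_cycles:
  assumes l: "2 \<le> l" and S: "S \<in> cycles l n N"
    and L: "0 \<le> lam" "lam \<le> L" "0 \<le> \<mu>" "\<mu> \<le> L" "1 \<le> L" and r: "0 \<le> \<rho>" "\<rho> \<le> 1"
  shows "0 \<le> Upsilon lam \<mu> \<rho> S" "Upsilon lam \<mu> \<rho> S \<le> L ^ l"
proof -
  obtain a b w where s: "inj_on a {..<l}" "inj_on b {..<l}" "S = cycle_graph l a b w"
    using cyclesE[OF l S] by metis
  have u: "Upsilon lam \<mu> \<rho> S = word_weight lam \<mu> \<rho> l w"
    unfolding s(3) by (rule Upsilon_cycle_graph[OF l s(1,2) L(1,3)])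
  show "0 \<le> Upsilon lam \<mu> \<rho> S"
    unfolding u word_weight_def using L r by (intro prod_nonneg ballI mult_nonneg_nonneg) (auto split: decoration.split)
  have "word_weight lam \<mu> \<rho> l w \<le> (\<Prod>i<l. L * 1)"
    unfolding word_weight_def using L r
    by (intro prod_mono conjI mult_mono mult_nonneg_nonneg) (auto split: decoration.split)
  then show "Upsilon lam \<mu> \<rho> S \<le> L ^ l" by (simp add: u)
qed

context pair_law
begin

definition pair_const :: "real \<Rightarrow> real" where
  "pair_const L = (2 * L\<^sup>2) ^ 4 * (env_bound ^ 2 * (normal_bound ^ 2 * normal_bound ^ 2))"

definition diag_bound :: "real \<Rightarrow> nat \<Rightarrow> real" where
  "diag_bound c l = (1 + 3 * c * env_bound) ^ l * ((1 + 3 * c * normal_bound) ^ l * (1 + 3 * c * normal_bound) ^ l)"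

text \<open>The coefficient \<open>Upsilon\<close> of a cycle is proportional to its planted mean,
  so the mean of the sum is a sum of squares. This is the reason for the weights in the
  statistic.\<close>

lemma expectation_cycle_sum:
  assumes l: "2 \<le> l" and n: "0 < n"
  shows "integrable (law_P \<pi> lam \<mu> n N) (cycle_sum lam \<mu> \<rho> l n N)"
    and "integrable (law_P \<pi> lam \<mu> n N) (\<lambda>XY. (cycle_sum lam \<mu> \<rho> l n N XY)\<^sup>2)"
    and "(\<integral>XY. cycle_sum lam \<mu> \<rho> l n N XY \<partial>law_P \<pi> lam \<mu> n N) = energy lam \<mu> \<rho> l n N / real n ^ l"
proof -
  note e = expectation_h_sub[OF l _ n]
  show "integrable (law_P \<pi> lam \<mu> n N) (cycle_sum lam \<mu> \<rho> l n N)"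
    unfolding cycle_sum_def[abs_def]
    by (intro Bochner_Integration.integrable_sum integrable_mult_right e(1))
  show "integrable (law_P \<pi> lam \<mu> n N) (\<lambda>XY. (cycle_sum lam \<mu> \<rho> l n N XY)\<^sup>2)"
    unfolding cycle_sum_square
    by (intro Bochner_Integration.integrable_sum integrable_mult_right integrable_h_sub_mult[OF l])
  show "(\<integral>XY. cycle_sum lam \<mu> \<rho> l n N XY \<partial>law_P \<pi> lam \<mu> n N) = energy lam \<mu> \<rho> l n N / real n ^ l"
    unfolding cycle_sum_def energy_def
    by (simp add: Bochner_Integration.integral_sum e power2_eq_square sum_divide_distrib)
qed

text \<open>Distinct cycles that meet share fewer edges than vertices; the missing edge is the factor
  \<open>1 / n\<close> in the second summand.\<close>

lemma covariance_le:
  assumes l: "2 \<le> l" and S: "S \<in> cycles l n N" and K: "K \<in> cycles l n N" and n: "0 < n"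
    and L: "0 \<le> lam" "lam \<le> L" "0 \<le> \<mu>" "\<mu> \<le> L" "1 \<le> L" and r: "0 \<le> \<rho>"
    and c: "c = L / sqrt (real n)" "c \<le> 1"
  shows "(\<integral>XY. h_sub S XY * h_sub K XY \<partial>law_P \<pi> lam \<mu> n N) -
      Upsilon lam \<mu> \<rho> S / real n ^ l * (Upsilon lam \<mu> \<rho> K / real n ^ l) \<le>
    (if S = K then diag_bound c l else 0) +
    pair_const L ^ l * (real n ^ (card (Va S \<inter> Va K) + card (Vb S \<inter> Vb K)) / real n ^ (2 * l + 1))"
    (is "?E - ?M \<le> ?D + ?R")
proof -
  have U: "0 \<le> Upsilon lam \<mu> \<rho> H" for H :: "(nat, nat) dgraph"
    unfolding Upsilon_def using L r by simp
  have M: "0 \<le> ?M" using U by simp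
  have pc: "0 \<le> pair_const L"
    using env_bound_ge_1 by (simp add: pair_const_def)
  \<comment> \<open>Being nonnegative, the second summand can be kept for every pair, so the later
    sum over \<open>K\<close> is that of \<open>sum_overlap_le\<close> without exclusions.\<close>
  then have R: "0 \<le> ?R" by simp
  consider "S = K" | "S \<noteq> K" "Va S \<inter> Va K = {}" "Vb S \<inter> Vb K = {}"
    | "S \<noteq> K" "Va S \<inter> Va K \<noteq> {} \<or> Vb S \<inter> Vb K \<noteq> {}" by blast
  then show ?thesis
  proof cases
    case 1
    have "?E \<le> diag_bound c l"
      using expectation_h_sub_square_le[OF l S L c] 1 by (simp add: diag_bound_def)
    then show ?thesis unfolding if_P[OF 1] using M R by linarith
  next
    case 2
    then show ?thesis using expectation_disjoint[OF l S K n 2(2,3)] R by simp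
  next
    case 3
    define e where "e = card (edges_of Bullet S \<inter> edges_of Bullet K) + card (edges_of Circ S \<inter> edges_of Circ K)"
    define v where "v = card (Va S \<inter> Va K) + card (Vb S \<inter> Vb K)"
    have ev: "e + 1 \<le> v" using shared_edges_less[OF l S K 3] by (simp add: e_def v_def)
    have "?E \<le> pair_const L ^ l * (real n ^ e / real n ^ (2 * l))"
      using expectation_pair_le[OF l S K n L e_def]
      by (simp only: pair_const_def power_mult_distrib power_mult)
    also have "real n ^ e / real n ^ (2 * l) = real n ^ (e + 1) / real n ^ (2 * l + 1)"
      using n by simp
    also have "pair_const L ^ l * (real n ^ (e + 1) / real n ^ (2 * l + 1)) \<le>
        pair_const L ^ l * (real n ^ v / real n ^ (2 * l + 1))"
      using n pc ev by (intro mult_left_mono divide_right_mono power_increasing) auto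
    finally show ?thesis using M 3 by (simp add: v_def)
  qed
qed

text \<open>The diagonal reproduces \<open>energy\<close>. In the remainder the weights are bounded
  by \<open>L ^ l\<close>, the sum over \<open>K\<close> by \<open>sum_overlap_le\<close> and the
  sum over \<open>S\<close> by \<open>card_cycles_le\<close>. The constant 4 counts the letters
  available to \<open>S\<close> and to \<open>K\<close> at each position, and
  \<open>L\<^sup>2\<close> comes from the two weights.\<close>

lemma variance_cycle_sum_le:
  assumes l: "2 \<le> l" and n: "0 < n"
    and L: "0 \<le> lam" "lam \<le> L" "0 \<le> \<mu>" "\<mu> \<le> L" "1 \<le> L" and r: "0 \<le> \<rho>" "\<rho> \<le> 1"
    and c: "c = L / sqrt (real n)" "c \<le> 1"
  shows "(\<integral>XY. (cycle_sum lam \<mu> \<rho> l n N XY)\<^sup>2 \<partial>law_P \<pi> lam \<mu> n N) -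
      (\<integral>XY. cycle_sum lam \<mu> \<rho> l n N XY \<partial>law_P \<pi> lam \<mu> n N)\<^sup>2 \<le>
    diag_bound c l * energy lam \<mu> \<rho> l n N +
    (4 * L\<^sup>2 * pair_const L) ^ l * (real n ^ l * real N ^ l *
      ((real n + real l * real n) ^ l * (real N + real l * real n) ^ l)) / real n ^ (2 * l + 1)"
proof -
  let ?C = "cycles l n N" and ?U = "Upsilon lam \<mu> \<rho>"
  define v where "v = (\<lambda>(S :: (nat, nat) dgraph) (K :: (nat, nat) dgraph). card (Va S \<inter> Va K) + card (Vb S \<inter> Vb K))"
  define E where "E = (\<lambda>S K. \<integral>XY. h_sub S XY * h_sub K XY \<partial>law_P \<pi> lam \<mu> n N)"
  define R where "R = pair_const L ^ l / real n ^ (2 * l + 1)"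
  have pc: "0 \<le> pair_const L"
    using env_bound_ge_1 by (simp add: pair_const_def)
  then have R0: "0 \<le> R" by (simp add: R_def)
  have U: "0 \<le> ?U S" "?U S \<le> L ^ l" if "S \<in> ?C" for S
    using Upsilon_cycles[OF l that L r] by auto
  have "(\<integral>XY. (cycle_sum lam \<mu> \<rho> l n N XY)\<^sup>2 \<partial>law_P \<pi> lam \<mu> n N) = (\<Sum>S\<in>?C. \<Sum>K\<in>?C. ?U S * ?U K * E S K)"
    unfolding cycle_sum_square E_def using integrable_h_sub_mult[OF l]
    by (simp add: Bochner_Integration.integral_sum)
  moreover have "(\<integral>XY. cycle_sum lam \<mu> \<rho> l n N XY \<partial>law_P \<pi> lam \<mu> n N)\<^sup>2 =
     (\<Sum>S\<in>?C. \<Sum>K\<in>?C. ?U S * ?U K * (?U S / real n ^ l * (?U K / real n ^ l)))"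
    unfolding expectation_cycle_sum(3)[OF l n] energy_def sum_divide_distrib power2_eq_square[of "sum _ _"] sum_product
    by (intro sum.cong refl) (simp add: power2_eq_square)
  ultimately have "(\<integral>XY. (cycle_sum lam \<mu> \<rho> l n N XY)\<^sup>2 \<partial>law_P \<pi> lam \<mu> n N) -
      (\<integral>XY. cycle_sum lam \<mu> \<rho> l n N XY \<partial>law_P \<pi> lam \<mu> n N)\<^sup>2 =
     (\<Sum>S\<in>?C. \<Sum>K\<in>?C. ?U S * ?U K * (E S K - ?U S / real n ^ l * (?U K / real n ^ l)))"
    by (simp only: sum_subtractf right_diff_distrib)
  also have "\<dots> \<le> (\<Sum>S\<in>?C. \<Sum>K\<in>?C. (if S = K then diag_bound c l * (?U S)\<^sup>2 else 0) +
      (L ^ l * L ^ l * R) * real n ^ v S K)"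
  proof (intro sum_mono)
    fix S K assume S: "S \<in> ?C" and K: "K \<in> ?C"
    have "?U S * ?U K * (E S K - ?U S / real n ^ l * (?U K / real n ^ l)) \<le>
      ?U S * ?U K * ((if S = K then diag_bound c l else 0) + R * real n ^ v S K)"
      using covariance_le[OF l S K n L r(1) c] U[OF S] U[OF K]
      by (intro mult_left_mono) (auto simp: E_def R_def v_def)
    also have "\<dots> = (if S = K then diag_bound c l * (?U S)\<^sup>2 else 0) + ?U S * ?U K * (R * real n ^ v S K)"
      by (simp add: distrib_left power2_eq_square)
    also have "?U S * ?U K * (R * real n ^ v S K) \<le> L ^ l * L ^ l * (R * real n ^ v S K)"
      using U[OF S] U[OF K] R0 L by (intro mult_right_mono mult_mono) auto
    finally show "?U S * ?U K * (E S K - ?U S / real n ^ l * (?U K / real n ^ l)) \<le>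
      (if S = K then diag_bound c l * (?U S)\<^sup>2 else 0) + (L ^ l * L ^ l * R) * real n ^ v S K"
      by (simp add: mult.assoc)
  qed
  also have "\<dots> = diag_bound c l * energy lam \<mu> \<rho> l n N + (L ^ l * L ^ l * R) * (\<Sum>S\<in>?C. \<Sum>K\<in>?C. real n ^ v S K)"
    using l by (simp add: sum.distrib energy_def sum_distrib_left)
  also have "(L ^ l * L ^ l * R) * (\<Sum>S\<in>?C. \<Sum>K\<in>?C. real n ^ v S K) \<le>
      (L ^ l * L ^ l * R) * ((2 ^ l * real n ^ l * real N ^ l) *
        (2 ^ l * (real n + real l * real n) ^ l * (real N + real l * real n) ^ l))"
  proof (rule mult_left_mono)
    have "(\<Sum>S\<in>?C. \<Sum>K\<in>?C. real n ^ v S K) \<le>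
       (\<Sum>S\<in>?C. 2 ^ l * (real n + real l * real n) ^ l * (real N + real l * real n) ^ l)"
    proof (rule sum_mono)
      fix S assume S: "S \<in> ?C"
      show "(\<Sum>K\<in>?C. real n ^ v S K) \<le> 2 ^ l * (real n + real l * real n) ^ l * (real N + real l * real n) ^ l"
        using sum_overlap_le[OF l n cycles_vertices(1,2)[OF l S], of N] cycles_vertices(3,4)[OF l S]
        by (simp add: v_def)
    qed
    also have "\<dots> = real (card ?C) * (2 ^ l * (real n + real l * real n) ^ l * (real N + real l * real n) ^ l)"
      by simp
    also have "\<dots> \<le> (2 ^ l * real n ^ l * real N ^ l) *
        (2 ^ l * (real n + real l * real n) ^ l * (real N + real l * real n) ^ l)"
      by (intro mult_right_mono card_cycles_le l n) auto
    finally show "(\<Sum>S\<in>?C. \<Sum>K\<in>?C. real n ^ v S K) \<le> (2 ^ l * real n ^ l * real N ^ l) *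
        (2 ^ l * (real n + real l * real n) ^ l * (real N + real l * real n) ^ l)" .
  qed (use R0 L in auto)
  also have "(L ^ l * L ^ l * R) * ((2 ^ l * real n ^ l * real N ^ l) *
        (2 ^ l * (real n + real l * real n) ^ l * (real N + real l * real n) ^ l)) =
     (4 * L\<^sup>2 * pair_const L) ^ l * (real n ^ l * real N ^ l *
      ((real n + real l * real n) ^ l * (real N + real l * real n) ^ l)) / real n ^ (2 * l + 1)"
  proof -
    have "4 * L\<^sup>2 * pair_const L = 2 * 2 * (L * L) * pair_const L" by (simp add: power2_eq_square)
    then have "(4 * L\<^sup>2 * pair_const L) ^ l = 2 ^ l * 2 ^ l * (L ^ l * L ^ l) * pair_const L ^ l"
      by (simp only: power_mult_distrib)
    then show ?thesis unfolding R_def by (simp only: times_divide_eq_left times_divide_eq_right mult_ac)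
  qed
  finally show ?thesis by simp
qed

lemma cycle_sum_type_II_error:
  assumes l: "2 \<le> l" and n: "0 < n" and E: "0 < energy lam \<mu> \<rho> l n N" and t: "t < 1"
    and V: "(\<integral>XY. (cycle_sum lam \<mu> \<rho> l n N XY)\<^sup>2 \<partial>law_P \<pi> lam \<mu> n N) -
      (\<integral>XY. cycle_sum lam \<mu> \<rho> l n N XY \<partial>law_P \<pi> lam \<mu> n N)\<^sup>2 \<le> V"
  shows "\<P>(XY in law_P \<pi> lam \<mu> n N. cycle_sum lam \<mu> \<rho> l n N XY \<le> t * (energy lam \<mu> \<rho> l n N / real n ^ l))
    \<le> V / ((1 - t) * (energy lam \<mu> \<rho> l n N / real n ^ l))\<^sup>2"
proof -
  interpret P: prob_space "law_P \<pi> lam \<mu> n N" by (rule prob_space_law_P)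
  let ?H = "cycle_sum lam \<mu> \<rho> l n N"
  let ?m = "energy lam \<mu> \<rho> l n N / real n ^ l"
  note e = expectation_cycle_sum[OF l n, of lam \<mu> N]
  have meas [measurable]: "?H \<in> borel_measurable (law_P \<pi> lam \<mu> n N)"
    using e(1) by simp
  have dev: "(1 - t) * m \<le> \<bar>h - m\<bar>" if "h \<le> t * m" for h m :: real
    unfolding left_diff_distrib using that by linarith
  have m: "0 < (1 - t) * ?m" using E n t by simp
  have "\<P>(XY in law_P \<pi> lam \<mu> n N. ?H XY \<le> t * ?m) \<le> \<P>(XY in law_P \<pi> lam \<mu> n N. (1 - t) * ?m \<le> \<bar>?H XY - P.expectation ?H\<bar>)"
    unfolding e(3) by (rule P.finite_measure_mono) (use dev in blast, measurable)
  also have "\<dots> \<le> P.variance ?H / ((1 - t) * ?m)\<^sup>2"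
    by (rule P.Chebyshev_inequality[OF meas e(2) m])
  also have "\<dots> \<le> V / ((1 - t) * ?m)\<^sup>2"
    using V by (intro divide_right_mono) (auto simp: P.variance_eq[OF e(1,2)])
  finally show ?thesis .
qed

end

lemma cycle_sum_type_I_error:
  assumes l: "2 \<le> l" and t: "0 < t"
  shows "\<P>(XY in law_Q n N. t \<le> cycle_sum lam \<mu> \<rho> l n N XY) \<le> energy lam \<mu> \<rho> l n N / t\<^sup>2"
proof -
  interpret Q: prob_space "law_Q n N" by (rule prob_space_law_Q)
  let ?H = "cycle_sum lam \<mu> \<rho> l n N"
  have meas [measurable]: "?H \<in> borel_measurable (law_Q n N)"
    using measurable_cycle_sum by (simp add: measurable_cong_sets[OF sets_law_Q refl])
  have "\<P>(XY in law_Q n N. t \<le> ?H XY) \<le> \<P>(XY in law_Q n N. t \<le> \<bar>?H XY\<bar>)"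
    by (intro Q.finite_measure_mono) auto
  also have "\<dots> \<le> Q.expectation (\<lambda>XY. (?H XY)\<^sup>2) / t\<^sup>2"
    by (rule Q.second_moment_method[OF meas law_Q_cycle_sum(1)[OF l] t])
  finally show ?thesis by (simp add: law_Q_cycle_sum(2)[OF l])
qed

text \<open>By Bernoulli's inequality \<open>2 * l\<^sup>2 \<le> n\<close> gives
  \<open>(1 - l / n) ^ l \<ge> 1 / 2\<close>, so injectivity costs a factor 2 on each side of the
  graph; \<open>l ^ 2\<close> is the multiplicity from \<open>sum_cycles_ge\<close>.\<close>

lemma energy_lower:
  assumes l: "2 \<le> l" and lam: "0 \<le> lam" "0 \<le> \<mu>" and n: "2 * l\<^sup>2 \<le> n" "2 * l\<^sup>2 \<le> N"
    and W: "W \<le> (\<Sum>w\<in>words l. (word_weight lam \<mu> \<rho> l w)\<^sup>2)" "0 \<le> W"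
  shows "W * (real n ^ l * real N ^ l) / (4 * real l ^ 2) \<le> energy lam \<mu> \<rho> l n N"
proof -
  have inj: "real m ^ l / 2 \<le> real (card (inj_maps l m))" if m: "2 * l\<^sup>2 \<le> m" for m
  proof -
    have "l \<le> l\<^sup>2" using l by (simp add: power2_eq_square)
    then have lm: "l \<le> m" "0 < m" using m l by linarith+
    have "2 * real l ^ 2 \<le> real m" using m by (metis of_nat_le_iff of_nat_mult of_nat_numeral of_nat_power)
    then have "1 / 2 \<le> 1 + real l * (- (real l / real m))"
      using lm by (simp add: field_simps power2_eq_square)
    also have "\<dots> \<le> (1 + - (real l / real m)) ^ l"
      using lm by (intro Bernoulli_inequality) simp
    finally have "real m ^ l * (1 / 2) \<le> real m ^ l * (1 + - (real l / real m)) ^ l"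
      by (intro mult_left_mono) auto
    also have "\<dots> = (real m - real l) ^ l"
      using lm by (simp add: power_mult_distrib[symmetric] algebra_simps)
    also have "\<dots> \<le> real (card (inj_maps l m))" by (rule inj_maps_lower[OF lm(1)])
    finally show ?thesis by simp
  qed
  have "(real n ^ l / 2) * ((real N ^ l / 2) * W) \<le>
     real (card (inj_maps l n)) * (real (card (inj_maps l N)) * (\<Sum>w\<in>words l. (word_weight lam \<mu> \<rho> l w)\<^sup>2))"
    using inj[OF n(1)] inj[OF n(2)] W by (intro mult_mono) auto
  also have "\<dots> = (\<Sum>a \<in> inj_maps l n. \<Sum>b \<in> inj_maps l N. \<Sum>w \<in> words l. (word_weight lam \<mu> \<rho> l w)\<^sup>2)"
    by simp
  also have "\<dots> = (\<Sum>a \<in> inj_maps l n. \<Sum>b \<in> inj_maps l N. \<Sum>w \<in> words l. (Upsilon lam \<mu> \<rho> (cycle_graph l a b w))\<^sup>2)"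
    using l lam by (intro sum.cong refl) (auto simp: inj_maps_def Upsilon_cycle_graph)
  also have "\<dots> \<le> real l ^ 2 * energy lam \<mu> \<rho> l n N"
    unfolding energy_def by (rule sum_cycles_ge[OF l]) simp
  finally show ?thesis using l by (simp add: field_simps)
qed

section \<open>Quantitative error bounds\<close>

context pair_law
begin

text \<open>By \<open>1 + x \<le> exp x\<close> the product is at most a single exponential, whose
  exponent the hypothesis bounds by 1.\<close>

lemma diag_bound_le:
  assumes "0 \<le> c" "real l * (3 * c * (env_bound + 2 * normal_bound)) \<le> 1"
  shows "diag_bound c l \<le> 3"
proof -
  have e: "(1 + x) ^ l \<le> exp (real l * x)" if "0 \<le> x" for x :: real
    using that power_mono[OF exp_ge_add_one_self[of x], of l] by (simp add: exp_of_nat_mult)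
  have nn: "0 \<le> 3 * c * env_bound" "0 \<le> 3 * c * normal_bound"
    using assms(1) env_bound_ge_1 normal_bound_ge_1 by auto
  have "diag_bound c l \<le> exp (real l * (3 * c * env_bound)) *
      (exp (real l * (3 * c * normal_bound)) * exp (real l * (3 * c * normal_bound)))"
    unfolding diag_bound_def using nn by (intro mult_mono e) auto
  also have "\<dots> = exp (real l * (3 * c * (env_bound + 2 * normal_bound)))"
    by (simp add: exp_add[symmetric] algebra_simps)
  also have "\<dots> \<le> exp 1" using assms(2) by simp
  also have "\<dots> \<le> 3" by (rule exp_le)
  finally show ?thesis .
qed

text \<open>What remains per unit of \<open>l\<close> in the overlap remainder once the powers of
  \<open>n\<close> and of \<open>1 + l\<close> are pulled out. The factor
  \<open>1 / \<gamma>\<close> is \<open>N / n\<close>, and \<open>1 / \<gamma> + 1\<close> comes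
  from \<open>N + l n \<le> n (1 / \<gamma> + 1) (1 + l)\<close>.\<close>

definition growth_const :: "real \<Rightarrow> real \<Rightarrow> real" where
  "growth_const L \<gamma> = 4 * L\<^sup>2 * pair_const L * (1 / \<gamma>) * (1 / \<gamma> + 1)"

text \<open>The target \<open>n^(2l)\<close> is small enough: the squared mean is
  \<open>A^2 / n^(2l)\<close>, so the relative contribution is the square of
  \<open>n^(2l) / A\<close>, which tends to 0. The spare factor \<open>1 / n\<close> is used up
  against the power of \<open>growth_const L \<gamma> * (1 + l)\<^sup>2\<close>.\<close>

lemma overlap_remainder_le:
  assumes n: "0 < n" and g: "0 < \<gamma>" and N: "real n = \<gamma> * real N" and L: "1 \<le> L"
    and G: "(growth_const L \<gamma> * (1 + real l)\<^sup>2) ^ l \<le> sqrt (real n)"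
  shows "(4 * L\<^sup>2 * pair_const L) ^ l * (real n ^ l * real N ^ l *
      ((real n + real l * real n) ^ l * (real N + real l * real n) ^ l)) / real n ^ (2 * l + 1) \<le> real n ^ (2 * l)"
proof -
  have pc: "0 \<le> pair_const L"
    using env_bound_ge_1 by (simp add: pair_const_def)
  have nl: "real n + real l * real n = real n * (1 + real l)" by (simp add: algebra_simps)
  have Ng: "real N = real n * (1 / \<gamma>)" using N g by simp
  have "real N + real l * real n \<le> real n * ((1 / \<gamma> + 1) * (1 + real l))"
    unfolding Ng using g n by (simp add: algebra_simps)
  then have "(4 * L\<^sup>2 * pair_const L) ^ l * (real n ^ l * real N ^ l *
      ((real n + real l * real n) ^ l * (real N + real l * real n) ^ l)) \<le>
    (4 * L\<^sup>2 * pair_const L) ^ l * (real n ^ l * real N ^ l *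
      ((real n + real l * real n) ^ l * (real n * ((1 / \<gamma> + 1) * (1 + real l))) ^ l))"
    using pc by (intro mult_left_mono power_mono) auto
  also have "\<dots> = (4 * L\<^sup>2 * pair_const L * (real n * (real n * (1 / \<gamma>) *
      ((real n * (1 + real l)) * (real n * ((1 / \<gamma> + 1) * (1 + real l)))))) ) ^ l"
    unfolding Ng nl by (simp only: power_mult_distrib mult_ac)
  also have "4 * L\<^sup>2 * pair_const L * (real n * (real n * (1 / \<gamma>) *
      ((real n * (1 + real l)) * (real n * ((1 / \<gamma> + 1) * (1 + real l)))))) =
      real n ^ 4 * (growth_const L \<gamma> * (1 + real l)\<^sup>2)"
    unfolding growth_const_def power2_eq_square power4_eq_xxxx by (simp only: mult_ac)
  also have "(real n ^ 4 * (growth_const L \<gamma> * (1 + real l)\<^sup>2)) ^ l =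
      real n ^ (4 * l) * (growth_const L \<gamma> * (1 + real l)\<^sup>2) ^ l"
    by (simp only: power_mult_distrib[of "real n ^ 4"] power_mult)
  also have "\<dots> \<le> real n ^ (4 * l) * real n"
  proof (rule mult_left_mono)
    have "sqrt (real n) \<le> real n" using n by (intro real_le_lsqrt) (auto simp: power2_eq_square)
    then show "(growth_const L \<gamma> * (1 + real l)\<^sup>2) ^ l \<le> real n" using G by linarith
  qed simp
  also have "\<dots> = real n ^ (2 * l) * real n ^ (2 * l + 1)"
    by (simp add: power_add[symmetric] mult.assoc flip: power_Suc2)
  finally show ?thesis using n by (simp add: divide_le_eq)
qed

text \<open>\<open>a\<close> is a lower bound for \<open>A / n^(2l)\<close>, and both errors are
  controlled by \<open>n^(2l) / A \<le> 1 / a\<close> alone. The variance bound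
  \<open>3 A + n^(2l)\<close> over the squared mean gives \<open>3 / a + 1 / a\<^sup>2\<close>; the
  null second moment \<open>A\<close> over the squared threshold gives \<open>1 / a\<close>, up to
  factors in \<open>t\<close>.\<close>

lemma errors_le:
  assumes l: "2 \<le> l" and n: "0 < n" and lm: "0 < lam" "lam \<le> L" "0 < \<mu>" "\<mu> \<le> L" "1 \<le> L" and r: "0 < \<rho>" "\<rho> \<le> 1"
    and c: "c = L / sqrt (real n)" "c \<le> 1" and D: "real l * (3 * c * (env_bound + 2 * normal_bound)) \<le> 1"
    and g: "0 < \<gamma>" and N: "real n = \<gamma> * real N"
    and G: "(growth_const L \<gamma> * (1 + real l)\<^sup>2) ^ l \<le> sqrt (real n)"
    and big: "2 * l\<^sup>2 \<le> n" "2 * l\<^sup>2 \<le> N"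
    and W: "0 < c0" "0 < \<kappa>" "c0 * (\<kappa> * \<gamma>) ^ l \<le> (\<Sum>w\<in>words l. (word_weight lam \<mu> \<rho> l w)\<^sup>2)"
    and a: "a = c0 * \<kappa> ^ l / (4 * real l ^ 2)" and t: "0 < t" "t < 1"
  defines "h \<equiv> h_stat lam \<mu> \<rho> l n N"
  shows "\<P>(XY in law_P \<pi> lam \<mu> n N. h XY \<le> t * (\<integral>XY. h XY \<partial>law_P \<pi> lam \<mu> n N)) +
      \<P>(XY in law_Q n N. t * (\<integral>XY. h XY \<partial>law_P \<pi> lam \<mu> n N) \<le> h XY) \<le>
    (3 / a + 1 / a\<^sup>2) / (1 - t)\<^sup>2 + 1 / (t\<^sup>2 * a)"
proof -
  let ?A = "energy lam \<mu> \<rho> l n N" and ?H = "cycle_sum lam \<mu> \<rho> l n N"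
  define x where "x = real n ^ l"
  have x: "0 < x" using n by (simp add: x_def)
  have x2: "real n ^ (2 * l) = x\<^sup>2" by (simp add: x_def power_mult[symmetric] mult.commute)
  have N0: "0 < N" using n N by (cases "N = 0") auto
  have a0: "0 < a" unfolding a using W l by simp
  have A: "a * x\<^sup>2 \<le> ?A"
  proof -
    have "\<gamma> ^ l * real N ^ l = x" by (simp add: x_def N power_mult_distrib)
    then have "a * x\<^sup>2 = c0 * (\<kappa> * \<gamma>) ^ l * (real n ^ l * real N ^ l) / (4 * real l ^ 2)"
      unfolding a power_mult_distrib power2_eq_square x_def[symmetric] by (simp add: mult_ac)
    also have "\<dots> \<le> ?A"
      using energy_lower[OF l _ _ big W(3)] W g lm by simp
    finally show ?thesis .
  qed
  have A0: "0 < ?A" using A a0 x by (smt (verit) mult_pos_pos zero_less_power)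
  obtain k where k: "0 < k" "\<And>XY. h XY = k * ?H XY"
    using h_stat_eq_cycle_sum[OF l lm(1,3) r(1) n N0] unfolding h_def by blast
  have Eh: "(\<integral>XY. h XY \<partial>law_P \<pi> lam \<mu> n N) = k * (?A / x)"
    unfolding k(2) x_def using expectation_cycle_sum(3)[OF l n] by simp
  have thr: "h XY \<le> t * (\<integral>XY. h XY \<partial>law_P \<pi> lam \<mu> n N) \<longleftrightarrow> ?H XY \<le> t * (?A / x)"
    "t * (\<integral>XY. h XY \<partial>law_P \<pi> lam \<mu> n N) \<le> h XY \<longleftrightarrow> t * (?A / x) \<le> ?H XY" for XY
    unfolding Eh unfolding k(2) mult.left_commute[of t k]
    using k(1) by (simp_all only: mult_le_cancel_left_pos)
  have "\<P>(XY in law_P \<pi> lam \<mu> n N. ?H XY \<le> t * (?A / x)) \<le> (3 * ?A + x\<^sup>2) / ((1 - t) * (?A / x))\<^sup>2"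
    unfolding x_def
  proof (rule cycle_sum_type_II_error[OF l n A0 t(2)])
    have c0: "0 \<le> c" using lm c by simp
    have "(\<integral>XY. (?H XY)\<^sup>2 \<partial>law_P \<pi> lam \<mu> n N) - (\<integral>XY. ?H XY \<partial>law_P \<pi> lam \<mu> n N)\<^sup>2 \<le>
        diag_bound c l * ?A + x\<^sup>2"
      using variance_cycle_sum_le[OF l n _ lm(2) _ lm(4,5) _ r(2) c, of N] overlap_remainder_le[OF n g N lm(5) G] lm r
      unfolding x2 by auto
    also have "diag_bound c l * ?A \<le> 3 * ?A"
      using diag_bound_le[OF c0 D] A0 by (intro mult_right_mono) auto
    finally show "(\<integral>XY. (?H XY)\<^sup>2 \<partial>law_P \<pi> lam \<mu> n N) - (\<integral>XY. ?H XY \<partial>law_P \<pi> lam \<mu> n N)\<^sup>2 \<le>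
        3 * ?A + (real n ^ l)\<^sup>2" by (simp add: x_def)
  qed
  also have "\<dots> = (3 * (x\<^sup>2 / ?A) + (x\<^sup>2 / ?A)\<^sup>2) / (1 - t)\<^sup>2"
    using A0 x t by (simp add: field_simps power2_eq_square)
  also have "\<dots> \<le> (3 * (1 / a) + (1 / a)\<^sup>2) / (1 - t)\<^sup>2"
  proof -
    have "x\<^sup>2 / ?A \<le> 1 / a" using A A0 a0 by (simp add: field_simps)
    moreover have "0 \<le> x\<^sup>2 / ?A" using A0 by simp
    ultimately show ?thesis by (intro divide_right_mono add_mono mult_left_mono power_mono) auto
  qed
  finally have 1: "\<P>(XY in law_P \<pi> lam \<mu> n N. ?H XY \<le> t * (?A / x)) \<le> (3 / a + 1 / a\<^sup>2) / (1 - t)\<^sup>2"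
    by (simp add: power_divide)
  have "\<P>(XY in law_Q n N. t * (?A / x) \<le> ?H XY) \<le> ?A / (t * (?A / x))\<^sup>2"
    using A0 x t by (intro cycle_sum_type_I_error l) simp
  also have "\<dots> = x\<^sup>2 / ?A / t\<^sup>2" using A0 x t by (simp add: field_simps power2_eq_square)
  also have "\<dots> \<le> 1 / a / t\<^sup>2"
    using A A0 a0 by (intro divide_right_mono) (auto simp: field_simps)
  finally have 2: "\<P>(XY in law_Q n N. t * (?A / x) \<le> ?H XY) \<le> 1 / (t\<^sup>2 * a)" by (simp add: mult.commute)
  show ?thesis unfolding thr using 1 2 by linarith
qed

end

section \<open>The regime of cycle lengths\<close>

text \<open>Write \<open>X = ln n\<close> and \<open>Y = ln (ln n)\<close>. Since
  \<open>1 + l \<le> X\<close>, one has \<open>ln (1 + l) \<le> Y\<close>, and for large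
  \<open>n\<close> the logarithm of the left-hand side is at most \<open>3 l Y\<close>. With
  \<open>l \<le> X / (6 Y)\<close> this is at most \<open>X / 2\<close>, the logarithm of
  \<open>sqrt n\<close>.\<close>

lemma cycle_length_growth:
  fixes n l :: "nat \<Rightarrow> nat"
  assumes n: "filterlim n at_top sequentially"
    and l: "(\<lambda>k. real (l k)) \<in> o(\<lambda>k. ln (real (n k)) / ln (ln (real (n k))))"
    and K: "0 \<le> K" and l1: "eventually (\<lambda>k. 1 \<le> l k) sequentially"
  shows "eventually (\<lambda>k. (K * (1 + real (l k))\<^sup>2) ^ l k \<le> sqrt (real (n k))) sequentially"
proof -
  have x: "filterlim (\<lambda>k. ln (real (n k))) at_top sequentially"
    by (intro filterlim_compose[OF ln_at_top] filterlim_compose[OF filterlim_real_sequentially] n)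
  have y: "filterlim (\<lambda>k. ln (ln (real (n k)))) at_top sequentially"
    by (rule filterlim_compose[OF ln_at_top x])
  \<comment> \<open>Keeps the base positive, so that its logarithm can be taken when
    \<open>K\<close> is 0.\<close>
  define K' where "K' = max 1 K"
  have "eventually (\<lambda>k. norm (real (l k)) \<le> 1 / 6 * norm (ln (real (n k)) / ln (ln (real (n k))))) sequentially"
    using landau_o.smallD[OF l, of "1 / 6"] by simp
  moreover have "eventually (\<lambda>k. 1 \<le> ln (ln (real (n k)))) sequentially"
    "eventually (\<lambda>k. ln K' \<le> ln (ln (real (n k)))) sequentially"
    "eventually (\<lambda>k. 1 \<le> ln (real (n k))) sequentially"
    "eventually (\<lambda>k. 1 \<le> n k) sequentially"
    using x y n by (auto simp: filterlim_at_top)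
  ultimately show ?thesis using l1
  proof eventually_elim
    case (elim k)
    define X Y where "X = ln (real (n k))" "Y = ln (ln (real (n k)))"
    have Y: "1 \<le> Y" "ln K' \<le> Y" "Y = ln X" and X: "1 \<le> X" using elim by (auto simp: X_Y_def)
    have "0 < Y" using Y by simp
    moreover have "real (l k) \<le> X / (6 * Y)" using elim(1) X Y by (simp add: X_Y_def)
    ultimately have lX: "real (l k) * Y \<le> X / 6" by (simp add: le_divide_eq)
    have "real (l k) * 1 \<le> real (l k) * Y" using Y by (intro mult_left_mono) auto
    then have "1 + real (l k) \<le> X" using lX elim(6) X by linarith
    then have lnl: "ln (1 + real (l k)) \<le> Y" unfolding Y(3) by (intro ln_mono) auto
    have K': "1 \<le> K'" "K \<le> K'" by (auto simp: K'_def)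
    have pos: "0 < K' * (1 + real (l k))\<^sup>2" using K' by (intro mult_pos_pos) auto
    have "(K * (1 + real (l k))\<^sup>2) ^ l k \<le> (K' * (1 + real (l k))\<^sup>2) ^ l k"
      using K K' by (intro power_mono mult_right_mono) auto
    also have "\<dots> = exp (real (l k) * ln (K' * (1 + real (l k))\<^sup>2))"
      using pos by (simp add: exp_of_nat_mult)
    also have "\<dots> \<le> exp (X / 2)"
    proof -
      have "ln (K' * (1 + real (l k))\<^sup>2) = ln K' + 2 * ln (1 + real (l k))"
        using K' by (simp add: ln_mult ln_realpow)
      also have "\<dots> \<le> 3 * Y" using Y lnl by linarith
      finally have "real (l k) * ln (K' * (1 + real (l k))\<^sup>2) \<le> real (l k) * (3 * Y)"
        by (intro mult_left_mono) auto
      also have "\<dots> \<le> X / 2" using lX by simp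
      finally show ?thesis by simp
    qed
    also have "exp (X / 2) = sqrt (real (n k))"
      using elim(5) by (simp add: X_Y_def ln_sqrt[symmetric])
    finally show ?case .
  qed
qed

theorem theorem2p8:
  fixes lam \<mu> \<rho> \<gamma> \<epsilon> C c :: real
    and \<pi> :: "(real \<times> real) measure"
    and n N l :: "nat \<Rightarrow> nat"
  assumes "\<gamma> > 0" and "0 < \<rho>" and "\<rho> < 1" and "lam \<ge> 0" and "\<mu> \<ge> 0"
    and "lam^2 / \<gamma> \<le> 1" and "\<mu>^2 / \<gamma> \<le> 1"
    and "\<epsilon> > 0" and "F lam \<mu> \<rho> \<gamma> > 1 + \<epsilon>"
    and "prob_space \<pi>" and "sets \<pi> = sets (borel \<Otimes>\<^sub>M borel)"
    and "integrable \<pi> (\<lambda>p. fst p ^ 4)" and "integrable \<pi> (\<lambda>p. snd p ^ 4)"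
    and "(\<integral>p. fst p \<partial>\<pi>) = 0" and "(\<integral>p. snd p \<partial>\<pi>) = 0"
    and "(\<integral>p. (fst p)^2 \<partial>\<pi>) = 1" and "(\<integral>p. (snd p)^2 \<partial>\<pi>) = 1"
    and "(\<integral>p. fst p * snd p \<partial>\<pi>) = \<rho>"
    and "(\<integral>p. fst p ^ 4 \<partial>\<pi>) \<le> C" and "(\<integral>p. snd p ^ 4 \<partial>\<pi>) \<le> C"
    and "filterlim n at_top sequentially"
    and "\<And>k. real (n k) / real (N k) = \<gamma>"
    and "(\<lambda>k. real (l k)) \<in> \<omega>(\<lambda>_. 1)"
    and "(\<lambda>k. real (l k)) \<in> o(\<lambda>k. ln (real (n k)) / ln (ln (real (n k))))"
    and "0 < c" and "c < 1"
  shows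
    "let P = (\<lambda>k. law_P \<pi> lam \<mu> (n k) (N k));
         Q = (\<lambda>k. law_Q (n k) (N k));
         h = (\<lambda>k. h_stat lam \<mu> \<rho> (l k) (n k) (N k));
         \<tau> = (\<lambda>k. c * (\<integral>XY. h k XY \<partial>P k))
     in (\<lambda>k. \<P>(XY in P k. h k XY \<le> \<tau> k) + \<P>(XY in Q k. h k XY \<ge> \<tau> k)) \<longlonglongrightarrow> 0 \<and>
        strong_detection P Q (\<lambda>k XY. if h k XY \<ge> \<tau> k then 1 else 0)"
proof -
  interpret pair_law \<pi> \<rho> C
    by (intro pair_law.intro pair_law_axioms.intro assms)
  define L where "L = max 1 (max lam \<mu>)"
  have L: "lam \<le> L" "\<mu> \<le> L" "1 \<le> L" by (auto simp: L_def)
  have F1: "F lam \<mu> \<rho> \<gamma> > 1" using assms(8,9) by linarith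
  note f = F_gt_1_imp[OF assms(1-7) F1]
  have le: "lam^2 \<le> \<gamma>" "\<mu>^2 \<le> \<gamma>" using assms(1,6,7) by (auto simp: field_simps)
  obtain \<kappa> c0 where kc: "1 < \<kappa>" "0 < c0"
    "\<And>l. 1 \<le> l \<Longrightarrow> c0 * (\<kappa> * \<gamma>) ^ l \<le> (\<Sum>w\<in>words l. (word_weight lam \<mu> \<rho> l w)^2)"
    using word_weight_square_sum_lower[OF assms(1-3) f(1,2) le f(3)] by blast
  define a where "a = (\<lambda>k. c0 * \<kappa> ^ l k / (4 * real (l k) ^ 2))"
  define cc where "cc = (\<lambda>k. L / sqrt (real (n k)))"
  \<comment> \<open>Chosen so that the condition \<open>D\<close> below reads
    \<open>B * l \<le> sqrt n\<close>.\<close>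
  define B where "B = 3 * L * (env_bound + 2 * normal_bound)"
  define P where "P = (\<lambda>k. law_P \<pi> lam \<mu> (n k) (N k))"
  define Q where "Q = (\<lambda>k. law_Q (n k) (N k))"
  define h where "h = (\<lambda>k. h_stat lam \<mu> \<rho> (l k) (n k) (N k))"
  define \<tau> where "\<tau> = (\<lambda>k. c * (\<integral>XY. h k XY \<partial>P k))"
  \<comment> \<open>Division by 0 gives 0, so \<open>\<gamma> > 0\<close> excludes
    \<open>N k = 0\<close>.\<close>
  have N: "real (n k) = \<gamma> * real (N k)" for k
    using assms(1) assms(22)[of k] by (cases "N k = 0") (auto simp: field_simps)
  have l_top: "filterlim l at_top sequentially"
  proof -
    have "filterlim (\<lambda>k. real (l k)) at_top sequentially"
      unfolding filterlim_at_top
    proof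
      fix Z :: real
      show "\<forall>\<^sub>F k in sequentially. Z \<le> real (l k)"
        by (rule eventually_mono[OF landau_omega.smallD[OF assms(23), of "\<bar>Z\<bar> + 1"]]) auto
    qed
    then show ?thesis by (simp add: filterlim_sequentially_iff_filterlim_real)
  qed
  \<comment> \<open>Used twice: with \<open>growth_const\<close> it controls the overlap remainder,
    with \<open>1 + B\<close> it supplies polynomial bounds on \<open>l\<close>.\<close>
  have growth: "\<forall>\<^sub>F k in sequentially. (K * (1 + real (l k))\<^sup>2) ^ l k \<le> sqrt (real (n k))" if "0 \<le> K" for K
    using l_top by (intro cycle_length_growth assms that) (auto simp: filterlim_at_top)
  have n_top: "filterlim (\<lambda>k. sqrt (real (n k))) at_top sequentially"
    by (intro filterlim_compose[OF sqrt_at_top] filterlim_compose[OF filterlim_real_sequentially] assms)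
  have G0: "0 \<le> growth_const L \<gamma>"
    using assms(1) env_bound_ge_1 by (simp add: growth_const_def pair_const_def)
  have B0: "0 \<le> B" using L env_bound_ge_1 normal_bound_ge_1 by (simp add: B_def)
  have ev: "\<forall>\<^sub>F k in sequentially. \<P>(XY in P k. h k XY \<le> \<tau> k) + \<P>(XY in Q k. \<tau> k \<le> h k XY) \<le>
      (3 / a k + 1 / (a k)\<^sup>2) / (1 - c)\<^sup>2 + 1 / (c\<^sup>2 * a k)"
  proof -
    have "\<forall>\<^sub>F k in sequentially. 2 \<le> l k" "\<forall>\<^sub>F k in sequentially. 1 \<le> n k"
      using l_top assms(21) by (auto simp: filterlim_at_top)
    moreover have "\<forall>\<^sub>F k in sequentially. Z \<le> sqrt (real (n k))" for Z
      using n_top by (auto simp: filterlim_at_top)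
    note this[of L] this[of B] this[of 2] this[of "2 * \<gamma>"]
    ultimately show ?thesis using growth[OF G0] growth[OF add_nonneg_nonneg[OF zero_le_one B0]]
    proof eventually_elim
      case (elim k)
      define s where "s = sqrt (real (n k))"
      have s: "s\<^sup>2 = real (n k)" "L \<le> s" "B \<le> s" "2 \<le> s" "2 * \<gamma> \<le> s" using elim by (auto simp: s_def)
      \<comment> \<open>A base that is at least 1 is at most its power with exponent
        \<open>l k\<close>, so the growth bound also dominates the base itself. From this follow
        \<open>ls\<close> and \<open>lB\<close>, hence \<open>big1\<close>, \<open>big2\<close> and
        \<open>D\<close>; the last one compares \<open>l\<close> with \<open>sqrt n\<close>, which
        is why the growth bound is stated with a square root.\<close>
      have key: "(1 + B) * (1 + real (l k))\<^sup>2 \<le> s"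
      proof -
        have "1 * 1 \<le> (1 + B) * (1 + real (l k))\<^sup>2"
          using B0 by (intro mult_mono one_le_power) auto
        then have "(1 + B) * (1 + real (l k))\<^sup>2 \<le> ((1 + B) * (1 + real (l k))\<^sup>2) ^ l k"
          using elim(1) by (intro self_le_power) auto
        also have "\<dots> \<le> s" using elim(8) by (simp add: s_def)
        finally show ?thesis .
      qed
      have ls: "real (l k) ^ 2 \<le> s"
      proof -
        have "1 * real (l k) ^ 2 \<le> (1 + B) * (1 + real (l k))\<^sup>2"
          using B0 by (intro mult_mono power_mono) auto
        then show ?thesis using key by simp
      qed
      have lB: "B * real (l k) \<le> s"
      proof -
        have "real (l k) \<le> (1 + real (l k))\<^sup>2" by (simp add: power2_eq_square algebra_simps)
        then have "B * real (l k) \<le> (1 + B) * (1 + real (l k))\<^sup>2"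
          using B0 by (intro mult_mono) auto
        then show ?thesis using key by simp
      qed
      have "2 * real (l k) ^ 2 \<le> s * s" using ls s by (intro mult_mono) auto
      then have "real (2 * (l k)\<^sup>2) \<le> real (n k)" using s(1) by (simp add: power2_eq_square)
      then have big1: "2 * (l k)\<^sup>2 \<le> n k" by linarith
      have "2 * \<gamma> * real (l k) ^ 2 \<le> s * s" using ls s assms(1) by (intro mult_mono) auto
      then have "\<gamma> * real (2 * (l k)\<^sup>2) \<le> \<gamma> * real (N k)" using s(1) N[of k] by (simp add: power2_eq_square)
      then have "real (2 * (l k)\<^sup>2) \<le> real (N k)" using assms(1) by (simp only: mult_le_cancel_left_pos)
      then have big2: "2 * (l k)\<^sup>2 \<le> N k" by linarith
      have cc1: "cc k \<le> 1" using s by (simp add: cc_def s_def[symmetric] divide_le_eq)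
      have D: "real (l k) * (3 * cc k * (env_bound + 2 * normal_bound)) \<le> 1"
      proof -
        have "real (l k) * (3 * cc k * (env_bound + 2 * normal_bound)) = B * real (l k) / s"
          by (simp add: B_def cc_def s_def)
        then show ?thesis using lB s(4) by (simp add: divide_le_eq)
      qed
      have pos: "0 < n k" "0 < \<kappa>" "1 \<le> l k" "\<rho> \<le> 1" using elim(1,2) kc(1) assms(3) by auto
      show ?case
        unfolding P_def Q_def h_def \<tau>_def
        by (rule errors_le[OF elim(1) pos(1) f(1) L(1) f(2) L(2,3) assms(2) pos(4) cc_def[THEN fun_cong] cc1 D
              assms(1) N elim(7) big1 big2 kc(2) pos(2) kc(3)[OF pos(3)] a_def[THEN fun_cong] assms(25,26)])
    qed
  qed
  have a_top: "filterlim a at_top sequentially"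
  proof -
    have "filterlim (\<lambda>m :: nat. c0 * \<kappa> ^ m / (4 * real m ^ 2)) at_top sequentially"
      using kc(1,2) by real_asymp
    from filterlim_compose[OF this l_top] show ?thesis by (simp add: a_def)
  qed
  have "((\<lambda>x. (3 / x + 1 / x\<^sup>2) / (1 - c)\<^sup>2 + 1 / (c\<^sup>2 * x)) \<longlongrightarrow> 0) at_top"
    using assms(25,26) by real_asymp
  from filterlim_compose[OF this a_top]
  have lim: "(\<lambda>k. (3 / a k + 1 / (a k)\<^sup>2) / (1 - c)\<^sup>2 + 1 / (c\<^sup>2 * a k)) \<longlonglongrightarrow> 0" .
  have errors: "(\<lambda>k. \<P>(XY in P k. h k XY \<le> \<tau> k) + \<P>(XY in Q k. \<tau> k \<le> h k XY)) \<longlonglongrightarrow> 0"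
    by (rule tendsto_sandwich[OF _ ev tendsto_const lim]) (auto intro!: always_eventually)
  have hP [measurable]: "h k \<in> borel_measurable (P k)" for k
    unfolding h_def P_def law_P_eq by (simp add: measurable_h_stat)
  have hQ [measurable]: "h k \<in> borel_measurable (Q k)" for k
    unfolding h_def Q_def by (simp add: measurable_cong_sets[OF sets_law_Q refl] measurable_h_stat)
  have "strong_detection P Q (\<lambda>k XY. if h k XY \<ge> \<tau> k then 1 else 0)"
    unfolding strong_detection_def
  proof (intro conjI allI)
    fix k
    show "(\<lambda>XY. if \<tau> k \<le> h k XY then 1 else 0) \<in> P k \<rightarrow>\<^sub>M count_space {0, 1}"
      by (intro measurable_If measurable_const) auto
    show "(\<lambda>XY. if \<tau> k \<le> h k XY then 1 else 0) \<in> Q k \<rightarrow>\<^sub>M count_space {0, 1}"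
      by (intro measurable_If measurable_const) auto
  next
    \<comment> \<open>The test outputs 0 only if \<open>h < \<tau>\<close>, part of the first error
      event; the boundary \<open>h = \<tau>\<close> is counted in both events of the stronger
      statement.\<close>
    have "\<P>(XY in P k. (if \<tau> k \<le> h k XY then 1 else 0) = (0::nat)) \<le> \<P>(XY in P k. h k XY \<le> \<tau> k)" for k
    proof -
      interpret Pk: prob_space "P k" unfolding P_def by (rule prob_space_law_P)
      show ?thesis by (intro Pk.finite_measure_mono) auto
    qed
    moreover have "\<P>(XY in Q k. (if \<tau> k \<le> h k XY then 1 else 0) = (1::nat)) = \<P>(XY in Q k. \<tau> k \<le> h k XY)" for k
      by (intro arg_cong2[where f = measure] Collect_cong refl) auto
    ultimately show "(\<lambda>k. \<P>(XY in P k. (if \<tau> k \<le> h k XY then 1 else 0) = (0::nat)) +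
        \<P>(XY in Q k. (if \<tau> k \<le> h k XY then 1 else 0) = (1::nat))) \<longlonglongrightarrow> 0"
      by (intro tendsto_sandwich[OF _ _ tendsto_const errors]) (auto intro!: always_eventually)
  qed
  with errors have "(\<lambda>k. \<P>(XY in P k. h k XY \<le> \<tau> k) + \<P>(XY in Q k. \<tau> k \<le> h k XY)) \<longlonglongrightarrow> 0 \<and>
      strong_detection P Q (\<lambda>k XY. if h k XY \<ge> \<tau> k then 1 else 0)" by blast
  then show ?thesis
    unfolding Let_def P_def Q_def \<tau>_def h_def .
qed

end
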